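(* Let $\Omega$ be a (one-dimensional, FLC, minimal) uniquely ergodic tiling space. Suppose that $F\in\mathcal F(\Omega)$, that the rotation class $[\mu]$ of $F$ exists and is irrational, and that $[\mu]\in\mathbb R\,dx\oplus H^1_{AN}(\Omega,\mathbb R)\subset H^1(\Omega,\mathbb R)$. Then $F$ is semi-conjugate to a uniform translation on $\Omega$.
   Context: Tilings: A tile is a pair $(I,\ell)$, with $I\subset\mathbb R$ a closed bounded interval of positive length and $\ell$ a label from a finite alphabet; tiles with the same label have the same length. $(I,\ell)-s=(I-s,\ell)$. A tiling $T$ is a collection of tiles meeting only at boundaries with union $\mathbb R$; $T-s$ is obtained by translating all tiles, and $\Gamma_s(T)=T-s$. (Such tilings have finite local complexity, FLC.) $d(T,T')$ is the infimum of the $\epsilon\in(0,1)$ for which there are $|s_1|,|s_2|\le\epsilon/2$ with $T-s_1$ and $T'-s_2$ agreeing exactly on $[-\epsilon^{-1},\epsilon^{-1}]$ ($1$ if there is none). $T$ is repetitive if for each finite pattern $P$ of $T$ there is $L_P$ such that every interval of length $L_P$ in $T$ contains a copy of $P$. A tiling space $\Omega$ is the closure of the translation orbit $\{T-s\}$ of a repetitive non-periodic tiling; it is compact, minimal under $\Gamma$, and its path components are the translation orbits. Uniquely ergodic means that $(\Omega,\Gamma)$ has a unique invariant probability measure. The orbit of a reference tiling $T\in\Omega$ is identified with $\mathbb R$ by $T-x\leftrightarrow x$. Pattern equivariance and cohomology: A continuous $\phi:\mathbb R\to\mathbb R$ is pattern equivariant (PE) with radius $R$ with respect to $T$ if $\phi(x_1)=\phi(x_2)$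 whenever $T-x_1$ and $T-x_2$ agree exactly on $[-R,R]$; it is strongly PE (sPE) if this holds for some $R>0$, and weakly PE (wPE) if it is a uniform limit of sPE functions. A continuous $G:\Omega\to\mathbb R$ is sPE if $x\mapsto G(T-x)$ is sPE with respect to $T$ (for one, equivalently every, $T\in\Omega$). An sPE 1-form with respect to $T$ is $g(x)\,dx$ with $g$ sPE. $H^1(\Omega,\mathbb R)$ is $\{\text{sPE 1-forms}\}/d\{\text{sPE functions}\}$, which is isomorphic to the Čech cohomology $\check H^1(\Omega,\mathbb R)$; $[\mu]$ is the class of $\mu$, and forms with the same class are called cohomologous. A class $[\alpha]$ is asymptotically negligible if $\alpha=dg$ for some wPE function $g$; these classes form the subspace $H^1_{AN}(\Omega,\mathbb R)$. $\mathbb R\,dx$ is the line spanned by $[dx]$. Maps: $\mathcal F(\Omega)$ is the set of homeomorphisms $F:\Omega\to\Omega$, homotopic to the identity, such that the displacement $\Phi:\Omega\to\mathbb R$, defined by $F(T)=T-\Phi(T)$, is sPE. For a reference tiling $T$, $f_T:\mathbb R\to\mathbb R$ is given by $F(T-x)=T-f_T(x)$. Rotation forms: An sPE 1-form $\mu$ (with respect to a reference tiling $T$) is a rotation form for $F$ if there is $R$ such that, for all $x_1,x_2\in\mathbb R$ for which $T-x_1$ and $T-x_2$ agree on the ball of radius $R$ about the origin, and all integers $n_\pm$ with $n_-<\int_{x_1}^{x_2}\mu<n_+$, the point $x_2$ is strictly between $f_T^{n_-}(x_1)$ and $f_T^{n_+}(x_1)$. Any form cohomologous to a rotation form is a rotation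 form, and $[\mu]$ is then called a rotation class. Shape change and irrationality: Let $\mu$ be a positive sPE 1-form of radius $R$ with respect to $T$. Relabel (collar) the tiles of $T$ so that the label of each tile records the pattern of $T$ around it out to distance $R$; this does not change the space up to translation-commuting homeomorphism. Let $T'$ be obtained by keeping labels and moving each vertex $x$ of $T$ to $\int_0^x\mu$. The orbit closure $\Omega_\mu$ of $T'$ is the shape change of $\Omega$ by $\mu$, and $T-x\mapsto T'-\int_0^x\mu$ extends to a homeomorphism $S:\Omega\to\Omega_\mu$. Shape changes by negative forms are defined similarly (and reverse orientation). A class is irrational if it is represented by a positive (or negative) sPE 1-form $\mu$ such that $\Omega_\mu$ is minimal under the action of $\Gamma_1$ (translation by $1$); this does not depend on the choice of representative. Semi-conjugacy: $F$ on $\Omega$ is semi-conjugate to $F'$ on $\Omega'$ if there is a continuous map $H:\Omega\to\Omega'$ with $F'\circ H=H\circ F$. A uniform translation on $\Omega$ is a map $\Gamma_\rho$ with $\rho\ne0$. *)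

theory Defs
  imports "HOL-Probability.Probability"
begin

subsection \<open>Tilings of the line\<close>

type_synonym 'l tile = "real set \<times> 'l"
type_synonym 'l tiling = "'l tile set"

definition is_tile :: "'l tile \<Rightarrow> bool" where
  "is_tile t \<longleftrightarrow> (\<exists>a b. a < b \<and> fst t = {a..b})"

text \<open>The alphabet of a tiling is the set of labels that occur in it, not the whole label type:
  collaring produces labels in an infinite type, of which only finitely many occur.\<close>

definition is_tiling :: "'l tiling \<Rightarrow> bool" where
  "is_tiling T \<longleftrightarrow>
     (\<forall>t\<in>T. is_tile t) \<and>
     finite (snd ` T) \<and>
     (\<forall>a b c d l. ({a..b}, l) \<in> T \<and> ({c..d}, l) \<in> T \<longrightarrow> b - a = d - c) \<and>
     (\<forall>t\<in>T. \<forall>t'\<in>T. t \<noteq> t' \<longrightarrow> fst t \<inter> fst t' \<subseteq> frontier (fst t) \<inter> frontier (fst t')) \<and>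
     (\<Union>t\<in>T. fst t) = UNIV"

definition translate_tile :: "real \<Rightarrow> 'l tile \<Rightarrow> 'l tile" where
  "translate_tile s t = ((\<lambda>x. x - s) ` fst t, snd t)"

text \<open>\<open>translate s\<close> is $\Gamma_s$, that is, $T \mapsto T - s$.\<close>

definition translate :: "real \<Rightarrow> 'l tiling \<Rightarrow> 'l tiling" where
  "translate s T = translate_tile s ` T"

definition patch :: "real set \<Rightarrow> 'l tiling \<Rightarrow> 'l tiling" where
  "patch B T = {t \<in> T. fst t \<inter> B \<noteq> {}}"

definition agree_on :: "real set \<Rightarrow> 'l tiling \<Rightarrow> 'l tiling \<Rightarrow> bool" where
  "agree_on B T T' \<longleftrightarrow> patch B T = patch B T'"

definition tiling_close :: "'l tiling \<Rightarrow> 'l tiling \<Rightarrow> real \<Rightarrow> bool" where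
  "tiling_close T T' e \<longleftrightarrow>
     (\<exists>s1 s2. \<bar>s1\<bar> \<le> e / 2 \<and> \<bar>s2\<bar> \<le> e / 2 \<and>
        agree_on {- inverse e..inverse e} (translate s1 T) (translate s2 T'))"

definition tiling_dist :: "'l tiling \<Rightarrow> 'l tiling \<Rightarrow> real" where
  "tiling_dist T T' =
     (let E = {e. 0 < e \<and> e < 1 \<and> tiling_close T T' e} in if E = {} then 1 else Inf E)"

lemma translate_tile_translate_tile:
  "translate_tile s (translate_tile r t) = translate_tile (r + s) t"
  by (simp add: translate_tile_def image_image algebra_simps)

lemma translate_tile_0 [simp]: "translate_tile 0 t = t"
  by (simp add: translate_tile_def)

lemma translate_translate: "translate s (translate r T) = translate (r + s) T"
  by (simp add: translate_def image_image translate_tile_translate_tile)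

lemma translate_0 [simp]: "translate 0 T = T"
  by (simp add: translate_def)

lemma patch_translate: "patch B (translate s T) = translate s (patch ((\<lambda>x. x + s) ` B) T)"
proof -
  have "fst (translate_tile s t) \<inter> B \<noteq> {} \<longleftrightarrow> fst t \<inter> (\<lambda>x. x + s) ` B \<noteq> {}" for t :: "'a tile"
    by (force simp: translate_tile_def)
  then show ?thesis unfolding patch_def translate_def by blast
qed

lemma agree_on_translate:
  assumes "agree_on {-r..r} T T'" "\<bar>s\<bar> \<le> r - q"
  shows "agree_on {-q..q} (translate s T) (translate s T')"
proof -
  have "patch B T = patch B T'" if "B \<subseteq> {-r..r}" for B
  proof -
    have "patch B U = patch B (patch {-r..r} U)" for U :: "'a tiling"
      using that by (fastforce simp: patch_def)
    then show ?thesis using assms(1) by (metis agree_on_def)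
  qed
  moreover have "(\<lambda>x. x + s) ` {-q..q} \<subseteq> {-r..r}"
    using assms(2) by auto
  ultimately show ?thesis by (simp add: agree_on_def patch_translate)
qed

lemma tiling_dist_le:
  assumes "0 < e" "tiling_close T T' e" shows "tiling_dist T T' \<le> e"
proof -
  let ?E = "{e. 0 < e \<and> e < 1 \<and> tiling_close T T' e}"
  have bdd: "bdd_below ?E" by (rule bdd_belowI[of _ 0]) auto
  show ?thesis
  proof (cases "e < 1")
    case True
    then have "e \<in> ?E" using assms by auto
    then show ?thesis using cInf_lower[OF _ bdd] by (auto simp: tiling_dist_def Let_def)
  next
    case False
    have "tiling_dist T T' \<le> 1"
    proof (cases "?E = {}")
      case False
      then obtain x where "x \<in> ?E" by blast
      then show ?thesis using cInf_lower[OF _ bdd, of x] False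
        by (auto simp: tiling_dist_def Let_def)
    qed (simp add: tiling_dist_def)
    then show ?thesis using False by simp
  qed
qed

lemma tiling_dist_le_1: "tiling_dist T T' \<le> 1"
proof (cases "{e. 0 < e \<and> e < 1 \<and> tiling_close T T' e} = {}")
  case False
  then show ?thesis using tiling_dist_le[of _ T T'] by force
qed (simp add: tiling_dist_def)

lemma tiling_dist_nonneg: "0 \<le> tiling_dist T T'"
  by (auto simp: tiling_dist_def Let_def intro!: cInf_greatest)

lemma tiling_dist_lessD:
  assumes "tiling_dist T T' < d" "d \<le> 1"
  obtains e where "0 < e" "e < d" "tiling_close T T' e"
proof -
  let ?E = "{e. 0 < e \<and> e < 1 \<and> tiling_close T T' e}"
  have ne: "?E \<noteq> {}"
  proof
    assume "?E = {}"
    then have "tiling_dist T T' = 1" by (simp only: tiling_dist_def Let_def if_True simp_thms)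
    then show False using assms by simp
  qed
  then have "tiling_dist T T' = Inf ?E" by (simp only: tiling_dist_def Let_def if_False)
  then have "Inf ?E < d" using assms by simp
  then obtain e where "e \<in> ?E" "e < d" using cInf_lessD[OF ne] by blast
  then show thesis using that by auto
qed

lemma tiling_close_sym: "tiling_close T T' e \<Longrightarrow> tiling_close T' T e"
  unfolding tiling_close_def agree_on_def by metis

lemma tiling_dist_sym: "tiling_dist T T' = tiling_dist T' T"
proof -
  have "tiling_close T T' = tiling_close T' T" using tiling_close_sym by blast
  then show ?thesis by (simp add: tiling_dist_def)
qed

lemma tiling_close_trans:
  assumes "tiling_close T U e" "tiling_close U V d" "0 < e" "0 < d" "e + d < 1"
  shows "tiling_close T V (e + d)"
proof -
  obtain s1 s2 where s: "\<bar>s1\<bar> \<le> e / 2" "\<bar>s2\<bar> \<le> e / 2"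
    "agree_on {- inverse e..inverse e} (translate s1 T) (translate s2 U)"
    using assms(1) by (auto simp: tiling_close_def)
  obtain r1 r2 where r: "\<bar>r1\<bar> \<le> d / 2" "\<bar>r2\<bar> \<le> d / 2"
    "agree_on {- inverse d..inverse d} (translate r1 U) (translate r2 V)"
    using assms(2) by (auto simp: tiling_close_def)
  have key: "y / 2 \<le> inverse x - inverse (x + y)" if "0 < x" "0 < y" "x + y < 1" for x y :: real
  proof -
    have "x * (x + y) \<le> 1 * 1" using that by (intro mult_mono) auto
    then have "y / 2 \<le> y / (x * (x + y))" using that by (intro divide_left_mono) auto
    also have "\<dots> = inverse x - inverse (x + y)" using that by (simp add: divide_simps)
    finally show ?thesis .
  qed
  have "agree_on {- inverse (e + d)..inverse (e + d)} (translate (s1 + r1) T) (translate (s2 + r1) U)"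
    using agree_on_translate[OF s(3), of r1] r(1) key[of e d] assms by (force simp: translate_translate)
  moreover have "agree_on {- inverse (e + d)..inverse (e + d)} (translate (r1 + s2) U) (translate (r2 + s2) V)"
    using agree_on_translate[OF r(3), of s2] s(2) key[of d e] assms
    by (force simp: translate_translate add.commute)
  ultimately have "agree_on {- inverse (e + d)..inverse (e + d)}
      (translate (s1 + r1) T) (translate (r2 + s2) V)"
    by (simp add: agree_on_def add.commute)
  moreover have "\<bar>s1 + r1\<bar> \<le> (e + d) / 2" using s(1) r(1) abs_triangle_ineq[of s1 r1] by argo
  moreover have "\<bar>r2 + s2\<bar> \<le> (e + d) / 2" using s(2) r(2) abs_triangle_ineq[of r2 s2] by argo
  ultimately show ?thesis unfolding tiling_close_def by blast
qed

lemma tiling_dist_triangle: "tiling_dist T V \<le> tiling_dist T U + tiling_dist U V"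
proof (rule ccontr)
  assume "\<not> ?thesis"
  then have lt: "tiling_dist T U + tiling_dist U V < tiling_dist T V" by simp
  define h where "h = (tiling_dist T V - tiling_dist T U - tiling_dist U V) / 2"
  have h: "0 < h" using lt by (simp add: h_def)
  have *: "tiling_dist T U + h + (tiling_dist U V + h) = tiling_dist T V"
    by (simp add: h_def field_simps)
  note nn = tiling_dist_nonneg[of T U] tiling_dist_nonneg[of U V]
  have le: "tiling_dist T U + h \<le> 1" "tiling_dist U V + h \<le> 1"
    using * nn h tiling_dist_le_1[of T V] by linarith+
  obtain e where e: "0 < e" "e < tiling_dist T U + h" "tiling_close T U e"
    using tiling_dist_lessD[of T U "tiling_dist T U + h"] h le by auto
  obtain d where d: "0 < d" "d < tiling_dist U V + h" "tiling_close U V d"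
    using tiling_dist_lessD[of U V "tiling_dist U V + h"] h le by auto
  have "e + d < tiling_dist T V" using e d * by linarith
  moreover have "tiling_close T V (e + d)"
    using tiling_close_trans[OF e(3) d(3)] e d calculation tiling_dist_le_1[of T V] by linarith
  ultimately show False using tiling_dist_le[of "e + d" T V] e d by linarith
qed

lemma tiling_dist_self: "tiling_dist T T = 0"
proof -
  have "tiling_dist T T \<le> e" if "0 < e" for e
  proof (rule tiling_dist_le[OF that])
    show "tiling_close T T e" unfolding tiling_close_def agree_on_def
      using that by (intro exI[of _ 0]) auto
  qed
  then have "tiling_dist T T \<le> 0" by (metis dense not_le)
  then show ?thesis using tiling_dist_nonneg[of T T] by simp
qed

lemma translated_tile_unique:
  assumes "is_tiling T" "({a..b}, l) \<in> T" "({a - r..b - r}, l) \<in> T" "\<bar>r\<bar> < b - a"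
  shows "r = 0"
proof (rule ccontr)
  assume r: "r \<noteq> 0"
  have ab: "a < b" using assms(4) by auto
  have "({a..b}, l) \<noteq> ({a - r..b - r}, l)" using r ab by (simp add: Icc_eq_Icc)
  then have sub: "{a..b} \<inter> {a - r..b - r} \<subseteq> frontier {a..b}"
    using assms(1-3) unfolding is_tiling_def by (metis fst_conv le_inf_iff)
  define c where "c = (a + b - r) / 2"
  have c: "a < c" "c < b" "a - r \<le> c" "c \<le> b - r"
    using assms(4) unfolding c_def by (auto simp: abs_less_iff)
  then have "c \<in> frontier {a..b}" using sub by (meson IntI atLeastAtMost_iff less_imp_le subsetD)
  then show False using c by (auto simp: frontier_def)
qed

lemma tiling_dist_0_subset:
  assumes T: "is_tiling T" and T': "is_tiling T'" and 0: "tiling_dist T T' = 0"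
  shows "T \<subseteq> T'"
proof
  fix t assume t: "t \<in> T"
  obtain a b l where ab: "t = ({a..b}, l)" "a < b"
    using T t unfolding is_tiling_def is_tile_def by (metis prod.collapse)
  obtain e0 where e0: "0 < e0" "e0 \<le> 1" "e0 \<le> (b - a) / 3" "e0 \<le> inverse (\<bar>a\<bar> + 1)"
  proof
    show "0 < min 1 (min ((b - a) / 3) (inverse (\<bar>a\<bar> + 1)))" using ab by simp
  qed (rule min.cobounded1 min.coboundedI2 order_refl)+
  have ex: "\<exists>r. \<bar>r\<bar> \<le> d \<and> ({a - r..b - r}, l) \<in> T'" if d: "0 < d" "d \<le> e0" for d
  proof -
    have "tiling_dist T T' < d" "d \<le> 1" using 0 d e0 by auto
    from tiling_dist_lessD[OF this] obtain e
      where e: "0 < e" "e < d" "tiling_close T T' e" .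
    then obtain s1 s2 where s: "\<bar>s1\<bar> \<le> e / 2" "\<bar>s2\<bar> \<le> e / 2"
      "agree_on {- inverse e..inverse e} (translate s1 T) (translate s2 T')"
      by (auto simp: tiling_close_def)
    have "\<bar>a\<bar> + 1 \<le> inverse e"
    proof -
      have "e \<le> inverse (\<bar>a\<bar> + 1)" using e d e0 by linarith
      then have "inverse (inverse (\<bar>a\<bar> + 1)) \<le> inverse e" using e by (intro le_imp_inverse_le) auto
      then show ?thesis by simp
    qed
    then have "a - s1 \<in> {- inverse e..inverse e}" using s e d e0 by (auto simp: abs_le_iff)
    moreover have im: "translate_tile s1 t = ({a - s1..b - s1}, l)"
      by (simp add: translate_tile_def ab)
    ultimately have "translate_tile s1 t \<in> patch {- inverse e..inverse e} (translate s1 T)"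
      using imageI[OF t, of "translate_tile s1"] ab unfolding patch_def translate_def by auto
    then have "({a - s1..b - s1}, l) \<in> translate s2 T'"
      using s(3) im by (auto simp: agree_on_def patch_def)
    then have "translate_tile (- s2) ({a - s1..b - s1}, l) \<in> translate (- s2) (translate s2 T')"
      unfolding translate_def by blast
    then have "({a - (s1 - s2)..b - (s1 - s2)}, l) \<in> T'"
      by (simp add: translate_translate translate_tile_def algebra_simps)
    moreover have "\<bar>s1 - s2\<bar> \<le> d" using s e by (auto simp: abs_le_iff)
    ultimately show ?thesis by blast
  qed
  obtain r where r: "\<bar>r\<bar> \<le> e0" "({a - r..b - r}, l) \<in> T'" using ex[of e0] e0 by auto
  have "r = 0"
  proof (rule ccontr)
    assume "r \<noteq> 0"
    then obtain q where q: "\<bar>q\<bar> \<le> min (\<bar>r\<bar> / 2) e0" "({a - q..b - q}, l) \<in> T'"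
      using ex[of "min (\<bar>r\<bar> / 2) e0"] e0 by auto
    have "({(a - r) - (q - r)..(b - r) - (q - r)}, l) \<in> T'" using q by simp
    moreover have "\<bar>q - r\<bar> < (b - r) - (a - r)" using q r e0 ab by (auto simp: abs_less_iff)
    ultimately have "q - r = 0" using translated_tile_unique[OF T' r(2)] by blast
    then show False using q \<open>r \<noteq> 0\<close> by auto
  qed
  then show "t \<in> T'" using r ab by simp
qed

interpretation tiling: Metric_space "Collect is_tiling" tiling_dist
proof
  show "(tiling_dist T T' = 0) = (T = T')" if "T \<in> Collect is_tiling" "T' \<in> Collect is_tiling"
    for T T' :: "'a tiling"
    using that tiling_dist_0_subset[of T T'] tiling_dist_0_subset[of T' T]
    by (auto simp: tiling_dist_self tiling_dist_sym[of T' T])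
qed (use tiling_dist_nonneg tiling_dist_sym tiling_dist_triangle in blast)+

definition tiling_topology :: "'l tiling topology" where
  "tiling_topology = Metric_space.mtopology (Collect is_tiling) tiling_dist"


subsection \<open>Tiling spaces\<close>

definition repetitive :: "'l tiling \<Rightarrow> bool" where
  "repetitive T \<longleftrightarrow>
     (\<forall>P. finite P \<and> P \<subseteq> T \<longrightarrow>
        (\<exists>L>0. \<forall>x. \<exists>s. translate s P \<subseteq> T \<and> (\<Union>t\<in>translate s P. fst t) \<subseteq> {x..x + L}))"

definition nonperiodic :: "'l tiling \<Rightarrow> bool" where
  "nonperiodic T \<longleftrightarrow> (\<forall>p. p \<noteq> 0 \<longrightarrow> translate p T \<noteq> T)"

definition orbit_closure :: "'l tiling \<Rightarrow> 'l tiling set" where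
  "orbit_closure T = tiling_topology closure_of (range (\<lambda>s. translate s T))"

definition tiling_space :: "'l tiling set \<Rightarrow> bool" where
  "tiling_space \<Omega> \<longleftrightarrow>
     (\<exists>T. is_tiling T \<and> repetitive T \<and> nonperiodic T \<and> \<Omega> = orbit_closure T)"

definition space_topology :: "'l tiling set \<Rightarrow> 'l tiling topology" where
  "space_topology \<Omega> = subtopology tiling_topology \<Omega>"

definition space_borel :: "'l tiling set \<Rightarrow> 'l tiling measure" where
  "space_borel \<Omega> = sigma \<Omega> {U. openin (space_topology \<Omega>) U}"

definition uniquely_ergodic :: "'l tiling set \<Rightarrow> bool" where
  "uniquely_ergodic \<Omega> \<longleftrightarrow>
     (\<exists>!M. prob_space M \<and> sets M = sets (space_borel \<Omega>) \<and> (\<forall>s. distr M M (translate s) = M))"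

definition minimal_map :: "'a topology \<Rightarrow> ('a \<Rightarrow> 'a) \<Rightarrow> bool" where
  "minimal_map X f \<longleftrightarrow> (\<forall>A. closedin X A \<and> f ` A = A \<and> A \<noteq> {} \<longrightarrow> A = topspace X)"


subsection \<open>Pattern equivariance and cohomology\<close>

definition PE_radius :: "'l tiling \<Rightarrow> real \<Rightarrow> (real \<Rightarrow> real) \<Rightarrow> bool" where
  "PE_radius T R \<phi> \<longleftrightarrow> continuous_on UNIV \<phi> \<and>
     (\<forall>x1 x2. agree_on {-R..R} (translate x1 T) (translate x2 T) \<longrightarrow> \<phi> x1 = \<phi> x2)"

definition sPE :: "'l tiling \<Rightarrow> (real \<Rightarrow> real) \<Rightarrow> bool" where
  "sPE T \<phi> \<longleftrightarrow> (\<exists>R>0. PE_radius T R \<phi>)"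

definition wPE :: "'l tiling \<Rightarrow> (real \<Rightarrow> real) \<Rightarrow> bool" where
  "wPE T \<phi> \<longleftrightarrow> (\<exists>\<psi>. (\<forall>n. sPE T (\<psi> n)) \<and> uniform_limit UNIV \<psi> \<phi> sequentially)"

definition sPE_on_space :: "'l tiling set \<Rightarrow> ('l tiling \<Rightarrow> real) \<Rightarrow> bool" where
  "sPE_on_space \<Omega> G \<longleftrightarrow> continuous_map (space_topology \<Omega>) euclideanreal G \<and>
     (\<exists>T\<in>\<Omega>. sPE T (\<lambda>x. G (translate x T)))"

text \<open>An sPE 1-form $g(x)\,dx$ is represented by its coefficient function $g$, and
  $dh = g\,dx$ means that $h$ is differentiable with derivative $g$.\<close>

definition is_d :: "(real \<Rightarrow> real) \<Rightarrow> (real \<Rightarrow> real) \<Rightarrow> bool" where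
  "is_d h g \<longleftrightarrow> (\<forall>x. (h has_real_derivative g x) (at x))"

definition cohomologous :: "'l tiling \<Rightarrow> ((real \<Rightarrow> real) \<times> (real \<Rightarrow> real)) set" where
  "cohomologous T = {(\<mu>, \<nu>). sPE T \<mu> \<and> sPE T \<nu> \<and> (\<exists>h. sPE T h \<and> is_d h (\<lambda>x. \<nu> x - \<mu> x))}"

definition coh_class :: "'l tiling \<Rightarrow> (real \<Rightarrow> real) \<Rightarrow> (real \<Rightarrow> real) set" where
  "coh_class T \<mu> = cohomologous T `` {\<mu>}"

definition H1 :: "'l tiling \<Rightarrow> (real \<Rightarrow> real) set set" where
  "H1 T = {\<mu>. sPE T \<mu>} // cohomologous T"

definition class_add :: "(real \<Rightarrow> real) set \<Rightarrow> (real \<Rightarrow> real) set \<Rightarrow> (real \<Rightarrow> real) set" where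
  "class_add A B = {\<lambda>x. f x + g x | f g. f \<in> A \<and> g \<in> B}"

definition H1_AN :: "'l tiling \<Rightarrow> (real \<Rightarrow> real) set set" where
  "H1_AN T = {A \<in> H1 T. \<exists>\<alpha>\<in>A. \<exists>g. wPE T g \<and> is_d g \<alpha>}"

definition dx_line :: "'l tiling \<Rightarrow> (real \<Rightarrow> real) set set" where
  "dx_line T = {coh_class T (\<lambda>x. c) | c. True}"

definition dx_plus_AN :: "'l tiling \<Rightarrow> (real \<Rightarrow> real) set set" where
  "dx_plus_AN T = {class_add A B | A B. A \<in> dx_line T \<and> B \<in> H1_AN T}"

lemma sPE_0: "sPE T (\<lambda>x. 0)"
  by (auto simp: sPE_def PE_radius_def intro!: exI[of _ 1])

lemma agree_on_mono: "agree_on B T T' \<Longrightarrow> A \<subseteq> B \<Longrightarrow> agree_on A T T'"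
  unfolding agree_on_def patch_def by blast

lemma sPE_lincomb:
  assumes "sPE T f" "sPE T g" shows "sPE T (\<lambda>x. c * f x + d * g x)"
proof -
  obtain R S where R: "0 < R" "PE_radius T R f" and S: "0 < S" "PE_radius T S g"
    using assms by (auto simp: sPE_def)
  have "PE_radius T (max R S) (\<lambda>x. c * f x + d * g x)"
    unfolding PE_radius_def
  proof (intro conjI allI impI)
    fix x1 x2 assume a: "agree_on {- max R S..max R S} (translate x1 T) (translate x2 T)"
    have "agree_on {-R..R} (translate x1 T) (translate x2 T)"
      "agree_on {-S..S} (translate x1 T) (translate x2 T)"
      by (rule agree_on_mono[OF a]; auto)+
    then have "f x1 = f x2" "g x1 = g x2" using R S unfolding PE_radius_def by blast+
    then show "c * f x1 + d * g x1 = c * f x2 + d * g x2" by simp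
  qed (use R S in \<open>auto simp: PE_radius_def intro!: continuous_intros\<close>)
  then show ?thesis unfolding sPE_def using R(1) by (meson less_max_iff_disj)
qed

lemma equiv_cohomologous: "equiv {\<mu>. sPE T \<mu>} (cohomologous T)"
proof (rule equivI)
  show "cohomologous T \<subseteq> {\<mu>. sPE T \<mu>} \<times> {\<mu>. sPE T \<mu>}"
    by (auto simp: cohomologous_def)
  show "refl_on {\<mu>. sPE T \<mu>} (cohomologous T)"
  proof (rule refl_onI)
    fix \<mu> assume "\<mu> \<in> {\<mu>. sPE T \<mu>}"
    moreover have "is_d (\<lambda>x. 0) (\<lambda>x. \<mu> x - \<mu> x)" by (simp add: is_d_def)
    ultimately show "(\<mu>, \<mu>) \<in> cohomologous T"
      using sPE_0[of T] unfolding cohomologous_def by blast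
  qed
  show "sym (cohomologous T)"
  proof (rule symI)
    fix \<mu> \<nu> assume "(\<mu>, \<nu>) \<in> cohomologous T"
    then obtain h where h: "sPE T \<mu>" "sPE T \<nu>" "sPE T h" "is_d h (\<lambda>x. \<nu> x - \<mu> x)"
      by (auto simp: cohomologous_def)
    have "sPE T (\<lambda>x. - h x)" using sPE_lincomb[OF h(3) h(3), of "-1" 0] by simp
    moreover have "is_d (\<lambda>x. - h x) (\<lambda>x. \<mu> x - \<nu> x)"
      using h(4) unfolding is_d_def by (force dest: DERIV_minus)
    ultimately show "(\<nu>, \<mu>) \<in> cohomologous T" using h by (auto simp: cohomologous_def)
  qed
  show "trans (cohomologous T)"
  proof (rule transI)
    fix \<mu> \<nu> \<xi> assume "(\<mu>, \<nu>) \<in> cohomologous T" "(\<nu>, \<xi>) \<in> cohomologous T"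
    then obtain h k where h: "sPE T \<mu>" "sPE T \<nu>" "sPE T h" "is_d h (\<lambda>x. \<nu> x - \<mu> x)"
      and k: "sPE T \<xi>" "sPE T k" "is_d k (\<lambda>x. \<xi> x - \<nu> x)"
      by (auto simp: cohomologous_def)
    have "sPE T (\<lambda>x. h x + k x)" using sPE_lincomb[OF h(3) k(2), of 1 1] by simp
    moreover have "is_d (\<lambda>x. h x + k x) (\<lambda>x. \<xi> x - \<mu> x)"
      unfolding is_d_def
    proof
      fix x
      have "((\<lambda>x. h x + k x) has_real_derivative (\<nu> x - \<mu> x) + (\<xi> x - \<nu> x)) (at x)"
        using h(4) k(3) by (intro DERIV_add) (auto simp: is_d_def)
      then show "((\<lambda>x. h x + k x) has_real_derivative \<xi> x - \<mu> x) (at x)" by simp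
    qed
    ultimately show "(\<mu>, \<xi>) \<in> cohomologous T" using h k by (auto simp: cohomologous_def)
  qed
qed


subsection \<open>The maps and their rotation classes\<close>

text \<open>The displacement is unique because no element of a tiling space is periodic.\<close>

definition sPE_homeos :: "'l tiling set \<Rightarrow> ('l tiling \<Rightarrow> 'l tiling) set" where
  "sPE_homeos \<Omega> = {F.
     homeomorphic_map (space_topology \<Omega>) (space_topology \<Omega>) F \<and>
     homotopic_with (\<lambda>_. True) (space_topology \<Omega>) (space_topology \<Omega>) F id \<and>
     (\<exists>\<Phi>. (\<forall>T\<in>\<Omega>. F T = translate (\<Phi> T) T) \<and> sPE_on_space \<Omega> \<Phi>)}"

definition orbit_map :: "('l tiling \<Rightarrow> 'l tiling) \<Rightarrow> 'l tiling \<Rightarrow> real \<Rightarrow> real" where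
  "orbit_map F T x = (THE y. F (translate x T) = translate y T)"

definition int_iterate :: "('a \<Rightarrow> 'a) \<Rightarrow> int \<Rightarrow> 'a \<Rightarrow> 'a" where
  "int_iterate f n = (if n \<ge> 0 then f ^^ nat n else inv f ^^ nat (- n))"

definition strictly_between :: "real \<Rightarrow> real \<Rightarrow> real \<Rightarrow> bool" where
  "strictly_between x a b \<longleftrightarrow> min a b < x \<and> x < max a b"

text \<open>The interval integrals below are oriented: exchanging the endpoints changes the sign.\<close>

definition rotation_form :: "('l tiling \<Rightarrow> 'l tiling) \<Rightarrow> 'l tiling \<Rightarrow> (real \<Rightarrow> real) \<Rightarrow> bool" where
  "rotation_form F T \<mu> \<longleftrightarrow> sPE T \<mu> \<and>
     (\<exists>R>0. \<forall>x1 x2. agree_on {-R..R} (translate x1 T) (translate x2 T) \<longrightarrow>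
        (\<forall>m n :: int. of_int m < (LBINT x=x1..x2. \<mu> x) \<and> (LBINT x=x1..x2. \<mu> x) < of_int n \<longrightarrow>
           strictly_between x2 (int_iterate (orbit_map F T) m x1) (int_iterate (orbit_map F T) n x1)))"

definition rotation_class ::
    "('l tiling \<Rightarrow> 'l tiling) \<Rightarrow> 'l tiling \<Rightarrow> (real \<Rightarrow> real) set \<Rightarrow> bool" where
  "rotation_class F T C \<longleftrightarrow> C \<in> H1 T \<and> (\<exists>\<mu>\<in>C. rotation_form F T \<mu>)"


subsection \<open>Shape changes and irrational classes\<close>

text \<open>The collared label of a tile on $[a,b]$ is the pattern of \<open>T\<close> out to distance \<open>R\<close> around
  it, rebased at \<open>a\<close>; the original label is the one of the tile in it starting at 0.\<close>

definition collar_label :: "real \<Rightarrow> 'l tiling \<Rightarrow> real set \<Rightarrow> 'l tile set" where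
  "collar_label R T I = translate (Inf I) (patch {Inf I - R..Sup I + R} T)"

text \<open>Taking images of intervals treats positive and negative forms alike; for negative ones the
  order of the tiles is reversed.\<close>

definition shape_change_tiling ::
    "'l tiling \<Rightarrow> real \<Rightarrow> (real \<Rightarrow> real) \<Rightarrow> 'l tile set tiling" where
  "shape_change_tiling T R \<mu> =
     (\<lambda>t. ((\<lambda>x. LBINT y=0..x. \<mu> y) ` fst t, collar_label R T (fst t))) ` T"

definition shape_change :: "'l tiling \<Rightarrow> real \<Rightarrow> (real \<Rightarrow> real) \<Rightarrow> 'l tile set tiling set" where
  "shape_change T R \<mu> = orbit_closure (shape_change_tiling T R \<mu>)"

text \<open>Admissible choices of \<open>R\<close> give shape changes that are homeomorphic by a map commuting with
  translations, so minimality does not depend on \<open>R\<close>.\<close>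

definition irrational_class :: "'l tiling \<Rightarrow> (real \<Rightarrow> real) set \<Rightarrow> bool" where
  "irrational_class T C \<longleftrightarrow> C \<in> H1 T \<and>
     (\<exists>\<mu>\<in>C. \<exists>R>0. PE_radius T R \<mu> \<and> ((\<forall>x. \<mu> x > 0) \<or> (\<forall>x. \<mu> x < 0)) \<and>
        minimal_map (space_topology (shape_change T R \<mu>)) (translate 1))"


subsection \<open>Semi-conjugacy\<close>

definition semi_conjugate ::
    "'a topology \<Rightarrow> ('a \<Rightarrow> 'a) \<Rightarrow> 'b topology \<Rightarrow> ('b \<Rightarrow> 'b) \<Rightarrow> bool" where
  "semi_conjugate X F Y F' \<longleftrightarrow>
     (\<exists>H. continuous_map X Y H \<and> (\<forall>x\<in>topspace X. F' (H x) = H (F x)))"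

definition uniform_translation :: "('l tiling \<Rightarrow> 'l tiling) \<Rightarrow> bool" where
  "uniform_translation G \<longleftrightarrow> (\<exists>\<rho>. \<rho> \<noteq> 0 \<and> G = translate \<rho>)"

end

theory Submission
  imports Defs
begin

text \<open>
  Fix a pattern class of points \<open>y\<close>, namely those for which \<open>T - y\<close> agrees with \<open>T\<close> on a large ball, put
  \<open>m(x) = \<integral>\<^sub>0\<^sup>x \<mu>\<close>, and let \<open>f\<close> be the map induced by \<open>F\<close> on the orbit of \<open>T\<close>. For positive \<open>\<mu>\<close>, the
  rotation property says that the points \<open>f^n(y)\<close> are ordered on the line as the numbers \<open>m(y) + n\<close>.
  Hence, as for circle homeomorphisms, \<open>h(x) = sup {m(y) + n | f^n(y) \<le> x}\<close> is monotone, satisfies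
  \<open>h \<circ> f = h + 1\<close> and extends \<open>m\<close> from the pattern class to the line. Minimality of the unit
  translation on the shape change makes the numbers \<open>m(y) + n\<close> dense, with uniform gaps by repetitivity, so
  \<open>h\<close> is continuous and \<open>h - m\<close> is weakly pattern equivariant. Since \<open>m(x) = c x + w(x)\<close> with \<open>w\<close> weakly
  pattern equivariant, so is \<open>\<psi>(x) = h(x) / c - x\<close>. Its continuous extension \<open>\<Psi>\<close> to the tiling space
  gives the semi-conjugacy \<open>S \<mapsto> S - \<Psi>(S)\<close> from \<open>F\<close> to the translation by \<open>1 / c\<close>.
\<close>

subsection \<open>Patches and recurrence in tiling spaces\<close>

text \<open>The obstacle: h is a supremum over infinitely many pairs (y, n), whereas weak pattern
  equivariance asks a finite window around x to determine h(x) - m(x) up to \<epsilon>. A pair that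
  nearly attains the supremum can be copied from x to x' when T - x and T - x' agree on a window
  that contains y and the whole f-orbit segment from y to f^n(y). So the density of the numbers m(y)
  + n has to be realised with y at bounded distance from x and with n bounded. The bound on n is
  available because h - m is bounded: h and m coincide on the relatively dense pattern class. The
  form with minimal shape change and the rotation form are only cohomologous, but they have the same
  integral between points of equal pattern. A negative form is treated by passing to the inverse of
  f. The constant c cannot vanish, since otherwise m and hence h would be bounded.\<close>

abbreviation agree :: "real \<Rightarrow> 'l tiling \<Rightarrow> 'l tiling \<Rightarrow> bool" where
  "agree K \<equiv> agree_on {- K..K}"

lemma agree_refl: "agree_on B S S" by (simp add: agree_on_def)
lemma agree_sym: "agree_on B S S' \<Longrightarrow> agree_on B S' S" by (simp add: agree_on_def)
lemma agree_trans: "agree_on B S S' \<Longrightarrow> agree_on B S' S'' \<Longrightarrow> agree_on B S S''"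
  by (simp add: agree_on_def)
lemma agree_mono: "agree K S S' \<Longrightarrow> K' \<le> K \<Longrightarrow> agree K' S S'"
  by (rule agree_on_mono) auto

lemma tiling_tileE:
  assumes "is_tiling T" "t \<in> T"
  obtains a b l where "a < b" "t = ({a..b}, l)"
  using assms unfolding is_tiling_def is_tile_def by (metis prod.collapse)

lemma tiling_coverE:
  assumes "is_tiling T"
  obtains a b l where "a < b" "({a..b}, l) \<in> T" "x \<in> {a..b}"
proof -
  have "x \<in> (\<Union>t\<in>T. fst t)" using assms unfolding is_tiling_def by blast
  then obtain t where "t \<in> T" "x \<in> fst t" by blast
  then show ?thesis using tiling_tileE[OF assms, of t] that by (metis fst_conv)
qed

lemma tiling_tile_frontier:
  assumes "is_tiling T" "t \<in> T" "t' \<in> T" "t \<noteq> t'" "x \<in> fst t" "x \<in> fst t'"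
  shows "x \<in> frontier (fst t)"
  using assms unfolding is_tiling_def by blast

lemma tile_eqI:
  assumes "is_tiling T" "({a..b}, l) \<in> T" "({c..d}, l') \<in> T" "a < x" "x < b" "x \<in> {c..d}"
  shows "{a..b} = {c..d} \<and> l = l'"
proof (rule ccontr)
  assume "\<not> ?thesis"
  then have "x \<in> frontier {a..b}"
    using tiling_tile_frontier[OF assms(1-3), of x] assms(4-6) by auto
  then show False using assms(4,5) by (auto simp: frontier_def)
qed

lemma left_endpoints_apart:
  assumes "is_tiling T" "({a..b}, l) \<in> T" "({c..d}, l') \<in> T" "a < b" "c < d" "a \<le> c"
  shows "b \<le> c \<or> (a = c \<and> b = d \<and> l = l')"
proof (rule ccontr)
  assume *: "\<not> ?thesis"
  then have "c < b" by simp
  define x where "x = (c + min b d) / 2"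
  have "a < x" "x < b" "x \<in> {c..d}" using \<open>c < b\<close> assms by (auto simp: x_def)
  then show False using tile_eqI[OF assms(1-3)] * assms by (auto simp: Icc_eq_Icc)
qed

definition tile_lengths :: "'l tiling \<Rightarrow> real set" where
  "tile_lengths T = {b - a | a b l. a < b \<and> ({a..b}, l) \<in> T}"

lemma finite_tile_lengths:
  assumes "is_tiling T" shows "finite (tile_lengths T)"
proof -
  define len where "len l = (SOME r. \<exists>a b. a < b \<and> ({a..b}, l) \<in> T \<and> r = b - a)" for l
  have "b - a = len l" if "a < b" "({a..b}, l) \<in> T" for a b l
  proof -
    have "\<exists>a' b'. a' < b' \<and> ({a'..b'}, l) \<in> T \<and> len l = b' - a'"
      unfolding len_def by (rule someI[of _ "b - a"]) (use that in blast)
    then obtain a' b' where *: "({a'..b'}, l) \<in> T" "len l = b' - a'" by blast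
    have "\<forall>a b c d l. ({a..b}, l) \<in> T \<and> ({c..d}, l) \<in> T \<longrightarrow> b - a = d - c"
      using assms unfolding is_tiling_def by (elim conjE)
    then show ?thesis using * that(2) by metis
  qed
  then have "tile_lengths T \<subseteq> len ` snd ` T"
    unfolding tile_lengths_def by force
  moreover have "finite (snd ` T)" using assms unfolding is_tiling_def by blast
  ultimately show ?thesis by (meson finite_imageI finite_subset)
qed

lemma tile_lengths_bounds:
  assumes "is_tiling T"
  obtains \<delta> M where "0 < \<delta>" "0 < M" "\<And>r. r \<in> tile_lengths T \<Longrightarrow> \<delta> \<le> r \<and> r \<le> M"
proof
  \<comment> \<open>The extra 1 guarantees that \<open>Min\<close> and \<open>Max\<close> are taken
    over a nonempty set.\<close>
  let ?A = "insert 1 (tile_lengths T)"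
  have fin: "finite ?A" using finite_tile_lengths[OF assms] by simp
  have pos: "0 < r" if "r \<in> ?A" for r using that by (auto simp: tile_lengths_def)
  show "0 < Min ?A" using fin pos by (subst Min_gr_iff) auto
  show "0 < Max ?A" using fin pos by (subst Max_gr_iff) auto
  show "Min ?A \<le> r \<and> r \<le> Max ?A" if "r \<in> tile_lengths T" for r
    using that fin by auto
qed

text \<open>Distinct tiles have left end points at least \<delta> apart, so the cell of length
  \<delta> that contains the left end point determines the tile, and tiles meeting a bounded
  interval use only finitely many cells.\<close>

lemma finite_patch:
  assumes T: "is_tiling T" shows "finite (patch {x..y} T)"
proof -
  obtain \<delta> M where \<delta>: "0 < \<delta>" "0 < M" "\<And>r. r \<in> tile_lengths T \<Longrightarrow> \<delta> \<le> r \<and> r \<le> M"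
    using tile_lengths_bounds[OF T] by blast
  define g where "g t = \<lfloor>Inf (fst t) / \<delta>\<rfloor>" for t :: "'a tile"
  have inj: "inj_on g (patch {x..y} T)"
  proof (rule inj_onI)
    have *: "t = t'" if t: "t \<in> T" and t': "t' \<in> T" and g: "g t = g t'"
      and le: "Inf (fst t) \<le> Inf (fst t')" for t t'
    proof -
      obtain a b l where 1: "a < b" "t = ({a..b}, l)" using tiling_tileE[OF T t] .
      obtain c d l' where 2: "c < d" "t' = ({c..d}, l')" using tiling_tileE[OF T t'] .
      have ac: "a \<le> c" using le 1 2 by simp
      have "\<delta> \<le> b - a" using \<delta>(3)[of "b - a"] 1 t by (auto simp: tile_lengths_def)
      have "\<not> b \<le> c"
      proof
        assume "b \<le> c"
        then have "(a + \<delta>) / \<delta> \<le> c / \<delta>" using \<open>\<delta> \<le> b - a\<close> \<delta>(1) by (intro divide_right_mono) auto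
        then have "a / \<delta> + 1 \<le> c / \<delta>" using \<delta>(1) by (simp add: add_divide_distrib)
        then have "\<lfloor>a / \<delta>\<rfloor> + 1 \<le> \<lfloor>c / \<delta>\<rfloor>" by linarith
        then show False using g 1 2 by (simp add: g_def)
      qed
      then show ?thesis using left_endpoints_apart[OF T, of a b l c d l'] t t' 1 2 ac by auto
    qed
    fix t t' assume "t \<in> patch {x..y} T" "t' \<in> patch {x..y} T" "g t = g t'"
    then show "t = t'" using *[of t t'] *[of t' t] by (fastforce simp: patch_def)
  qed
  have "g ` patch {x..y} T \<subseteq> {\<lfloor>(x - M) / \<delta>\<rfloor>..\<lfloor>y / \<delta>\<rfloor>}"
  proof (rule image_subsetI)
    fix t assume "t \<in> patch {x..y} T"
    then have t: "t \<in> T" "fst t \<inter> {x..y} \<noteq> {}" by (auto simp: patch_def)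
    obtain a b l where 1: "a < b" "t = ({a..b}, l)" using tiling_tileE[OF T t(1)] .
    have "b - a \<le> M" using \<delta>(3)[of "b - a"] 1 t by (auto simp: tile_lengths_def)
    then have "x - M \<le> a" "a \<le> y" using t(2) 1 by auto
    then show "g t \<in> {\<lfloor>(x - M) / \<delta>\<rfloor>..\<lfloor>y / \<delta>\<rfloor>}"
      using 1 \<delta>(1) by (auto simp: g_def intro!: floor_mono divide_right_mono)
  qed
  then have "finite (g ` patch {x..y} T)" by (rule finite_subset) simp
  then show ?thesis using inj by (rule finite_imageD)
qed

text \<open>The tiles of S that meet [a, b] already cover a neighbourhood of [a, b]. A further tile
  of S' touching [a, b] would share an interior point with one of them, so one inclusion suffices
  for agreement.\<close>

lemma patch_determined:
  assumes S: "is_tiling S" and S': "is_tiling S'" and sub: "patch {a..b} S \<subseteq> S'"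
  shows "agree_on {a..b} S S'"
proof -
  have "t \<in> patch {a..b} S" if t: "t \<in> patch {a..b} S'" for t
  proof (rule ccontr)
    assume tn: "t \<notin> patch {a..b} S"
    obtain z where z: "z \<in> fst t" "a \<le> z" "z \<le> b" and tS': "t \<in> S'"
      using t by (auto simp: patch_def)
    obtain c d l where cd: "c < d" "t = ({c..d}, l)" using tiling_tileE[OF S' tS'] .
    \<comment> \<open>Finitely many tiles of S come near [a, b] without meeting it; they form a
      closed set that stays away from z.\<close>
    define N where "N = patch {a - 1..b + 1} S - patch {a..b} S"
    have "closed (\<Union>(fst ` N))"
    proof (rule closed_Union)
      show "finite (fst ` N)" using finite_patch[OF S] by (simp add: N_def)
      show "\<forall>X\<in>fst ` N. closed X"
      proof
        fix X assume "X \<in> fst ` N"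
        then obtain u where u: "u \<in> S" "X = fst u" by (auto simp: N_def patch_def)
        then show "closed X" using tiling_tileE[OF S u(1)] by (metis closed_atLeastAtMost fst_conv)
      qed
    qed
    moreover have "z \<notin> \<Union>(fst ` N)" using z by (auto simp: N_def patch_def)
    ultimately obtain e where e: "0 < e" "\<And>w. dist w z < e \<Longrightarrow> w \<notin> \<Union>(fst ` N)"
      unfolding closed_def open_dist by (metis ComplD ComplI)
    \<comment> \<open>Below \<open>e\<close> to avoid \<open>N\<close>, below 1 to stay in the
      window that defines \<open>N\<close>, and at most a third of the length of t so that z + r or
      z - r is interior to t.\<close>
    define r where "r = min (min e 1) (d - c) / 3"
    have r0: "0 < r" "r < e" "r < 1" using e(1) cd(1) by (auto simp: r_def)
    moreover have "3 * r \<le> d - c" by (simp add: r_def)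
    ultimately have r: "0 < r" "r < e" "r < 1" "2 * r < d - c" by linarith+
    have zcd: "c \<le> z" "z \<le> d" using z(1) cd(2) by auto
    define w where "w = (if z + r < d then z + r else z - r)"
    have w: "c < w" "w < d" "dist w z < e" "w \<in> {a - 1..b + 1}"
      using r z(2,3) zcd by (auto simp: w_def dist_real_def)
    obtain a' b' l' where 1: "a' < b'" "({a'..b'}, l') \<in> S" "w \<in> {a'..b'}"
      using tiling_coverE[OF S] .
    have "({a'..b'}, l') \<notin> N" using e(2)[OF w(3)] 1(3) by force
    then have "({a'..b'}, l') \<in> patch {a..b} S" using 1 w(4) by (auto simp: N_def patch_def)
    then have "({a'..b'}, l') \<in> S'" "({a'..b'}, l') \<noteq> t" using sub tn by auto
    moreover have "({c..d}, l) \<in> S'" using cd tS' by simp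
    ultimately have "{c..d} = {a'..b'} \<and> l = l'" using tile_eqI[OF S' _ _ w(1,2) 1(3)] by blast
    then show False using cd \<open>({a'..b'}, l') \<noteq> t\<close> by simp
  qed
  then show ?thesis using sub by (auto simp: agree_on_def patch_def)
qed

section \<open>Tilings deformed by a homeomorphism of the line\<close>

lemma homeo_image_Icc:
  fixes m :: "real \<Rightarrow> real"
  assumes "continuous_on UNIV m" "strict_mono m \<or> strict_mono (\<lambda>x. - m x)" "a < b"
  obtains p q where "p < q" "m ` {a..b} = {p..q}" "{p, q} = {m a, m b}"
proof -
  have cs: "m ` {a..b} = closed_segment (m a) (m b)"
  proof (rule antisym)
    show "closed_segment (m a) (m b) \<subseteq> m ` {a..b}"
    proof
      fix y assume "y \<in> closed_segment (m a) (m b)"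
      then obtain x where "x \<in> closed_segment a b" "m x = y"
        using IVT'_closed_segment_real continuous_on_subset[OF assms(1)] by blast
      then show "y \<in> m ` {a..b}" using assms(3) by (auto simp: closed_segment_eq_real_ivl)
    qed
    show "m ` {a..b} \<subseteq> closed_segment (m a) (m b)"
      using assms(2,3) strict_mono_less_eq[of m] strict_mono_less_eq[of "\<lambda>x. - m x"]
      by (auto simp: closed_segment_eq_real_ivl)
  qed
  show thesis
  proof (cases "m a < m b")
    case True
    then show ?thesis using that[of "m a" "m b"] cs by (simp add: closed_segment_eq_real_ivl)
  next
    case False
    have "m a \<noteq> m b" using assms(2,3) strict_monoD[of m a b] strict_monoD[of "\<lambda>x. - m x" a b] by auto
    then show ?thesis using that[of "m b" "m a"] cs False
      by (simp add: closed_segment_eq_real_ivl insert_commute)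
  qed
qed

text \<open>Serves for translations and for shape changes alike. The condition on \<open>lab\<close>
  makes the images of equally labelled tiles translates of each other, which preserves the rule that
  a label fixes a length.\<close>

lemma is_tiling_image:
  fixes m :: "real \<Rightarrow> real"
  assumes T: "is_tiling T" and m: "continuous_on UNIV m" "strict_mono m \<or> strict_mono (\<lambda>x. - m x)"
    and surj: "surj m" and fin: "finite (lab ` T)"
    and lab: "\<And>t t'. t \<in> T \<Longrightarrow> t' \<in> T \<Longrightarrow> lab t = lab t' \<Longrightarrow> \<exists>s. m ` fst t' = (\<lambda>x. x + s) ` m ` fst t"
  shows "is_tiling ((\<lambda>t. (m ` fst t, lab t)) ` T)"
  unfolding is_tiling_def
proof (intro conjI ballI allI impI)
  let ?T = "(\<lambda>t. (m ` fst t, lab t)) ` T"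
  have inj: "inj m" using m(2) strict_mono_eq[of m] strict_mono_eq[of "\<lambda>x. - m x"] by (auto simp: inj_def)
  have fr: "frontier (m ` fst t) = m ` frontier (fst t)" if t: "t \<in> T" for t
  proof -
    obtain a b l where 1: "a < b" "t = ({a..b}, l)" using tiling_tileE[OF T t] .
    obtain p q where pq: "p < q" "m ` {a..b} = {p..q}" "{p, q} = {m a, m b}"
      using homeo_image_Icc[OF m 1(1)] .
    have fI: "frontier {u..v} = {u, v}" if "u < v" for u v :: real
      using that by (auto simp: frontier_def)
    show ?thesis using 1 pq fI[of a b] fI[of p q] by simp
  qed
  show "is_tile t" if "t \<in> ?T" for t
  proof -
    from that obtain t' where t': "t' \<in> T" "t = (m ` fst t', lab t')" by blast
    obtain a b l where 1: "a < b" "t' = ({a..b}, l)" using tiling_tileE[OF T t'(1)] .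
    obtain p q where "p < q" "m ` {a..b} = {p..q}" using homeo_image_Icc[OF m 1(1)] .
    then show ?thesis using 1 t' by (auto simp: is_tile_def)
  qed
  show "finite (snd ` ?T)" using fin by (simp add: image_image)
  show "b - a = d - c" if "({a..b}, l) \<in> ?T \<and> ({c..d}, l) \<in> ?T" for a b c d l
  proof -
    from that obtain t where "t \<in> T" "({a..b}, l) = (m ` fst t, lab t)" by (elim conjE imageE)
    moreover from that obtain t' where "t' \<in> T" "({c..d}, l) = (m ` fst t', lab t')"
      by (elim conjE imageE)
    ultimately have "t \<in> T" "({a..b}, l) = (m ` fst t, lab t)"
      "t' \<in> T" "({c..d}, l) = (m ` fst t', lab t')" .
    then have t: "t \<in> T" "t' \<in> T" "m ` fst t = {a..b}" "m ` fst t' = {c..d}" "lab t = lab t'"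
      by auto
    have "fst t \<noteq> {}" if "t \<in> T" for t
      using tiling_tileE[OF T that] by (metis atLeastatMost_empty_iff fst_conv less_imp_le)
    then have ne: "fst t \<noteq> {}" "fst t' \<noteq> {}" using t by blast+
    obtain s where "{c..d} = (\<lambda>x. x + s) ` {a..b}" using lab[OF t(1,2,5)] t by auto
    then have "{c..d} = {a + s..b + s}" by simp
    moreover have "c \<le> d" "a \<le> b" using t ne by (metis atLeastatMost_empty_iff image_is_empty)+
    ultimately show ?thesis by (simp add: Icc_eq_Icc)
  qed
  show "fst t \<inter> fst t' \<subseteq> frontier (fst t) \<inter> frontier (fst t')"
    if "t \<in> ?T" "t' \<in> ?T" "t \<noteq> t'" for t t'
  proof -
    from that(1) obtain u where 1: "u \<in> T" "t = (m ` fst u, lab u)" by (elim imageE)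
    from that(2) obtain u' where 2: "u' \<in> T" "t' = (m ` fst u', lab u')" by (elim imageE)
    note u = 1(1) 2(1) 1(2) 2(2)
    have "u \<noteq> u'" using that(3) u(3,4) by blast
    note u = u this
    have "fst u \<inter> fst u' \<subseteq> frontier (fst u) \<inter> frontier (fst u')"
      using T u(1,2,5) unfolding is_tiling_def by blast
    then have "m ` (fst u \<inter> fst u') \<subseteq> m ` frontier (fst u) \<inter> m ` frontier (fst u')" by blast
    then show ?thesis using u fr[OF u(1)] fr[OF u(2)] image_Int[OF inj, of "fst u" "fst u'"] by simp
  qed
  have "(\<Union>t\<in>?T. fst t) = m ` (\<Union>t\<in>T. fst t)" by auto
  then show "(\<Union>t\<in>?T. fst t) = UNIV" using T surj unfolding is_tiling_def by simp
qed

lemma is_tiling_translate: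
  assumes T: "is_tiling T" shows "is_tiling (translate s T)"
proof -
  have "translate s T = (\<lambda>t. ((\<lambda>x. x - s) ` fst t, snd t)) ` T"
    by (simp add: translate_def translate_tile_def)
  moreover have "is_tiling \<dots>"
  proof (rule is_tiling_image[OF T])
    show "surj (\<lambda>x. x - s)" by (metis add_diff_cancel surjI)
    show "finite (snd ` T)" using T by (simp add: is_tiling_def)
    fix t t' assume t: "t \<in> T" "t' \<in> T" "snd t = snd t'"
    obtain a b l where 1: "a < b" "t = ({a..b}, l)" using tiling_tileE[OF T t(1)] .
    obtain c d l' where 2: "c < d" "t' = ({c..d}, l')" using tiling_tileE[OF T t(2)] .
    have "\<forall>a b c d l. ({a..b}, l) \<in> T \<and> ({c..d}, l) \<in> T \<longrightarrow> b - a = d - c"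
      using T unfolding is_tiling_def by (elim conjE)
    then have "b - a = d - c" using t 1 2 by (metis snd_conv)
    then have "(\<lambda>x. x - s) ` fst t' = (\<lambda>x. x + (c - a)) ` (\<lambda>x. x - s) ` fst t"
      using 1 2 by (simp add: image_image)
    then show "\<exists>r. (\<lambda>x. x - s) ` fst t' = (\<lambda>x. x + r) ` (\<lambda>x. x - s) ` fst t" by blast
  qed (auto intro!: continuous_intros strict_monoI)
  ultimately show ?thesis by simp
qed

text \<open>Between p - \<delta>/2 and p there is room for at most one vertex, as tiles have length
  at least \<delta>; the tile after such a vertex reaches beyond p. In the second alternative p is
  interior to the tile.\<close>

lemma left_neighbour:
  assumes T: "is_tiling T"
  obtains a l where "a < p" "({a..p}, l) \<in> T \<or> (\<exists>b. p < b \<and> ({a..b}, l) \<in> T)"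
proof -
  obtain \<delta> M where \<delta>: "0 < \<delta>" "0 < M" "\<And>r. r \<in> tile_lengths T \<Longrightarrow> \<delta> \<le> r \<and> r \<le> M"
    using tile_lengths_bounds[OF T] by blast
  obtain a b l where 1: "a < b" "({a..b}, l) \<in> T" "p - \<delta> / 2 \<in> {a..b}" using tiling_coverE[OF T] .
  show thesis
  proof (cases "b < p")
    case False
    then have "a < p" using 1 \<delta>(1) by auto
    then show ?thesis using that[of a l] False 1 by (metis linorder_neqE_linordered_idom)
  next
    case True
    obtain c d l' where 2: "c < d" "({c..d}, l') \<in> T" "(b + p) / 2 \<in> {c..d}" using tiling_coverE[OF T] .
    have "b < d" using 2(3) True by auto
    then have "b \<le> c"
      using left_endpoints_apart[OF T 1(2) 2(2)] left_endpoints_apart[OF T 2(2) 1(2)] 1 2 by linarith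
    moreover have "\<delta> \<le> d - c" using \<delta>(3)[of "d - c"] 2 by (auto simp: tile_lengths_def)
    moreover have "p - \<delta> / 2 \<le> b" using 1 by simp
    ultimately have "p < d" using \<delta>(1) by linarith
    moreover have "c < p" using 2 True by auto
    ultimately show ?thesis using that[of c l'] 2 by blast
  qed
qed

text \<open>The vertices to the right of a given vertex are reached by steps taken from the finite set of
  tile lengths, so that only finitely many displacements of bounded size occur.\<close>

lemma finite_displacements:
  assumes T: "is_tiling T"
  shows "\<exists>D. finite D \<and> (\<forall>a b l c d l'. a < b \<longrightarrow> c < d \<longrightarrow> ({a..b}, l) \<in> T \<longrightarrow> ({c..d}, l') \<in> T \<longrightarrow>
           \<bar>c - a\<bar> \<le> B \<longrightarrow> c - a \<in> D)"
proof -
  obtain \<delta> M where \<delta>: "0 < \<delta>" "0 < M" "\<And>r. r \<in> tile_lengths T \<Longrightarrow> \<delta> \<le> r \<and> r \<le> M"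
    using tile_lengths_bounds[OF T] by blast
  \<comment> \<open>Going back from c to the preceding vertex shortens the displacement by a tile
    length, hence by at least \<delta>; this reduces k + 1 to k.\<close>
  have step: "\<exists>D. finite D \<and> (\<forall>a b l c d l'. a < b \<longrightarrow> c < d \<longrightarrow> ({a..b}, l) \<in> T \<longrightarrow> ({c..d}, l') \<in> T \<longrightarrow>
           a \<le> c \<longrightarrow> c - a \<le> real k * \<delta> \<longrightarrow> c - a \<in> D)" for k
  proof (induction k)
    case 0
    show ?case by (intro exI[of _ "{0}"]) auto
  next
    case (Suc k)
    then obtain D where D: "finite D"
      "\<And>a b l c d l'. a < b \<Longrightarrow> c < d \<Longrightarrow> ({a..b}, l) \<in> T \<Longrightarrow> ({c..d}, l') \<in> T \<Longrightarrow>
           a \<le> c \<Longrightarrow> c - a \<le> real k * \<delta> \<Longrightarrow> c - a \<in> D" by metis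
    let ?D = "insert 0 ((\<lambda>(x, y). x + y) ` (D \<times> tile_lengths T))"
    have "c - a \<in> ?D" if 1: "a < b" "({a..b}, l) \<in> T" and 2: "c < d" "({c..d}, l') \<in> T"
      and ac: "a \<le> c" and le: "c - a \<le> real (Suc k) * \<delta>" for a b l c d l'
    proof (cases "a = c")
      case False
      obtain c' l'' where c': "c' < c" "({c'..c}, l'') \<in> T \<or> (\<exists>b. c < b \<and> ({c'..b}, l'') \<in> T)"
        using left_neighbour[OF T] .
      have in_T: "({c'..c}, l'') \<in> T"
      proof (rule ccontr)
        assume "\<not> ?thesis"
        then obtain b' where b': "c < b'" "({c'..b'}, l'') \<in> T" using c' by blast
        then show False using left_endpoints_apart[OF T b'(2) 2(2)] c'(1) 2(1) by auto
      qed
      have len: "c - c' \<in> tile_lengths T" using in_T c'(1) by (auto simp: tile_lengths_def)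
      have "a \<le> c'"
        using left_endpoints_apart[OF T in_T 1(2)] c'(1) 1(1) ac False by force
      moreover have "c' - a \<le> real k * \<delta>"
        using \<delta>(3)[OF len] le by (simp add: algebra_simps)
      ultimately have "c' - a \<in> D" using D(2)[OF 1(1) c'(1) 1(2) in_T] by blast
      then have "(c' - a, c - c') \<in> D \<times> tile_lengths T" using len by blast
      then show ?thesis by (intro insertI2 image_eqI[of _ _ "(c' - a, c - c')"]) auto
    qed simp
    moreover have "finite ?D" using D(1) finite_tile_lengths[OF T] by simp
    ultimately show ?case by (intro exI[of _ ?D]) blast
  qed
  obtain k :: nat where "B / \<delta> \<le> real k" using real_arch_simple by blast
  then have k: "B \<le> real k * \<delta>" using \<delta>(1) by (simp add: field_simps)
  obtain D where D: "finite D"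
      "\<And>a b l c d l'. a < b \<Longrightarrow> c < d \<Longrightarrow> ({a..b}, l) \<in> T \<Longrightarrow> ({c..d}, l') \<in> T \<Longrightarrow>
           a \<le> c \<Longrightarrow> c - a \<le> real k * \<delta> \<Longrightarrow> c - a \<in> D" using step[of k] by metis
  have "c - a \<in> D \<union> uminus ` D" if "a < b" "c < d" "({a..b}, l) \<in> T" "({c..d}, l') \<in> T" "\<bar>c - a\<bar> \<le> B"
    for a b l c d l'
  proof (cases "a \<le> c")
    case True
    then show ?thesis using D(2)[of a b c d l l'] that k by auto
  next
    case False
    then have "a - c \<in> D" using D(2)[of c d a b l' l] that k by auto
    then have "- (a - c) \<in> uminus ` D" by (rule imageI)
    then show ?thesis by simp
  qed
  then show ?thesis using D(1) by (intro exI[of _ "D \<union> uminus ` D"]) blast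
qed

text \<open>The centre x varies continuously, so patches rebased at x would be infinitely many.
  Rebasing at the left end point a of a tile through x leaves only displacements between vertices,
  which are finite in number.\<close>

lemma finite_local_complexity:
  assumes T: "is_tiling T"
  shows "finite {translate a (patch {x - K..x + K} T) | a b l x. a < b \<and> ({a..b}, l) \<in> T \<and> x \<in> {a..b}}"
proof -
  obtain \<delta> M where \<delta>: "0 < \<delta>" "0 < M" "\<And>r. r \<in> tile_lengths T \<Longrightarrow> \<delta> \<le> r \<and> r \<le> M"
    using tile_lengths_bounds[OF T] by blast
  \<comment> \<open>K + 2 M: the point x is within M of a, the tile considered meets [x - K, x + K],
    and its own length adds at most M.\<close>
  obtain D where D: "finite D"
    "\<And>a b l c d l'. a < b \<Longrightarrow> c < d \<Longrightarrow> ({a..b}, l) \<in> T \<Longrightarrow> ({c..d}, l') \<in> T \<Longrightarrow>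
       \<bar>c - a\<bar> \<le> K + 2 * M \<Longrightarrow> c - a \<in> D" using finite_displacements[OF T, of "K + 2 * M"] by metis
  define X where "X = (\<lambda>(d, r, l). ({d..d + r}, l)) ` (D \<times> tile_lengths T \<times> snd ` T)"
  have "finite X" unfolding X_def
    using D(1) finite_tile_lengths[OF T] T by (auto simp: is_tiling_def)
  moreover have "translate a (patch {x - K..x + K} T) \<subseteq> X"
    if 1: "a < b" "({a..b}, l) \<in> T" "x \<in> {a..b}" for a b l x
  proof
    fix t assume "t \<in> translate a (patch {x - K..x + K} T)"
    then obtain u where u: "u \<in> T" "fst u \<inter> {x - K..x + K} \<noteq> {}" "t = translate_tile a u"
      by (auto simp: translate_def patch_def)
    obtain c d l' where 2: "c < d" "u = ({c..d}, l')" using tiling_tileE[OF T u(1)] .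
    have len: "b - a \<in> tile_lengths T" "d - c \<in> tile_lengths T"
      using 1 2 u by (auto simp: tile_lengths_def)
    have "\<bar>c - a\<bar> \<le> K + 2 * M" using \<delta>(3)[OF len(1)] \<delta>(3)[OF len(2)] u(2) 1 2 by auto
    then have "c - a \<in> D" using D(2) 1 2 u by blast
    then have "(c - a, d - c, l') \<in> D \<times> tile_lengths T \<times> snd ` T" using len u 2 by force
    moreover have "t = ({c - a..c - a + (d - c)}, l')" using u 2 by (simp add: translate_tile_def)
    ultimately show "t \<in> X" unfolding X_def by (metis (mono_tags, lifting) case_prod_conv image_eqI)
  qed
  ultimately have "finite (Pow X)" "{translate a (patch {x - K..x + K} T) | a b l x.
      a < b \<and> ({a..b}, l) \<in> T \<and> x \<in> {a..b}} \<subseteq> Pow X" by blast+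
  then show ?thesis by (rule rev_finite_subset)
qed

text \<open>Repetitivity gives a gap length for each patch; finite local complexity leaves finitely
  many patches up to translation, so the largest gap serves for all x at once.\<close>

lemma repetitive_uniform:
  assumes T: "is_tiling T" and rep: "repetitive T" and K: "0 \<le> K"
  shows "\<exists>L. \<forall>x z. \<exists>y. \<bar>y - z\<bar> \<le> L \<and> agree K (translate x T) (translate y T)"
proof -
  define \<P> where "\<P> = {translate a (patch {x - K..x + K} T) | a b l x. a < b \<and> ({a..b}, l) \<in> T \<and> x \<in> {a..b}}"
  have fin: "finite \<P>" unfolding \<P>_def by (rule finite_local_complexity[OF T])
  have "\<forall>Q\<in>\<P>. \<exists>L>0. \<forall>z. \<exists>s. translate s Q \<subseteq> T \<and> (\<Union>t\<in>translate s Q. fst t) \<subseteq> {z..z + L}"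
  proof
    fix Q assume "Q \<in> \<P>"
    then obtain a x where Q: "Q = translate a (patch {x - K..x + K} T)" by (auto simp: \<P>_def)
    have "finite (patch {x - K..x + K} T) \<and> patch {x - K..x + K} T \<subseteq> T"
      using finite_patch[OF T] by (auto simp: patch_def)
    then obtain L where L: "L > 0" "\<And>z. \<exists>s. translate s (patch {x - K..x + K} T) \<subseteq> T \<and>
        (\<Union>t\<in>translate s (patch {x - K..x + K} T). fst t) \<subseteq> {z..z + L}"
      using rep unfolding repetitive_def by meson
    have "\<exists>s. translate s Q \<subseteq> T \<and> (\<Union>t\<in>translate s Q. fst t) \<subseteq> {z..z + L}" for z
    proof -
      obtain s where "translate s (patch {x - K..x + K} T) \<subseteq> T \<and>
        (\<Union>t\<in>translate s (patch {x - K..x + K} T). fst t) \<subseteq> {z..z + L}" using L(2) by blast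
      then show ?thesis unfolding Q by (intro exI[of _ "s - a"]) (simp add: translate_translate)
    qed
    then show "\<exists>L>0. \<forall>z. \<exists>s. translate s Q \<subseteq> T \<and> (\<Union>t\<in>translate s Q. fst t) \<subseteq> {z..z + L}"
      using L(1) by blast
  qed
  then obtain L where L: "\<And>Q. Q \<in> \<P> \<Longrightarrow> 0 < L Q \<and> (\<forall>z. \<exists>s. translate s Q \<subseteq> T \<and>
      (\<Union>t\<in>translate s Q. fst t) \<subseteq> {z..z + L Q})" by metis
  have "\<exists>y. \<bar>y - z\<bar> \<le> Max (insert 0 (L ` \<P>)) \<and> agree K (translate x T) (translate y T)" for x z
  proof -
    obtain a b l where 1: "a < b" "({a..b}, l) \<in> T" "x \<in> {a..b}" using tiling_coverE[OF T] .
    define P where "P = patch {x - K..x + K} T"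
    have Q: "translate a P \<in> \<P>" using 1 by (auto simp: \<P>_def P_def)
    then obtain s where s: "translate (a + s) P \<subseteq> T" "(\<Union>t\<in>translate (a + s) P. fst t) \<subseteq> {z..z + L (translate a P)}"
      using L[OF Q] by (metis translate_translate)
    \<comment> \<open>The place in the copied patch that corresponds to x.\<close>
    define y where "y = x - (a + s)"
    have "patch {- K..K} (translate x T) = translate x P"
      by (simp add: patch_translate P_def add.commute)
    also have "\<dots> = translate y (translate (a + s) P)" by (simp add: translate_translate y_def)
    also have "\<dots> \<subseteq> translate y T" using s(1) unfolding translate_def by blast
    finally have "agree K (translate x T) (translate y T)"
      by (intro patch_determined is_tiling_translate T)
    \<comment> \<open>As K is nonnegative, the tile through x belongs to the patch, so its copy
      contains y; this confines y to the interval found for the copy.\<close>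
    moreover have "({a..b}, l) \<in> P" using 1 K by (force simp: P_def patch_def)
    then have "translate_tile (a + s) ({a..b}, l) \<in> translate (a + s) P" unfolding translate_def by blast
    moreover have "y \<in> fst (translate_tile (a + s) ({a..b}, l))"
      using 1 by (auto simp: translate_tile_def y_def)
    ultimately have "agree K (translate x T) (translate y T)" "y \<in> {z..z + L (translate a P)}"
      using s(2) by blast+
    moreover have "L (translate a P) \<le> Max (insert 0 (L ` \<P>))" using fin Q by simp
    ultimately show ?thesis by (intro exI[of _ y]) auto
  qed
  then show ?thesis by blast
qed

section \<open>Exact agreement on windows and the tiling metric\<close>

lemma agree_translate:
  assumes "agree K S S'" "\<bar>s\<bar> \<le> K - K'"
  shows "agree K' (translate s S) (translate s S')"
  using assms by (rule agree_on_translate)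

text \<open>Undoing the small shift of S puts the whole shift on S', at the cost of at most e in the
  radius of the window.\<close>

lemma tiling_close_dist:
  assumes "tiling_dist S S' < e" "e \<le> 1"
  obtains s where "\<bar>s\<bar> \<le> e" "agree (inverse e - e) S (translate s S')"
proof -
  obtain d where d: "0 < d" "d < e" "tiling_close S S' d" using tiling_dist_lessD[OF assms] .
  then obtain s1 s2 where s: "\<bar>s1\<bar> \<le> d / 2" "\<bar>s2\<bar> \<le> d / 2"
    "agree (inverse d) (translate s1 S) (translate s2 S')" by (auto simp: tiling_close_def)
  have "inverse e \<le> inverse d" using d by simp
  then have "\<bar>- s1\<bar> \<le> inverse d - (inverse e - e)" using s(1) d by linarith
  then have "agree (inverse e - e) (translate (- s1) (translate s1 S)) (translate (- s1) (translate s2 S'))"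
    using agree_translate[OF s(3)] by blast
  then show thesis using that[of "s2 - s1"] s(1,2) d(2) by (auto simp: translate_translate)
qed

lemma tiling_dist_le_agree:
  assumes "0 < e" "\<bar>s\<bar> \<le> e / 2" "agree (inverse e) S (translate s S')"
  shows "tiling_dist S S' \<le> e"
  by (rule tiling_dist_le[OF assms(1)], unfold tiling_close_def,
      intro exI[of _ 0] exI[of _ s]) (use assms in auto)

lemma ex_small_with_large_inverse:
  fixes K d :: real
  assumes h: "0 < d"
  obtains e where "0 < e" "e \<le> 1" "e \<le> d" "K \<le> inverse e - e"
proof -
  define e where "e = min (min 1 d) (inverse (\<bar>K\<bar> + 1))"
  have e: "0 < e" "e \<le> 1" "e \<le> d" "e \<le> inverse (\<bar>K\<bar> + 1)" using h by (auto simp: e_def)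
  have "\<bar>K\<bar> + 1 \<le> inverse e" using le_imp_inverse_le[OF e(4) e(1)] by simp
  then show thesis using that[OF e(1-3)] e(2) by linarith
qed

text \<open>The small shift that the metric tolerates can be absorbed into the translation of T, so
  approximation by the orbit means exact agreement on every window.\<close>

lemma mem_orbit_closure_iff:
  assumes T: "is_tiling T"
  shows "S \<in> orbit_closure T \<longleftrightarrow> is_tiling S \<and> (\<forall>K. \<exists>s. agree K S (translate s T))"
proof
  assume "S \<in> orbit_closure T"
  then have S: "is_tiling S" and *: "\<And>r. 0 < r \<Longrightarrow> \<exists>s. tiling_dist S (translate s T) < r"
    unfolding orbit_closure_def tiling_topology_def tiling.metric_closure_of
    by (auto simp: tiling.in_mball)
  have "\<exists>s. agree K S (translate s T)" for K
  proof -
    obtain e where e: "0 < e" "e \<le> 1" "K \<le> inverse e - e" using ex_small_with_large_inverse[of 1 K] by auto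
    obtain s where "tiling_dist S (translate s T) < e" using * e(1) by blast
    then obtain r where "agree (inverse e - e) S (translate r (translate s T))"
      using tiling_close_dist e(2) by blast
    then show ?thesis using agree_mono e(3) by (metis translate_translate)
  qed
  then show "is_tiling S \<and> (\<forall>K. \<exists>s. agree K S (translate s T))" using S by blast
next
  assume S: "is_tiling S \<and> (\<forall>K. \<exists>s. agree K S (translate s T))"
  have "\<exists>s. tiling_dist S (translate s T) < r" if "0 < r" for r
  proof -
    obtain s where "agree (inverse (r / 2)) S (translate s T)" using S by blast
    then have "tiling_dist S (translate s T) \<le> r / 2"
      using that by (intro tiling_dist_le_agree[of _ 0]) auto
    then show ?thesis using that by (intro exI[of _ s]) auto
  qed
  then show "S \<in> orbit_closure T"
    unfolding orbit_closure_def tiling_topology_def tiling.metric_closure_of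
    using S is_tiling_translate[OF T] by (auto simp: tiling.in_mball)
qed

text \<open>What the proof keeps of a tiling space. \<open>recur\<close> combines minimality with
  repetitivity: a window of any tiling of the space recurs with bounded gaps in every other one. For
  negative K the window is empty.\<close>

locale minimal_tiling_space =
  fixes \<Omega> :: "'l tiling set"
  assumes tilings: "S \<in> \<Omega> \<Longrightarrow> is_tiling S"
    and invariant: "S \<in> \<Omega> \<Longrightarrow> translate s S \<in> \<Omega>"
    and nonper: "S \<in> \<Omega> \<Longrightarrow> translate p S = S \<Longrightarrow> p = 0"
    and recur: "\<exists>L. \<forall>S\<in>\<Omega>. \<forall>S'\<in>\<Omega>. \<exists>y. \<bar>y\<bar> \<le> L \<and> agree K S (translate y S')"

lemma agree_all_subset:
  assumes "is_tiling S" "\<And>K. agree K S S'"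
  shows "S \<subseteq> S'"
proof
  fix t assume t: "t \<in> S"
  obtain a b l where ab: "a < b" "t = ({a..b}, l)" using tiling_tileE[OF assms(1) t] .
  have "a \<in> fst t \<inter> {- \<bar>a\<bar>..\<bar>a\<bar>}" using ab by auto
  then have "t \<in> patch {- \<bar>a\<bar>..\<bar>a\<bar>} S" using t unfolding patch_def by blast
  then show "t \<in> S'" using assms(2)[of "\<bar>a\<bar>"] by (auto simp: agree_on_def patch_def)
qed

text \<open>Windows of S and S' are windows of T, so recurrence between them reduces to recurrence
  within T. A period of S would be a period of T, because every window of T occurs in S.\<close>

lemma minimal_tiling_spaceI:
  assumes "tiling_space \<Omega>" shows "minimal_tiling_space \<Omega>"
proof -
  obtain T where T: "is_tiling T" "repetitive T" "nonperiodic T" and \<Omega>: "\<Omega> = orbit_closure T"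
    using assms by (auto simp: tiling_space_def)
  note iff = mem_orbit_closure_iff[OF T(1), folded \<Omega>]
  have app: "\<exists>s. agree K S (translate s T)" if "S \<in> \<Omega>" for K S
    using that unfolding iff by blast
  have rec0: "\<exists>L. \<forall>S\<in>\<Omega>. \<forall>S'\<in>\<Omega>. \<exists>y. \<bar>y\<bar> \<le> L \<and> agree K S (translate y S')" if K0: "0 \<le> K" for K
  proof -
    obtain L where L: "\<And>x z. \<exists>y. \<bar>y - z\<bar> \<le> L \<and> agree K (translate x T) (translate y T)"
      using repetitive_uniform[OF T(1,2) K0] by metis
    have "\<exists>y. \<bar>y\<bar> \<le> L \<and> agree K S (translate y S')" if S: "S \<in> \<Omega>" "S' \<in> \<Omega>" for S S'
    proof -
      obtain x where x: "agree K S (translate x T)" using app S(1) by blast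
      \<comment> \<open>Radius K + L: the window of radius K around any point y with |y - z| <= L
        must still be copied by S'.\<close>
      obtain z where z: "agree (K + L) S' (translate z T)" using app S(2) by blast
      obtain y where y: "\<bar>y - z\<bar> \<le> L" "agree K (translate x T) (translate y T)" using L by blast
      have "agree K (translate (y - z) S') (translate (y - z) (translate z T))"
        using agree_translate[OF z] y(1) by simp
      then have "agree K (translate (y - z) S') (translate y T)" by (simp add: translate_translate)
      then show ?thesis using x y by (meson agree_sym agree_trans)
    qed
    then show ?thesis by blast
  qed
  show ?thesis
  proof
    show til: "is_tiling S" if "S \<in> \<Omega>" for S using that iff by blast
    show "translate s S \<in> \<Omega>" if "S \<in> \<Omega>" for s S
    proof -
      note S = that
      have "\<exists>r. agree K (translate s S) (translate r T)" for K
      proof -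
        obtain r where "agree (K + \<bar>s\<bar>) S (translate r T)" using app[OF S] by blast
        then have "agree K (translate s S) (translate s (translate r T))"
          by (rule agree_translate) simp
        then show ?thesis by (metis translate_translate)
      qed
      then show ?thesis using iff[of "translate s S"] is_tiling_translate[OF til[OF S]] by simp
    qed
    show rec: "\<exists>L. \<forall>S\<in>\<Omega>. \<forall>S'\<in>\<Omega>. \<exists>y. \<bar>y\<bar> \<le> L \<and> agree K S (translate y S')" for K
    proof -
      obtain L where "\<forall>S\<in>\<Omega>. \<forall>S'\<in>\<Omega>. \<exists>y. \<bar>y\<bar> \<le> L \<and> agree \<bar>K\<bar> S (translate y S')"
        using rec0[of "\<bar>K\<bar>"] by auto
      then show ?thesis using agree_mono[of "\<bar>K\<bar>" _ _ K] by (meson abs_ge_self)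
    qed
    have "\<exists>s. agree K T (translate s T)" for K by (rule exI[of _ 0]) (simp add: agree_refl)
    then have T\<Omega>: "T \<in> \<Omega>" using iff[of T] T(1) by simp
    fix S p assume S: "S \<in> \<Omega>" and p: "translate p S = S"
    have ag: "agree K T (translate p T)" for K
    proof -
      obtain y where y: "agree (\<bar>K\<bar> + \<bar>p\<bar>) T (translate y S)" using rec T\<Omega> S by blast
      have "agree \<bar>K\<bar> (translate p T) (translate p (translate y S))"
        using agree_translate[OF y, of p "\<bar>K\<bar>"] by simp
      then have "agree \<bar>K\<bar> (translate p T) (translate y (translate p S))"
        by (simp add: translate_translate add.commute)
      then have "agree \<bar>K\<bar> (translate p T) (translate y S)" using p by simp
      moreover have "agree \<bar>K\<bar> T (translate y S)" using y by (rule agree_mono) simp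
      ultimately have "agree \<bar>K\<bar> T (translate p T)" by (meson agree_sym agree_trans)
      then show ?thesis by (rule agree_mono) simp
    qed
    have "T = translate p T"
      using agree_all_subset[OF T(1) ag] agree_all_subset[OF is_tiling_translate[OF T(1)] agree_sym[OF ag]]
      by blast
    then show "p = 0" using T(3) unfolding nonperiodic_def by metis
  qed
qed

subsection \<open>Pattern equivariant functions on the line\<close>

lemma int_iterate_Suc:
  assumes "bij f" shows "int_iterate f (n + 1) x = f (int_iterate f n x)"
proof (cases "n \<ge> 0")
  case True
  then have "nat (n + 1) = Suc (nat n)" by simp
  then show ?thesis using True by (simp add: int_iterate_def)
next
  case False
  then have "nat (- n) = Suc (nat (- (n + 1)))" by simp
  then have "f (int_iterate f n x) = (inv f ^^ nat (- (n + 1))) x"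
    using False assms by (simp add: int_iterate_def bij_is_surj surj_f_inv_f)
  also have "\<dots> = int_iterate f (n + 1) x"
    using False by (cases "n + 1 = 0") (auto simp: int_iterate_def)
  finally show ?thesis by simp
qed

lemma int_iterate_inv:
  assumes "bij f" shows "int_iterate (inv f) n = int_iterate f (- n)"
  using assms by (auto simp: int_iterate_def inv_inv_eq)

text \<open>A continuous injection of the line is monotone, and bounded displacement excludes the
  decreasing case. It also makes f unbounded in both directions, whence surjectivity.\<close>

lemma displacement_strict_mono:
  fixes f :: "real \<Rightarrow> real"
  assumes cont: "continuous_on UNIV f" and inj: "inj f" and D: "\<And>x. \<bar>f x - x\<bar> \<le> D"
  shows "strict_mono f" "bij f"
proof -
  show "strict_mono f"
  proof (rule strict_monoI, rule ccontr)
    fix a b :: real assume ab: "a < b" and n: "\<not> f a < f b"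
    \<comment> \<open>Far enough to the right that f a < f c whatever the two displacements
      are.\<close>
    define c where "c = b + 2 * \<bar>D\<bar> + 1"
    have "b < c" by (simp add: c_def)
    have "f a < f c" using D[of a] D[of c] ab by (simp add: c_def abs_le_iff)
    moreover have "f a < f b \<and> f b < f c \<or> f c < f b \<and> f b < f a"
      using continuous_inj_imp_mono[OF ab \<open>b < c\<close>, of f] continuous_on_subset[OF cont]
        inj_on_subset[OF inj] by auto
    ultimately show False using n by auto
  qed
  have "y \<in> range f" for y
  proof -
    have "f (y - \<bar>D\<bar>) \<le> y" "y \<le> f (y + \<bar>D\<bar>)"
      using D[of "y - \<bar>D\<bar>"] D[of "y + \<bar>D\<bar>"] by (auto simp: abs_le_iff)
    then obtain x where "f x = y"
      using IVT'[of f "y - \<bar>D\<bar>" y "y + \<bar>D\<bar>"] continuous_on_subset[OF cont] by auto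
    then show ?thesis by blast
  qed
  then show "bij f" using inj by (auto simp: bij_def)
qed

lemma continuous_on_inv_real:
  fixes m :: "real \<Rightarrow> real"
  assumes "continuous_on UNIV m" "bij m"
  shows "continuous_on UNIV (inv m)"
proof -
  have "open (inv m -` U)" if "open U" for U
  proof -
    have "inv m -` U = m ` U" using assms(2) by (metis bij_vimage_eq_inv_image inv_inv_eq bij_imp_bij_inv)
    moreover have "open (m ` U)"
      using invariance_of_domain[of U m] continuous_on_subset[OF assms(1)]
        inj_on_subset[OF bij_is_inj[OF assms(2)]] that by auto
    ultimately show ?thesis by simp
  qed
  then show ?thesis by (simp add: continuous_on_open_vimage)
qed

text \<open>\<open>E K x y\<close> abstracts the relation that \<open>T - x\<close> and \<open>T - y\<close> agree on \<open>[-K, K]\<close>.\<close>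

locale recurrent_line =
  fixes E :: "real \<Rightarrow> real \<Rightarrow> real \<Rightarrow> bool"
  assumes E_refl: "E K x x"
    and E_sym: "E K x y \<Longrightarrow> E K y x"
    and E_trans: "E K x y \<Longrightarrow> E K y z \<Longrightarrow> E K x z"
    and E_shift: "E K x y \<Longrightarrow> \<bar>s\<bar> \<le> K - K' \<Longrightarrow> E K' (x + s) (y + s)"
    and E_recur: "\<exists>L. \<forall>x z. \<exists>y. \<bar>y - z\<bar> \<le> L \<and> E K x y"
begin

lemma E_mono: "E K x y \<Longrightarrow> K' \<le> K \<Longrightarrow> E K' x y"
  using E_shift[of K x y 0 K'] by simp

definition equivariant :: "real \<Rightarrow> (real \<Rightarrow> real) \<Rightarrow> bool" where
  "equivariant R \<phi> \<longleftrightarrow> continuous_on UNIV \<phi> \<and> (\<forall>x y. E R x y \<longrightarrow> \<phi> x = \<phi> y)"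

text \<open>An \<epsilon>-form of weak pattern equivariance: uniform limits of
  \<open>equivariant\<close> functions satisfy it, and it can be checked for a function given by a
  supremum without exhibiting approximants.\<close>

definition weakly_equivariant :: "(real \<Rightarrow> real) \<Rightarrow> bool" where
  "weakly_equivariant \<phi> \<longleftrightarrow> continuous_on UNIV \<phi> \<and> (\<forall>\<epsilon>>0. \<exists>R. \<forall>x y. E R x y \<longrightarrow> \<bar>\<phi> x - \<phi> y\<bar> \<le> \<epsilon>)"

lemma equivariant_mono: "equivariant R \<phi> \<Longrightarrow> R \<le> R' \<Longrightarrow> equivariant R' \<phi>"
  unfolding equivariant_def using E_mono by blast

lemma equivariant_weakly_equivariant: "equivariant R \<phi> \<Longrightarrow> weakly_equivariant \<phi>"
  unfolding equivariant_def weakly_equivariant_def by (metis abs_zero diff_self less_imp_le)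

lemma weakly_equivariant_add:
  assumes "weakly_equivariant \<phi>" "weakly_equivariant \<psi>" shows "weakly_equivariant (\<lambda>x. \<phi> x + \<psi> x)"
  unfolding weakly_equivariant_def
proof (intro conjI allI impI)
  show "continuous_on UNIV (\<lambda>x. \<phi> x + \<psi> x)"
    using assms by (auto simp: weakly_equivariant_def intro!: continuous_intros)
  fix \<epsilon> :: real assume "\<epsilon> > 0"
  then have "\<epsilon> / 2 > 0" by simp
  obtain R where R: "\<And>x y. E R x y \<Longrightarrow> \<bar>\<phi> x - \<phi> y\<bar> \<le> \<epsilon> / 2"
    using assms(1) \<open>\<epsilon> / 2 > 0\<close> unfolding weakly_equivariant_def by blast
  obtain R' where R': "\<And>x y. E R' x y \<Longrightarrow> \<bar>\<psi> x - \<psi> y\<bar> \<le> \<epsilon> / 2"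
    using assms(2) \<open>\<epsilon> / 2 > 0\<close> unfolding weakly_equivariant_def by blast
  have "\<bar>\<phi> x + \<psi> x - (\<phi> y + \<psi> y)\<bar> \<le> \<epsilon>" if E: "E (max R R') x y" for x y
  proof -
    have "E R x y" "E R' x y" by (rule E_mono[OF E]; simp)+
    then show ?thesis using R R' by (smt (verit) field_sum_of_halves)
  qed
  then show "\<exists>R. \<forall>x y. E R x y \<longrightarrow> \<bar>\<phi> x + \<psi> x - (\<phi> y + \<psi> y)\<bar> \<le> \<epsilon>" by blast
qed

lemma weakly_equivariant_scale:
  assumes "weakly_equivariant \<phi>" shows "weakly_equivariant (\<lambda>x. c * \<phi> x)"
  unfolding weakly_equivariant_def
proof (intro conjI allI impI)
  show "continuous_on UNIV (\<lambda>x. c * \<phi> x)"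
    using assms by (auto simp: weakly_equivariant_def intro!: continuous_intros)
  fix \<epsilon> :: real assume "\<epsilon> > 0"
  then have "\<epsilon> / (\<bar>c\<bar> + 1) > 0" by (auto intro!: divide_pos_pos)
  then obtain R where R: "\<And>x y. E R x y \<Longrightarrow> \<bar>\<phi> x - \<phi> y\<bar> \<le> \<epsilon> / (\<bar>c\<bar> + 1)"
    using assms unfolding weakly_equivariant_def by blast
  have "\<bar>c * \<phi> x - c * \<phi> y\<bar> \<le> \<epsilon>" if "E R x y" for x y
  proof -
    have "\<bar>c * \<phi> x - c * \<phi> y\<bar> = \<bar>c\<bar> * \<bar>\<phi> x - \<phi> y\<bar>" by (metis abs_mult right_diff_distrib)
    also have "\<dots> \<le> (\<bar>c\<bar> + 1) * (\<epsilon> / (\<bar>c\<bar> + 1))" using R[OF that] by (intro mult_mono) auto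
    also have "\<dots> = \<epsilon>" by simp
    finally show ?thesis .
  qed
  then show "\<exists>R. \<forall>x y. E R x y \<longrightarrow> \<bar>c * \<phi> x - c * \<phi> y\<bar> \<le> \<epsilon>" by blast
qed

lemma weakly_equivariant_uniform_limit:
  assumes "\<And>n. \<exists>R. equivariant R (\<psi> n)" "uniform_limit UNIV \<psi> \<phi> sequentially"
  shows "weakly_equivariant \<phi>"
  unfolding weakly_equivariant_def
proof (intro conjI allI impI)
  have "\<And>n. continuous_on UNIV (\<psi> n)" using assms(1) unfolding equivariant_def by blast
  then show "continuous_on UNIV \<phi>"
    by (intro uniform_limit_theorem[OF _ assms(2)]) auto
  fix \<epsilon> :: real assume "\<epsilon> > 0"
  then have "\<forall>\<^sub>F n in sequentially. \<forall>x\<in>UNIV. dist (\<psi> n x) (\<phi> x) < \<epsilon> / 2"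
    by (intro uniform_limitD[OF assms(2)]) simp
  then obtain n where n: "\<And>x. \<bar>\<psi> n x - \<phi> x\<bar> < \<epsilon> / 2"
    by (auto simp: dist_real_def eventually_sequentially)
  obtain R where R: "equivariant R (\<psi> n)" using assms(1) by blast
  have "\<bar>\<phi> x - \<phi> y\<bar> \<le> \<epsilon>" if "E R x y" for x y
  proof -
    have "\<psi> n x = \<psi> n y" using R that unfolding equivariant_def by blast
    then show ?thesis using n[of x] n[of y] by linarith
  qed
  then show "\<exists>R. \<forall>x y. E R x y \<longrightarrow> \<bar>\<phi> x - \<phi> y\<bar> \<le> \<epsilon>" by blast
qed

text \<open>By recurrence every pattern is seen at some point of [- L, L], so the values on this
  compact interval determine all values up to 1.\<close>

lemma weakly_equivariant_bounded:
  assumes "weakly_equivariant \<phi>" shows "\<exists>B>0. \<forall>x. \<bar>\<phi> x\<bar> \<le> B"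
proof -
  obtain R where R: "\<And>x y. E R x y \<Longrightarrow> \<bar>\<phi> x - \<phi> y\<bar> \<le> 1"
    using assms unfolding weakly_equivariant_def by (metis zero_less_one)
  obtain L where L: "\<And>x z. \<exists>y. \<bar>y - z\<bar> \<le> L \<and> E R x y" using E_recur by metis
  have "compact (\<phi> ` {- L..L})"
    using assms continuous_on_subset by (intro compact_continuous_image) (auto simp: weakly_equivariant_def)
  then obtain B where B: "\<And>y. y \<in> {- L..L} \<Longrightarrow> \<bar>\<phi> y\<bar> \<le> B"
    using compact_imp_bounded bounded_iff by (metis imageI real_norm_def)
  have "\<bar>\<phi> x\<bar> \<le> \<bar>B\<bar> + 1" for x
  proof -
    obtain y where "\<bar>y - 0\<bar> \<le> L" "E R x y" using L by blast
    then show ?thesis using B[of y] R[of x y] by (auto simp: abs_le_iff)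
  qed
  then show ?thesis by (intro exI[of _ "\<bar>B\<bar> + 1"]) auto
qed

text \<open>Recurrence moves the pair x, x + s to a pair in a fixed compact interval. Radius R + 1
  leaves room for shifts of size at most 1.\<close>

lemma weakly_equivariant_uniformly_continuous:
  assumes "weakly_equivariant \<phi>" "\<epsilon> > 0"
  shows "\<exists>\<delta>>0. \<forall>x s. \<bar>s\<bar> \<le> \<delta> \<longrightarrow> \<bar>\<phi> (x + s) - \<phi> x\<bar> \<le> \<epsilon>"
proof -
  obtain R where R: "\<And>x y. E R x y \<Longrightarrow> \<bar>\<phi> x - \<phi> y\<bar> \<le> \<epsilon> / 3"
    using assms unfolding weakly_equivariant_def by (metis divide_pos_pos zero_less_numeral)
  obtain L where L: "\<And>x z. \<exists>y. \<bar>y - z\<bar> \<le> L \<and> E (R + 1) x y" using E_recur by metis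
  have "uniformly_continuous_on {- L - 1..L + 1} \<phi>"
    using assms(1) continuous_on_subset
    by (intro compact_uniformly_continuous) (auto simp: weakly_equivariant_def)
  then obtain \<delta> where \<delta>: "\<delta> > 0" "\<And>x y. x \<in> {- L - 1..L + 1} \<Longrightarrow> y \<in> {- L - 1..L + 1} \<Longrightarrow>
      \<bar>y - x\<bar> < \<delta> \<Longrightarrow> \<bar>\<phi> y - \<phi> x\<bar> < \<epsilon> / 3"
    using assms(2) unfolding uniformly_continuous_on_def dist_real_def by (metis divide_pos_pos zero_less_numeral)
  have "\<bar>\<phi> (x + s) - \<phi> x\<bar> \<le> \<epsilon>" if s: "\<bar>s\<bar> \<le> min (\<delta> / 2) 1" for x s
  proof -
    obtain y where y: "\<bar>y - 0\<bar> \<le> L" "E (R + 1) x y" using L by blast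
    have 1: "E R (x + s) (y + s)" using E_shift[OF y(2), of s R] s by simp
    have 2: "E R x y" using E_mono[OF y(2), of R] by simp
    have 3: "y \<in> {- L - 1..L + 1}" "y + s \<in> {- L - 1..L + 1}" "\<bar>(y + s) - y\<bar> < \<delta>"
      using y(1) s \<delta>(1) by (auto simp: abs_le_iff)
    show ?thesis using R[OF 1] R[OF 2] \<delta>(2)[OF 3] by linarith
  qed
  then show ?thesis using \<delta>(1) by (intro exI[of _ "min (\<delta> / 2) 1"]) auto
qed

lemma equivariant_pos_lower_bound:
  assumes "equivariant R \<mu>" "\<And>x. \<mu> x > 0"
  shows "\<exists>c>0. \<forall>x. c \<le> \<mu> x"
proof -
  obtain L where L: "\<And>x z. \<exists>y. \<bar>y - z\<bar> \<le> L \<and> E R x y" using E_recur by metis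
  have "continuous_on {- L..L} \<mu>" using assms(1) continuous_on_subset unfolding equivariant_def by blast
  moreover have "{- L..L} \<noteq> {}" using L[of 0 0] by force
  ultimately obtain x0 where x0: "\<And>y. y \<in> {- L..L} \<Longrightarrow> \<mu> x0 \<le> \<mu> y"
    using continuous_attains_inf[of "{- L..L}" \<mu>] by (meson compact_Icc)
  have "\<mu> x0 \<le> \<mu> x" for x
  proof -
    obtain y where y: "\<bar>y - 0\<bar> \<le> L" "E R x y" using L by blast
    then show ?thesis using x0[of y] assms(1) unfolding equivariant_def by (auto simp: abs_le_iff)
  qed
  then show ?thesis using assms(2)[of x0] by blast
qed

text \<open>Each application of f uses up at most D of the common radius, so both orbits see the
  same displacement at each of the first n steps.\<close>

lemma iterate_shift:
  assumes "equivariant R d" "\<And>x. \<bar>d x\<bar> \<le> D" "f = (\<lambda>x. x + d x)" "E (R + real n * D) y (y + v)"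
  shows "(f ^^ n) (y + v) = (f ^^ n) y + v \<and> \<bar>(f ^^ n) y - y\<bar> \<le> real n * D"
  using assms(4)
proof (induction n arbitrary: y)
  case (Suc n)
  have D: "0 \<le> D" using assms(2)[of 0] by linarith
  have "E R y (y + v)" using D by (intro E_mono[OF Suc.prems]) simp
  then have "d (y + v) = d y" using assms(1) unfolding equivariant_def by metis
  then have f: "f (y + v) = f y + v" by (simp add: assms(3))
  have "\<bar>d y\<bar> \<le> (R + real (Suc n) * D) - (R + real n * D)"
    using assms(2)[of y] by (simp add: algebra_simps)
  then have "E (R + real n * D) (y + d y) (y + v + d y)" by (rule E_shift[OF Suc.prems])
  then have "E (R + real n * D) (f y) (f y + v)" by (simp add: assms(3) add_ac)
  from Suc.IH[OF this] have "(f ^^ n) (f (y + v)) = (f ^^ n) (f y) + v"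
    "\<bar>(f ^^ n) (f y) - f y\<bar> \<le> real n * D" using f by simp_all
  moreover have "\<bar>f y - y\<bar> \<le> D" using assms(2) by (simp add: assms(3))
  ultimately have "(f ^^ n) (f (y + v)) = (f ^^ n) (f y) + v"
    "\<bar>(f ^^ n) (f y) - y\<bar> \<le> real n * D + D" by linarith+
  then show ?case by (simp add: funpow_Suc_right algebra_simps del: funpow.simps)
qed simp

text \<open>The displacement of \<open>inv f\<close> at x is minus that of f at
  \<open>inv f x\<close>, a point at most D away; hence the radius R + D.\<close>

lemma inverse_equivariant:
  assumes d: "equivariant R d" "\<And>x. \<bar>d x\<bar> \<le> D" "f = (\<lambda>x. x + d x)" and f: "inj f"
  shows "equivariant (R + D) (\<lambda>x. inv f x - x)" "\<bar>inv f x - x\<bar> \<le> D"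
proof -
  have cont: "continuous_on UNIV f"
    using d(1) by (auto simp: equivariant_def d(3) intro!: continuous_intros)
  have D: "\<bar>f x - x\<bar> \<le> D" for x using d(2) by (simp add: d(3))
  note sm = displacement_strict_mono[OF cont f D]
  have finv: "f (inv f x) = x" for x using sm(2) by (simp add: bij_is_surj surj_f_inv_f)
  show bd: "\<bar>inv f x - x\<bar> \<le> D" for x
    using D[of "inv f x"] finv[of x] by (simp add: abs_minus_commute)
  have "continuous_on UNIV (inv f)" by (rule continuous_on_inv_real[OF cont sm(2)])
  moreover have "inv f x - x = inv f y - y" if "E (R + D) x y" for x y
  proof -
    define u where "u = inv f x"
    have "E R (x + (u - x)) (y + (u - x))"
      using bd[of x] by (intro E_shift[OF that]) (simp add: u_def)
    then have "d u = d (u + (y - x))" using d(1) unfolding equivariant_def by (simp add: algebra_simps)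
    then have "f (u + (y - x)) = f u + (y - x)" by (simp add: d(3))
    also have "\<dots> = y" by (simp add: u_def finv)
    finally have "inv f y = u + (y - x)" using f by (metis inv_f_f)
    then show ?thesis by (simp add: u_def)
  qed
  ultimately show "equivariant (R + D) (\<lambda>x. inv f x - x)"
    unfolding equivariant_def by (auto intro!: continuous_intros)
qed

text \<open>For negative n the iteration is that of \<open>inv f\<close>, whose displacement has
  radius R + D; this accounts for the additional D.\<close>

lemma int_iterate_shift:
  assumes d: "equivariant R d" "\<And>x. \<bar>d x\<bar> \<le> D" "f = (\<lambda>x. x + d x)" and f: "inj f"
    and E: "E (R + D + \<bar>real_of_int n\<bar> * D) y (y + v)"
  shows "int_iterate f n (y + v) = int_iterate f n y + v"
proof (cases "n \<ge> 0")
  case True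
  have "0 \<le> D" using d(2)[of 0] by linarith
  then have "E (R + real (nat n) * D) y (y + v)" using E True by (elim E_mono) simp
  then show ?thesis using iterate_shift[OF d] True by (simp add: int_iterate_def)
next
  case False
  have "inv f = (\<lambda>x. x + (inv f x - x))" by simp
  moreover have "E (R + D + real (nat (- n)) * D) y (y + v)" using E False by (elim E_mono) simp
  ultimately show ?thesis
    using iterate_shift[OF inverse_equivariant[OF d f]] False by (simp add: int_iterate_def)
qed

text \<open>The increment m z - m x integrates \<mu> over the segment from x to z, and the pattern
  to distance R around this segment determines \<mu> there.\<close>

lemma integral_shift:
  assumes \<mu>: "equivariant R \<mu>" and m: "\<And>x. (m has_real_derivative \<mu> x) (at x)"
    and E: "E (R + \<bar>z - x\<bar>) x (x + v)"
  shows "m (z + v) - m (x + v) = m z - m x"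
proof -
  \<comment> \<open>Running along the segment with parameter s in [0, 1] treats both orders of x and
    z at once.\<close>
  define g where "g s = m (x + s * (z - x) + v) - m (x + s * (z - x))" for s
  have "\<exists>c. \<forall>s\<in>{0..1}. g s = c"
  proof (rule has_field_derivative_zero_constant)
    fix s :: real assume s: "s \<in> {0..1}"
    have "\<bar>s * (z - x)\<bar> \<le> (R + \<bar>z - x\<bar>) - R"
      using s by (simp add: abs_mult mult_left_le_one_le)
    then have "E R (x + s * (z - x)) (x + v + s * (z - x))" by (rule E_shift[OF E])
    then have eq: "\<mu> (x + s * (z - x)) = \<mu> (x + s * (z - x) + v)"
      using \<mu> unfolding equivariant_def by (metis add.assoc add.commute)
    have "(g has_real_derivative \<mu> (x + s * (z - x) + v) * (z - x) - \<mu> (x + s * (z - x)) * (z - x)) (at s)"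
      unfolding g_def
      by (intro DERIV_diff DERIV_chain2[where f = m] m) (auto intro!: derivative_eq_intros)
    then show "(g has_real_derivative 0) (at s within {0..1})"
      using eq by (simp add: has_field_derivative_at_within)
  qed simp
  then have "g 0 = g 1" by auto
  then show ?thesis by (simp add: g_def)
qed

end

subsection \<open>The semi-conjugacy on the line\<close>

text \<open>The case of positive \<mu>, with a common radius R. The rotation property appears as two
  one-sided comparisons, which follow from it once the iterates are known to increase with
  n.\<close>

locale rotation_line = recurrent_line E for E +
  fixes R D :: real and \<mu> m d f :: "real \<Rightarrow> real"
  assumes \<mu>_equivariant: "equivariant R \<mu>" and m_deriv: "(m has_real_derivative \<mu> x) (at x)" and \<mu>_pos: "\<mu> x > 0"
    and d_equivariant: "equivariant R d" and d_bound: "\<bar>d x\<bar> \<le> D" and f_eq: "f = (\<lambda>x. x + d x)" and f_inj: "inj f"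
    and rot_less: "E R x1 x2 \<Longrightarrow> m x2 - m x1 < real_of_int n \<Longrightarrow> x2 < int_iterate f n x1"
    and rot_greater: "E R x1 x2 \<Longrightarrow> real_of_int n < m x2 - m x1 \<Longrightarrow> int_iterate f n x1 < x2"
    and dense: "\<epsilon> > 0 \<Longrightarrow> \<exists>y n. E R 0 y \<and> \<bar>m y + real_of_int n - t\<bar> < \<epsilon>"
begin

lemma f_strict_mono: "strict_mono f" and f_bij: "bij f"
proof -
  have "continuous_on UNIV f" using d_equivariant by (auto simp: equivariant_def f_eq intro!: continuous_intros)
  moreover have "\<bar>f x - x\<bar> \<le> D" for x using d_bound by (simp add: f_eq)
  ultimately show "strict_mono f" "bij f" using displacement_strict_mono f_inj by blast+
qed

lemma m_lipschitz: "\<exists>M>0. \<forall>x y. \<bar>m y - m x\<bar> \<le> M * \<bar>y - x\<bar>"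
proof -
  obtain M where M: "M > 0" "\<And>x. \<bar>\<mu> x\<bar> \<le> M" using weakly_equivariant_bounded[OF equivariant_weakly_equivariant[OF \<mu>_equivariant]] by blast
  have "\<bar>m y - m x\<bar> \<le> M * \<bar>y - x\<bar>" for x y
    using field_differentiable_bound[of UNIV m \<mu> M y x] m_deriv M(2)
    by (auto simp: has_field_derivative_at_within)
  then show ?thesis using M(1) by blast
qed

definition recurrences where "recurrences = {y. E R 0 y}"

lemma recurrences_rel: "y \<in> recurrences \<Longrightarrow> y' \<in> recurrences \<Longrightarrow> E R y y'"
  unfolding recurrences_def using E_sym E_trans by blast

lemma recurrences_relatively_dense: "\<exists>L\<ge>0. \<forall>z. \<exists>y\<in>recurrences. \<bar>y - z\<bar> \<le> L"
proof -
  obtain L where L: "\<And>x z. \<exists>y. \<bar>y - z\<bar> \<le> L \<and> E R x y" using E_recur by metis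
  then have "0 \<le> L" by (meson abs_ge_zero order_trans)
  then show ?thesis using L unfolding recurrences_def by blast
qed

text \<open>\<open>rot_less\<close> read backwards: the order of points on the line bounds the order
  of the numbers. This makes the supremum finite and fixes its value on
  \<open>recurrences\<close>.\<close>

lemma recurrences_m_le:
  assumes "y \<in> recurrences" "y' \<in> recurrences" "int_iterate f n y' \<le> y"
  shows "m y' + of_int n \<le> m y"
proof (rule ccontr)
  assume "\<not> ?thesis"
  then have "y < int_iterate f n y'" by (intro rot_less recurrences_rel assms) simp
  then show False using assms by simp
qed

definition lower_values where "lower_values x = {m y + real_of_int n | y n. y \<in> recurrences \<and> int_iterate f n y \<le> x}"
definition semiconj where "semiconj x = Sup (lower_values x)"

lemma lower_values_le: "a \<in> lower_values x \<Longrightarrow> y \<in> recurrences \<Longrightarrow> x \<le> y \<Longrightarrow> a \<le> m y"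
  unfolding lower_values_def using recurrences_m_le by fastforce

lemma lower_values_mem: "y \<in> recurrences \<Longrightarrow> y \<le> x \<Longrightarrow> m y \<in> lower_values x"
  unfolding lower_values_def by (intro CollectI exI[of _ y] exI[of _ 0]) (simp add: int_iterate_def)

lemma recurrences_right: "\<exists>L. \<forall>x. \<exists>y\<in>recurrences. x \<le> y \<and> y \<le> x + L"
  and recurrences_left: "\<exists>L. \<forall>x. \<exists>y\<in>recurrences. y \<le> x \<and> x - L \<le> y"
proof -
  obtain L where L: "L \<ge> 0" "\<And>z. \<exists>y\<in>recurrences. \<bar>y - z\<bar> \<le> L" using recurrences_relatively_dense by blast
  have "\<exists>y\<in>recurrences. x \<le> y \<and> y \<le> x + 2 * L" for x
    using L(2)[of "x + L"] by (force simp: abs_le_iff)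
  then show "\<exists>L. \<forall>x. \<exists>y\<in>recurrences. x \<le> y \<and> y \<le> x + L" by blast
  have "\<exists>y\<in>recurrences. y \<le> x \<and> x - 2 * L \<le> y" for x
    using L(2)[of "x - L"] by (force simp: abs_le_iff)
  then show "\<exists>L. \<forall>x. \<exists>y\<in>recurrences. y \<le> x \<and> x - L \<le> y" by blast
qed

lemma lower_values_nonempty: "lower_values x \<noteq> {}" and lower_values_bdd: "bdd_above (lower_values x)"
proof -
  obtain y where "y \<in> recurrences" "y \<le> x" using recurrences_left by blast
  then show "lower_values x \<noteq> {}" using lower_values_mem by blast
  obtain y where "y \<in> recurrences" "x \<le> y" using recurrences_right by blast
  then show "bdd_above (lower_values x)" using lower_values_le by (meson bdd_aboveI)
qed

lemma semiconj_ge: "y \<in> recurrences \<Longrightarrow> int_iterate f n y \<le> x \<Longrightarrow> m y + of_int n \<le> semiconj x"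
  unfolding semiconj_def by (intro cSup_upper lower_values_bdd) (auto simp: lower_values_def)

lemma semiconj_mono: "x \<le> x' \<Longrightarrow> semiconj x \<le> semiconj x'"
  unfolding semiconj_def by (intro cSup_subset_mono lower_values_nonempty lower_values_bdd) (force simp: lower_values_def)

lemma semiconj_eq_m: "y \<in> recurrences \<Longrightarrow> semiconj y = m y"
  unfolding semiconj_def by (intro cSup_eq_maximum lower_values_mem) (auto intro: lower_values_le)

text \<open>Since f is increasing, f^n(y) <= x is equivalent to f^(n+1)(y) <= f(x), so the set under
  the supremum moves up by 1.\<close>

lemma semiconj_f: "semiconj (f x) = semiconj x + 1"
proof (rule antisym)
  have "a \<le> semiconj x + 1" if "a \<in> lower_values (f x)" for a
  proof -
    obtain y n where a: "a = m y + of_int n" "y \<in> recurrences" "int_iterate f n y \<le> f x"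
      using \<open>a \<in> lower_values (f x)\<close> by (auto simp: lower_values_def)
    have "f (int_iterate f (n - 1) y) \<le> f x" using int_iterate_Suc[OF f_bij, of "n - 1" y] a(3) by simp
    then have "int_iterate f (n - 1) y \<le> x" using f_strict_mono by (simp add: strict_mono_less_eq)
    then show ?thesis using semiconj_ge[OF a(2)] a(1) by force
  qed
  then show "semiconj (f x) \<le> semiconj x + 1" unfolding semiconj_def[of "f x"] by (intro cSup_least lower_values_nonempty)
  have "a \<le> semiconj (f x) - 1" if "a \<in> lower_values x" for a
  proof -
    obtain y n where a: "a = m y + of_int n" "y \<in> recurrences" "int_iterate f n y \<le> x"
      using \<open>a \<in> lower_values x\<close> by (auto simp: lower_values_def)
    have "int_iterate f (n + 1) y \<le> f x"
      using int_iterate_Suc[OF f_bij, of n y] a(3) f_strict_mono by (simp add: strict_mono_less_eq)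
    then show ?thesis using semiconj_ge[OF a(2)] a(1) by force
  qed
  then have "semiconj x \<le> semiconj (f x) - 1" unfolding semiconj_def[of x] by (intro cSup_least lower_values_nonempty)
  then show "semiconj x + 1 \<le> semiconj (f x)" by simp
qed

lemma semiconj_int_iterate: "semiconj (int_iterate f n x) = semiconj x + of_int n"
proof (induction n rule: int_induct[where k = 0])
  case base
  show ?case by (simp add: int_iterate_def)
next
  case (step1 i)
  then show ?case by (simp add: int_iterate_Suc[OF f_bij] semiconj_f)
next
  case (step2 i)
  then show ?case using int_iterate_Suc[OF f_bij, of "i - 1" x] semiconj_f[of "int_iterate f (i - 1) x"] by simp
qed

text \<open>The point x lies between two points of \<open>recurrences\<close> at bounded distance,
  where \<open>semiconj\<close> equals m, and m is Lipschitz.\<close>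

lemma semiconj_m_bounded: "\<exists>C. \<forall>x. \<bar>semiconj x - m x\<bar> \<le> C"
proof -
  obtain M where M: "M > 0" "\<And>x y. \<bar>m y - m x\<bar> \<le> M * \<bar>y - x\<bar>" using m_lipschitz by blast
  obtain L where L: "\<And>x. \<exists>y\<in>recurrences. x \<le> y \<and> y \<le> x + L" using recurrences_right by metis
  obtain L' where L': "\<And>x. \<exists>y\<in>recurrences. y \<le> x \<and> x - L' \<le> y" using recurrences_left by metis
  have "\<bar>semiconj x - m x\<bar> \<le> max (M * L) (M * L')" for x
  proof -
    obtain y where y: "y \<in> recurrences" "x \<le> y" "y \<le> x + L" using L by blast
    obtain y' where y': "y' \<in> recurrences" "y' \<le> x" "x - L' \<le> y'" using L' by blast
    have "semiconj x \<le> m y" "m y' \<le> semiconj x" using semiconj_mono semiconj_eq_m y y' by metis+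
    moreover have "m y - m x \<le> M * L"
    proof -
      have "M * \<bar>y - x\<bar> \<le> M * L" using y M(1) by (intro mult_left_mono) auto
      then show ?thesis using M(2)[of y x] by linarith
    qed
    moreover have "m x - m y' \<le> M * L'"
    proof -
      have "M * \<bar>y' - x\<bar> \<le> M * L'" using y' M(1) by (intro mult_left_mono) auto
      then show ?thesis using M(2)[of y' x] by linarith
    qed
    ultimately show ?thesis by linarith
  qed
  then show ?thesis by blast
qed

text \<open>A finite family of points of \<open>recurrences\<close> whose values of \<open>m\<close> are \<open>\<epsilon>\<close>-dense modulo 1 recurs, up to a
  common translation and a common additive constant, with bounded gaps.\<close>

lemma dense_uniform:
  assumes "\<epsilon> > 0"
  shows "\<exists>L. \<forall>x t. \<bar>t - m x\<bar> \<le> C \<longrightarrow>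
           (\<exists>y n. y \<in> recurrences \<and> \<bar>y - x\<bar> \<le> L \<and> \<bar>real_of_int n\<bar> \<le> L \<and> \<bar>m y + real_of_int n - t\<bar> < \<epsilon>)"
proof -
  obtain M where M: "M > 0" "\<And>x y. \<bar>m y - m x\<bar> \<le> M * \<bar>y - x\<bar>" using m_lipschitz by blast
  \<comment> \<open>The grid j / N has mesh below \<epsilon> / 2; the other half pays for
    approximating its points.\<close>
  obtain N where N: "N > 0" "inverse (real N) < \<epsilon> / 2"
    using reals_Archimedean[of "\<epsilon> / 2"] assms by (metis half_gt_zero zero_less_Suc)
  have "\<exists>y n. E R 0 y \<and> \<bar>m y + real_of_int n - real j / real N\<bar> < \<epsilon> / 2" for j :: nat
    using dense[of "\<epsilon> / 2"] assms by simp
  then obtain Y k where Y: "\<And>j. E R 0 (Y j)" "\<And>j. \<bar>m (Y j) + real_of_int (k j) - real j / real N\<bar> < \<epsilon> / 2"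
    by metis
  have mod1: "\<exists>j\<le>N. \<exists>n. \<bar>m (Y j) + real_of_int n - t\<bar> < \<epsilon>" for t
  proof -
    define j where "j = nat \<lfloor>frac t * real N\<rfloor>"
    have fr: "0 \<le> frac t" "frac t < 1" by (auto simp: frac_lt_1)
    have j: "real j = of_int \<lfloor>frac t * real N\<rfloor>" using fr by (simp add: j_def)
    have "real j \<le> frac t * real N" "frac t * real N < real j + 1" unfolding j by linarith+
    moreover have "frac t * real N \<le> 1 * real N" using fr by (intro mult_right_mono) auto
    ultimately have "real j \<le> real N" "real j / real N \<le> frac t" "frac t \<le> real j / real N + inverse (real N)"
      using N(1) by (linarith, auto simp: field_simps)
    then have "j \<le> N" "\<bar>real j / real N - frac t\<bar> < \<epsilon> / 2" using N(2) by auto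
    moreover have "\<bar>m (Y j) + real_of_int (k j) - real j / real N\<bar> < \<epsilon> / 2" by (rule Y)
    moreover have "t = frac t + of_int \<lfloor>t\<rfloor>" by (simp add: frac_def)
    ultimately have "\<bar>m (Y j) + real_of_int (k j + \<lfloor>t\<rfloor>) - t\<bar> < \<epsilon>" unfolding of_int_add by argo
    then show ?thesis using \<open>j \<le> N\<close> by blast
  qed
  define B where "B = Max ((\<lambda>j. \<bar>Y j\<bar>) ` {..N})"
  have B: "\<bar>Y j\<bar> \<le> B" if "j \<le> N" for j unfolding B_def using that by (intro Max_ge) auto
  \<comment> \<open>Radius R + B, so that the whole family Y 0, ..., Y N keeps its patterns when
    moved from 0 to v.\<close>
  obtain L0 where L0: "\<And>x z. \<exists>y. \<bar>y - z\<bar> \<le> L0 \<and> E (R + B) x y" using E_recur by metis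
  \<comment> \<open>The first entry bounds the distance from x to y, the second bounds n through the
    Lipschitz estimate for m.\<close>
  define L where "L = max (L0 + B) (M * (L0 + B) + C + \<epsilon>)"
  have "\<exists>y n. y \<in> recurrences \<and> \<bar>y - x\<bar> \<le> L \<and> \<bar>real_of_int n\<bar> \<le> L \<and> \<bar>m y + real_of_int n - t\<bar> < \<epsilon>"
    if t: "\<bar>t - m x\<bar> \<le> C" for x t
  proof -
    obtain v where v: "\<bar>v - x\<bar> \<le> L0" "E (R + B) 0 v" using L0 by blast
    \<comment> \<open>Moving the family by v adds m v - m 0 to its values of m; the target is
      corrected by this constant.\<close>
    obtain j n where j: "j \<le> N" "\<bar>m (Y j) + real_of_int n - (t - m v + m 0)\<bar> < \<epsilon>" using mod1 by blast
    define y where "y = Y j + v"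
    have "\<bar>Y j\<bar> \<le> (R + B) - R" using B[OF j(1)] by simp
    then have "E R (0 + Y j) (v + Y j)" by (rule E_shift[OF v(2)])
    then have "y \<in> recurrences" using Y(1)[of j] E_trans[of R 0 "Y j" y] by (simp add: recurrences_def y_def add.commute)
    moreover have "E (R + \<bar>Y j - 0\<bar>) 0 (0 + v)" using E_mono[OF v(2), of "R + \<bar>Y j\<bar>"] B[OF j(1)] by simp
    then have "m (Y j + v) - m (0 + v) = m (Y j) - m 0"
      by (rule integral_shift[OF \<mu>_equivariant m_deriv])
    then have my: "\<bar>m y + real_of_int n - t\<bar> < \<epsilon>" using j(2) by (simp add: y_def)
    moreover have yx: "\<bar>y - x\<bar> \<le> L0 + B" using v(1) B[OF j(1)] unfolding y_def by linarith
    moreover have "\<bar>real_of_int n\<bar> \<le> M * (L0 + B) + C + \<epsilon>"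
    proof -
      have "M * \<bar>y - x\<bar> \<le> M * (L0 + B)" using yx M(1) by (intro mult_left_mono) auto
      then have "\<bar>m y - m x\<bar> \<le> M * (L0 + B)" using M(2)[of y x] by linarith
      then show ?thesis using my t by linarith
    qed
    ultimately show ?thesis by (intro exI[of _ y] exI[of _ n]) (auto simp: L_def)
  qed
  then show ?thesis by blast
qed

text \<open>\<open>semiconj\<close> takes the value m y + n at f^n(y), so monotonicity turns a
  strict inequality of values into one of points.\<close>

lemma semiconj_less_imp: "y \<in> recurrences \<Longrightarrow> m y + of_int n < semiconj x \<Longrightarrow> int_iterate f n y < x"
  using semiconj_mono[of x "int_iterate f n y"] semiconj_int_iterate[of n y] semiconj_eq_m[of y] by force

lemma semiconj_greater_imp: "y \<in> recurrences \<Longrightarrow> semiconj x < m y + of_int n \<Longrightarrow> x < int_iterate f n y"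
  using semiconj_mono[of "int_iterate f n y" x] semiconj_int_iterate[of n y] semiconj_eq_m[of y] by force

text \<open>A monotone function with dense range has no jump; here the values m y + n, attained at
  the points f^n(y), are dense.\<close>

lemma semiconj_continuous: "continuous_on UNIV semiconj"
proof -
  have "\<exists>\<delta>>0. \<forall>x'. \<bar>x' - x\<bar> < \<delta> \<longrightarrow> \<bar>semiconj x' - semiconj x\<bar> < \<epsilon>" if \<epsilon>: "\<epsilon> > 0" for x \<epsilon>
  proof -
    \<comment> \<open>Target \<open>semiconj x - \<epsilon> / 2\<close> with error below \<epsilon>
      / 2 puts the value strictly between \<open>semiconj x - \<epsilon>\<close> and
      \<open>semiconj x\<close>; the second pair does the same on the other side.\<close>
    obtain y n where y: "y \<in> recurrences" "\<bar>m y + of_int n - (semiconj x - \<epsilon> / 2)\<bar> < \<epsilon> / 2"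
      using dense[of "\<epsilon> / 2" "semiconj x - \<epsilon> / 2"] \<epsilon> unfolding recurrences_def by auto
    obtain y' n' where y': "y' \<in> recurrences" "\<bar>m y' + of_int n' - (semiconj x + \<epsilon> / 2)\<bar> < \<epsilon> / 2"
      using dense[of "\<epsilon> / 2" "semiconj x + \<epsilon> / 2"] \<epsilon> unfolding recurrences_def by auto
    let ?a = "int_iterate f n y" and ?b = "int_iterate f n' y'"
    have "?a < x" by (rule semiconj_less_imp[OF y(1)]) (use y(2) in linarith)
    moreover have "x < ?b" by (rule semiconj_greater_imp[OF y'(1)]) (use y'(2) in linarith)
    moreover have "\<bar>semiconj x' - semiconj x\<bar> < \<epsilon>" if "?a \<le> x'" "x' \<le> ?b" for x'
    proof -
      have "semiconj ?a \<le> semiconj x'" "semiconj x' \<le> semiconj ?b" using that by (auto intro: semiconj_mono)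
      moreover have "semiconj ?a = m y + of_int n" "semiconj ?b = m y' + of_int n'"
        using semiconj_int_iterate semiconj_eq_m y(1) y'(1) by auto
      ultimately show ?thesis using y(2) y'(2) by linarith
    qed
    ultimately show ?thesis by (intro exI[of _ "min (x - ?a) (?b - x)"]) (auto simp: abs_less_iff)
  qed
  then show ?thesis unfolding continuous_on_iff dist_real_def by blast
qed

text \<open>A pair (y, n) that nearly attains the supremum at x is carried by the translation v = x'
  - x to a pair admissible at x', and m(y + v) - m y = m x' - m x. This bounds the function at x'
  from below; exchanging x and x' gives the other bound.\<close>

lemma semiconj_minus_m_weakly_equivariant: "weakly_equivariant (\<lambda>x. semiconj x - m x)"
  unfolding weakly_equivariant_def
proof (intro conjI allI impI)
  have "continuous_on UNIV m" using m_deriv by (meson DERIV_isCont continuous_at_imp_continuous_on)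
  then show "continuous_on UNIV (\<lambda>x. semiconj x - m x)" using semiconj_continuous by (intro continuous_intros)
  fix \<epsilon> :: real assume \<epsilon>: "\<epsilon> > 0"
  obtain C where C: "\<And>x. \<bar>semiconj x - m x\<bar> \<le> C" using semiconj_m_bounded by blast
  obtain L where L: "\<And>x t. \<bar>t - m x\<bar> \<le> C + \<epsilon> \<Longrightarrow> \<exists>y n. y \<in> recurrences \<and> \<bar>y - x\<bar> \<le> L \<and>
      \<bar>real_of_int n\<bar> \<le> L \<and> \<bar>m y + real_of_int n - t\<bar> < \<epsilon> / 2"
    using dense_uniform[of "\<epsilon> / 2" "C + \<epsilon>"] \<epsilon> by (metis half_gt_zero)
  have D: "0 \<le> D" using d_bound[of 0] by linarith
  \<comment> \<open>L leads from x to y; around y, radius R + D + L D lets up to L iterates of f or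
    of its inverse commute with the translation.\<close>
  define K where "K = R + L + D + L * D"
  have one: "semiconj x - m x - \<epsilon> \<le> semiconj x' - m x'" if E: "E K x x'" for x x'
  proof -
    have "\<bar>semiconj x - \<epsilon> / 2 - m x\<bar> \<le> C + \<epsilon>" using C[of x] \<epsilon> by linarith
    from L[OF this] obtain y n where y: "y \<in> recurrences" "\<bar>y - x\<bar> \<le> L" "\<bar>real_of_int n\<bar> \<le> L"
        "\<bar>m y + real_of_int n - (semiconj x - \<epsilon> / 2)\<bar> < \<epsilon> / 2" by blast
    define v where "v = x' - x"
    have nD: "\<bar>real_of_int n\<bar> * D \<le> L * D" using y(3) D by (intro mult_right_mono)
    have LD: "0 \<le> L * D" using nD D y(3) by (meson abs_ge_zero mult_nonneg_nonneg order_trans)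
    have "int_iterate f n y < x" by (rule semiconj_less_imp[OF y(1)]) (use y(4) in linarith)
    moreover have E': "E (R + D + L * D) y (y + v)"
      using E_shift[OF E, of "y - x" "R + D + L * D"] y(2) by (simp add: K_def v_def algebra_simps)
    have "int_iterate f n (y + v) = int_iterate f n y + v"
      by (rule int_iterate_shift[OF d_equivariant d_bound f_eq f_inj]) (rule E_mono[OF E'], use nD in simp)
    ultimately have "int_iterate f n (y + v) \<le> x'" by (simp add: v_def)
    moreover have "E R y (y + v)" by (rule E_mono[OF E']) (use D LD in simp)
    then have "y + v \<in> recurrences" using y(1) E_trans[of R 0 y "y + v"] by (simp add: recurrences_def)
    ultimately have "m (y + v) + of_int n \<le> semiconj x'" by (intro semiconj_ge)
    moreover have "E (R + \<bar>y - x\<bar>) x (x + v)"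
      using E_mono[OF E, of "R + \<bar>y - x\<bar>"] y(2) D LD by (simp add: K_def v_def)
    then have "m (y + v) - m (x + v) = m y - m x" by (rule integral_shift[OF \<mu>_equivariant m_deriv])
    moreover have "x + v = x'" by (simp add: v_def)
    moreover have "semiconj x - \<epsilon> < m y + of_int n" using y(4) unfolding abs_less_iff by linarith
    ultimately show ?thesis by simp
  qed
  have "\<bar>semiconj x - m x - (semiconj x' - m x')\<bar> \<le> \<epsilon>" if "E K x x'" for x x'
    using one[OF that] one[OF E_sym[OF that]] by linarith
  then show "\<exists>R. \<forall>x y. E R x y \<longrightarrow> \<bar>semiconj x - m x - (semiconj y - m y)\<bar> \<le> \<epsilon>" by blast
qed

end

subsection \<open>Density from minimality of the shape change\<close>

lemma agree_on_translate_subset: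
  assumes "agree_on B S S'" "(\<lambda>x. x + s) ` C \<subseteq> B"
  shows "agree_on C (translate s S) (translate s S')"
  using agree_on_mono[OF assms] by (simp add: agree_on_def patch_translate)

lemma tiling_dist_translate:
  assumes "0 < e"
  shows "\<exists>d>0. \<forall>S S'. tiling_dist S S' < d \<longrightarrow> tiling_dist (translate r S) (translate r S') \<le> e"
proof -
  obtain d where d: "0 < d" "d \<le> 1" "d \<le> e / 2" "inverse e + \<bar>r\<bar> \<le> inverse d - d"
    using ex_small_with_large_inverse[of "e / 2" "inverse e + \<bar>r\<bar>"] assms by auto
  have "tiling_dist (translate r S) (translate r S') \<le> e" if S: "tiling_dist S S' < d" for S S' :: "'a tiling"
  proof -
    obtain s where s: "\<bar>s\<bar> \<le> d" "agree (inverse d - d) S (translate s S')"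
      using tiling_close_dist[OF S d(2)] .
    have "agree (inverse e) (translate r S) (translate r (translate s S'))"
      using agree_translate[OF s(2)] d(4) by simp
    then have "agree (inverse e) (translate r S) (translate s (translate r S'))"
      by (simp add: translate_translate add.commute)
    then show ?thesis using s(1) d(3) by (intro tiling_dist_le_agree[of e s] assms) auto
  qed
  then show ?thesis using d(1) by blast
qed

lemma orbit_closure_translate:
  assumes T: "is_tiling T" and S: "S \<in> orbit_closure T"
  shows "translate s S \<in> orbit_closure T"
proof -
  have "\<exists>r. agree K (translate s S) (translate r T)" for K
  proof -
    obtain r where "agree (K + \<bar>s\<bar>) S (translate r T)" using S mem_orbit_closure_iff[OF T] by blast
    then have "agree K (translate s S) (translate s (translate r T))"
      by (rule agree_translate) simp
    then show ?thesis by (metis translate_translate)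
  qed
  moreover have "is_tiling (translate s S)"
    using S mem_orbit_closure_iff[OF T] is_tiling_translate by blast
  ultimately show ?thesis by (simp add: mem_orbit_closure_iff[OF T])
qed

lemma translate_orbit_mem: "is_tiling T \<Longrightarrow> translate s T \<in> orbit_closure T"
  using orbit_closure_translate mem_orbit_closure_iff agree_refl translate_0 by metis

text \<open>The closure of the orbit of T - t under unit translations is closed, invariant and
  nonempty, hence the whole space, so T - s is approximated by some T - (t + n). The error r is the
  small shift that the metric allows.\<close>

lemma minimal_unit_translation_dense:
  assumes T: "is_tiling T" and min: "minimal_map (space_topology (orbit_closure T)) (translate 1)"
    and \<epsilon>: "\<epsilon> > 0"
  shows "\<exists>n r. \<bar>r\<bar> \<le> \<epsilon> \<and> agree K (translate s T) (translate (t + real_of_int n + r) T)"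
proof -
  define Z where "Z = range (\<lambda>n. translate (t + real_of_int n) T)"
  define A where "A = tiling_topology closure_of Z \<inter> orbit_closure T"
  have cl: "S \<in> tiling_topology closure_of Z \<longleftrightarrow>
      is_tiling S \<and> (\<forall>r>0. \<exists>n. tiling_dist S (translate (t + real_of_int n) T) < r)" for S
    unfolding tiling_topology_def tiling.metric_closure_of Z_def
    using is_tiling_translate[OF T] by (auto simp: tiling.in_mball)
  \<comment> \<open>Invariance under all integers, negative ones included, makes A equal to its
    image, as \<open>minimal_map\<close> demands, and not just a superset of it.\<close>
  have inv: "translate (of_int k) S \<in> A" if S: "S \<in> A" for S and k :: int
  proof -
    have S1: "is_tiling S" and S2: "\<And>r. r > 0 \<Longrightarrow> \<exists>n. tiling_dist S (translate (t + real_of_int n) T) < r"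
      using S cl unfolding A_def by auto
    have "\<exists>n. tiling_dist (translate (of_int k) S) (translate (t + real_of_int n) T) < r" if "r > 0" for r
    proof -
      have "r / 2 > 0" using that by simp
      obtain d where d: "d > 0" "\<And>S S' :: 'a tiling. tiling_dist S S' < d \<Longrightarrow>
          tiling_dist (translate (of_int k) S) (translate (of_int k) S') \<le> r / 2"
        using tiling_dist_translate[OF \<open>r / 2 > 0\<close>, of "of_int k"] by blast
      obtain n where "tiling_dist S (translate (t + real_of_int n) T) < d" using S2[OF d(1)] by blast
      then have "tiling_dist (translate (of_int k) S) (translate (of_int k) (translate (t + real_of_int n) T)) \<le> r / 2"
        by (rule d(2))
      then have "tiling_dist (translate (of_int k) S) (translate (t + real_of_int (n + k)) T) < r"
        using that by (simp add: translate_translate add.assoc)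
      then show ?thesis by blast
    qed
    then show ?thesis
      using S is_tiling_translate[OF S1] orbit_closure_translate[OF T] cl unfolding A_def by blast
  qed
  have "translate 1 ` A = A"
  proof (rule antisym)
    show "translate 1 ` A \<subseteq> A" using inv[of _ 1] by auto
    show "A \<subseteq> translate 1 ` A"
    proof
      fix S assume "S \<in> A"
      then have "translate (- 1) S \<in> A" using inv[of S "-1"] by simp
      moreover have "S = translate 1 (translate (- 1) S)" by (simp add: translate_translate)
      ultimately show "S \<in> translate 1 ` A" by (rule rev_image_eqI)
    qed
  qed
  moreover have "closedin (space_topology (orbit_closure T)) A"
    unfolding space_topology_def A_def closedin_subtopology by (rule exI[of _ "tiling_topology closure_of Z"]) simp
  moreover have "translate t T \<in> tiling_topology closure_of Z"
    unfolding cl using is_tiling_translate[OF T]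
    by (auto intro!: exI[of _ 0] simp: tiling_dist_self)
  then have "translate t T \<in> A" unfolding A_def using translate_orbit_mem[OF T] by blast
  ultimately have "A = topspace (space_topology (orbit_closure T))"
    using min unfolding minimal_map_def by blast
  moreover have "topspace (space_topology (orbit_closure T)) = orbit_closure T"
    using mem_orbit_closure_iff[OF T]
    by (auto simp: space_topology_def tiling_topology_def)
  ultimately have "translate s T \<in> A" using translate_orbit_mem[OF T] by simp
  then have *: "\<And>r. r > 0 \<Longrightarrow> \<exists>n. tiling_dist (translate s T) (translate (t + real_of_int n) T) < r"
    unfolding A_def Int_iff cl by blast
  obtain d where d: "0 < d" "d \<le> 1" "d \<le> \<epsilon>" "K \<le> inverse d - d"
    using ex_small_with_large_inverse[OF \<epsilon>, of K] .
  obtain n where n: "tiling_dist (translate s T) (translate (t + real_of_int n) T) < d"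
    using *[OF d(1)] by blast
  obtain r where "\<bar>r\<bar> \<le> d" "agree (inverse d - d) (translate s T) (translate r (translate (t + real_of_int n) T))"
    using tiling_close_dist[OF n d(2)] .
  then show ?thesis using d agree_mono by (metis order_trans translate_translate)
qed

section \<open>Collared labels and the shape change\<close>

lemma collar_label_Icc:
  assumes "a \<le> b" shows "collar_label R T {a..b} = patch {- R..b - a + R} (translate a T)"
proof -
  have "(\<lambda>x. x + a) ` {- R..b - a + R} = {a - R..b + R}" by (simp add: add.commute)
  then show ?thesis using assms by (simp add: collar_label_def patch_translate)
qed

text \<open>A collared label contains its tile rebased to start at 0. If two labels coincide, both
  rebased tiles lie in one tiling and overlap to the right of 0, so they are equal.\<close>

lemma collar_label_eqD:
  assumes T: "is_tiling T" and R: "0 \<le> R" and t: "({a..b}, l) \<in> T" "a < b" and t': "({c..d}, l') \<in> T" "c < d"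
    and eq: "collar_label R T {a..b} = collar_label R T {c..d}"
  shows "d - c = b - a" "l' = l" "agree_on {- R..b - a + R} (translate a T) (translate c T)"
proof -
  let ?t = "({0..b - a}, l)" and ?t' = "({0..d - c}, l')"
  have "translate_tile a ({a..b}, l) \<in> translate a T" using t(1) unfolding translate_def by blast
  then have "?t \<in> translate a T" by (simp add: translate_tile_def)
  moreover have "0 \<in> fst ?t \<inter> {- R..b - a + R}" using t R by auto
  ultimately have "?t \<in> collar_label R T {a..b}"
    using t by (simp only: collar_label_Icc less_imp_le) (auto simp: patch_def)
  then have 1: "?t \<in> translate c T" using eq t'(2) by (simp add: collar_label_Icc patch_def)
  have "translate_tile c ({c..d}, l') \<in> translate c T" using t'(1) unfolding translate_def by blast
  then have 2: "?t' \<in> translate c T" by (simp add: translate_tile_def)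
  define x where "x = min (b - a) (d - c) / 2"
  have x: "0 < x" "x < b - a" "x \<in> {0..d - c}" using t(2) t'(2) by (auto simp: x_def)
  have "{0..b - a} = {0..d - c} \<and> l = l'" by (rule tile_eqI[OF is_tiling_translate[OF T] 1 2 x])
  then show dc: "d - c = b - a" "l' = l" using t(2) t'(2) by (auto simp: Icc_eq_Icc)
  then show "agree_on {- R..b - a + R} (translate a T) (translate c T)"
    using eq t(2) t'(2) by (simp add: collar_label_Icc agree_on_def)
qed

locale tiling_shape_change = minimal_tiling_space \<Omega> for \<Omega> :: "'l tiling set" +
  fixes T :: "'l tiling" and R :: real and \<mu> m :: "real \<Rightarrow> real"
  assumes T_mem: "T \<in> \<Omega>" and R_nonneg: "0 \<le> R"
    and \<mu>_PE: "PE_radius T R \<mu>"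
    and m_deriv: "(m has_real_derivative \<mu> x) (at x)"
    and m_mono: "strict_mono m \<or> strict_mono (\<lambda>x. - m x)"
    and m_surj: "surj m"
begin

definition lab :: "'l tile \<Rightarrow> 'l tile set" where "lab t = collar_label R T (fst t)"
definition T' where "T' = (\<lambda>t. (m ` fst t, lab t)) ` T"

lemma T_tiling: "is_tiling T" using T_mem tilings by blast

lemma m_cont: "continuous_on UNIV m"
  using m_deriv by (meson DERIV_isCont continuous_at_imp_continuous_on)

lemma m_inj: "inj m"
  using m_mono strict_mono_eq[of m] strict_mono_eq[of "\<lambda>x. - m x"] by (auto simp: inj_def)

text \<open>Points at the same place of two equally collared tiles have the same pattern of radius
  R, hence the same \<mu>; so m(x + (c - a)) - m x has derivative 0 along the tile.\<close>

lemma m_collar_shift: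
  assumes t: "({a..b}, l) \<in> T" "a < b" and t': "({c..d}, l') \<in> T" "c < d"
    and eq: "collar_label R T {a..b} = collar_label R T {c..d}" and x: "x \<in> {a..b}"
  shows "m (x + (c - a)) = m x + (m c - m a)"
proof -
  define v where "v = c - a"
  have ag: "agree_on {- R..b - a + R} (translate a T) (translate c T)"
    by (rule collar_label_eqD(3)[OF T_tiling R_nonneg t t' eq])
  have "\<exists>k. \<forall>x\<in>{a..b}. m (x + v) - m x = k"
  proof (rule has_field_derivative_zero_constant)
    fix x assume x: "x \<in> {a..b}"
    have "agree R (translate (x - a) (translate a T)) (translate (x - a) (translate c T))"
      by (rule agree_on_translate_subset[OF ag]) (use x in auto)
    then have "\<mu> (x + v) = \<mu> x"
      using \<mu>_PE unfolding PE_radius_def by (simp add: translate_translate v_def algebra_simps)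
    moreover have "((\<lambda>x. m (x + v) - m x) has_real_derivative \<mu> (x + v) * 1 - \<mu> x) (at x)"
      by (intro DERIV_diff DERIV_chain2[where f = m] m_deriv) (auto intro!: derivative_eq_intros)
    ultimately show "((\<lambda>x. m (x + v) - m x) has_real_derivative 0) (at x within {a..b})"
      by (simp add: has_field_derivative_at_within)
  qed simp
  then obtain k where k: "\<And>x. x \<in> {a..b} \<Longrightarrow> m (x + v) - m x = k" by blast
  show ?thesis using k[OF x] k[of a] t(2) by (simp add: v_def)
qed

lemma m_collar_image:
  assumes t: "({a..b}, l) \<in> T" "a < b" and t': "({c..d}, l') \<in> T" "c < d"
    and eq: "collar_label R T {a..b} = collar_label R T {c..d}"
  shows "m ` {c..d} = (\<lambda>x. x + (m c - m a)) ` m ` {a..b}"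
proof -
  have d: "d = b + (c - a)" using collar_label_eqD(1)[OF T_tiling R_nonneg t t' eq] by simp
  have "{c..d} = (\<lambda>x. x + (c - a)) ` {a..b}" unfolding d image_add_atLeastAtMost' by simp
  then have "m ` {c..d} = (\<lambda>x. m (x + (c - a))) ` {a..b}" by (simp only: image_image)
  also have "\<dots> = (\<lambda>x. m x + (m c - m a)) ` {a..b}"
    using m_collar_shift[OF t t' eq] by (intro image_cong) auto
  finally show ?thesis by (simp only: image_image)
qed

text \<open>By recurrence each tile occurs with its collar at a tile that starts within L of the
  origin, and only finitely many tiles meet [- L, L].\<close>

lemma finite_collar_labels: "finite (lab ` T)"
proof -
  obtain \<delta> M where M: "0 < \<delta>" "0 < M" "\<And>r. r \<in> tile_lengths T \<Longrightarrow> \<delta> \<le> r \<and> r \<le> M"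
    using tile_lengths_bounds[OF T_tiling] by blast
  \<comment> \<open>Radius R + M around the left end point contains the collar of a tile of length
    at most M.\<close>
  obtain L where L: "\<And>S S'. S \<in> \<Omega> \<Longrightarrow> S' \<in> \<Omega> \<Longrightarrow> \<exists>y. \<bar>y\<bar> \<le> L \<and> agree (R + M) S (translate y S')"
    using recur by metis
  have "lab ` T \<subseteq> lab ` patch {- L..L} T"
  proof (rule image_subsetI)
    fix t assume t: "t \<in> T"
    obtain a b l where 1: "a < b" "t = ({a..b}, l)" using tiling_tileE[OF T_tiling t] .
    have len: "b - a \<le> M" using M(3)[of "b - a"] 1 t by (auto simp: tile_lengths_def)
    obtain y where y: "\<bar>y\<bar> \<le> L" "agree (R + M) (translate a T) (translate y T)"
      using L[OF invariant[OF T_mem] T_mem] by blast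
    have ag: "agree_on {- R..b - a + R} (translate a T) (translate y T)"
      by (rule agree_on_mono[OF y(2)]) (use len M R_nonneg in auto)
    have "translate_tile a t \<in> translate a T" using t unfolding translate_def by blast
    then have "({0..b - a}, l) \<in> translate a T" using 1 by (simp add: translate_tile_def)
    moreover have "{0..b - a} \<inter> {- R..b - a + R} \<noteq> {}" using 1 R_nonneg by auto
    ultimately have "({0..b - a}, l) \<in> translate y T"
      using ag by (auto simp: agree_on_def patch_def)
    then have "translate_tile (- y) ({0..b - a}, l) \<in> translate (- y) (translate y T)"
      unfolding translate_def by blast
    then have t': "({y..y + (b - a)}, l) \<in> T"
      by (simp add: translate_tile_def translate_translate add.commute)
    have "lab t = lab ({y..y + (b - a)}, l)"
      using ag 1 by (simp add: lab_def collar_label_Icc agree_on_def)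
    moreover have "({y..y + (b - a)}, l) \<in> patch {- L..L} T" using t' y(1) 1 by (force simp: patch_def)
    ultimately show "lab t \<in> lab ` patch {- L..L} T" by blast
  qed
  then show ?thesis using finite_patch[OF T_tiling] finite_subset by blast
qed

lemma T'_tiling: "is_tiling T'"
  unfolding T'_def
proof (rule is_tiling_image[OF T_tiling m_cont m_mono m_surj finite_collar_labels])
  fix t t' assume t: "t \<in> T" "t' \<in> T" "lab t = lab t'"
  obtain a b l where 1: "a < b" "t = ({a..b}, l)" using tiling_tileE[OF T_tiling t(1)] .
  obtain c d l' where 2: "c < d" "t' = ({c..d}, l')" using tiling_tileE[OF T_tiling t(2)] .
  have "m ` {c..d} = (\<lambda>x. x + (m c - m a)) ` m ` {a..b}"
    by (rule m_collar_image) (use t 1 2 in \<open>auto simp: lab_def\<close>)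
  then show "\<exists>s. m ` fst t' = (\<lambda>x. x + s) ` m ` fst t" using 1 2 by auto
qed

text \<open>On each tile, the coordinate change carrying \<open>T - y0\<close> to \<open>T - y\<close> is a translation. The
  translation vector depends continuously on the point and takes finitely many values, hence it is
  the same for all the tiles.\<close>

lemma agree_shape:
  assumes K: "0 < K" and K': "\<And>x. \<bar>x - y0\<bar> \<le> K \<Longrightarrow> \<bar>m x - m y0\<bar> \<le> K'"
    and ag: "agree K' (translate (m y0) T') (translate (m y) T')"
  shows "agree K (translate y0 T) (translate y T)"
proof -
  define Q where "Q = patch {y0 - K..y0 + K} T"
  \<comment> \<open>In the deformed coordinate, x + D x lies relative to y as x does relative to
    y0.\<close>
  define D where "D x = inv m (m x - m y0 + m y) - x" for x
  have bij: "bij m" using m_inj m_surj by (simp add: bij_def)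
  have D_cont: "continuous_on UNIV D"
    unfolding D_def
    by (intro continuous_intros m_cont continuous_on_compose2[OF continuous_on_inv_real[OF m_cont bij]]) auto
  have tile: "\<exists>v. (\<forall>x\<in>{a..b}. D x = v) \<and> ({a + v..b + v}, l) \<in> T"
    if q: "({a..b}, l) \<in> Q" "a < b" for a b l
  proof -
    have t: "({a..b}, l) \<in> T" using q by (simp add: Q_def patch_def)
    have "{a..b} \<inter> {y0 - K..y0 + K} \<noteq> {}" using q by (simp add: Q_def patch_def)
    then obtain x where "x \<in> {a..b}" "x \<in> {y0 - K..y0 + K}" by blast
    then have x: "x \<in> {a..b}" "\<bar>x - y0\<bar> \<le> K" by (auto simp: abs_le_iff)
    let ?t = "(m ` {a..b}, lab ({a..b}, l))"
    have "?t \<in> T'" using t by (force simp: T'_def)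
    then have "translate_tile (m y0) ?t \<in> translate (m y0) T'" unfolding translate_def by blast
    moreover have "m x - m y0 \<in> fst (translate_tile (m y0) ?t) \<inter> {- K'..K'}"
      using x K'[OF x(2)] by (auto simp: translate_tile_def abs_le_iff)
    ultimately have "translate_tile (m y0) ?t \<in> patch {- K'..K'} (translate (m y0) T')"
      unfolding patch_def by blast
    then have "translate_tile (m y0) ?t \<in> translate (m y) T'" using ag by (auto simp: agree_on_def patch_def)
    then obtain t' where t': "t' \<in> T" "translate_tile (m y0) ?t = translate_tile (m y) (m ` fst t', lab t')"
      by (auto simp: translate_def T'_def)
    obtain c d l' where cd: "c < d" "t' = ({c..d}, l')" using tiling_tileE[OF T_tiling t'(1)] .
    have t'T: "({c..d}, l') \<in> T" using t' cd by simp
    have eq: "collar_label R T {a..b} = collar_label R T {c..d}"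
      using t'(2) cd by (simp add: translate_tile_def lab_def)
    obtain p q where pq: "p < q" "m ` {a..b} = {p..q}" using homeo_image_Icc[OF m_cont m_mono \<open>a < b\<close>] .
    have im: "m ` {c..d} = {p + (m c - m a)..q + (m c - m a)}"
      using m_collar_image[OF t \<open>a < b\<close> t'T cd(1) eq] pq by simp
    have "(\<lambda>x. x - m y0) ` m ` {a..b} = (\<lambda>x. x - m y) ` m ` {c..d}"
      using t'(2) cd by (simp add: translate_tile_def)
    then have "{p - m y0..q - m y0} = {p + (m c - m a) - m y..q + (m c - m a) - m y}"
      unfolding im pq(2) by simp
    then have "p - m y0 = p + (m c - m a) - m y" using pq(1) by (simp add: Icc_eq_Icc)
    then have s: "m c - m a = m y - m y0" by simp
    have "D x = c - a" if "x \<in> {a..b}" for x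
    proof -
      have "m (x + (c - a)) = m x - m y0 + m y"
        using m_collar_shift[OF t \<open>a < b\<close> t'T cd(1) eq that] s by simp
      then have "inv m (m x - m y0 + m y) = x + (c - a)" using m_inj by (metis inv_f_f)
      then show ?thesis by (simp add: D_def)
    qed
    moreover have "a + (c - a) = c" "b + (c - a) = d" "l' = l"
      using collar_label_eqD(1,2)[OF T_tiling R_nonneg t \<open>a < b\<close> t'T cd(1) eq] by simp_all
    then have "({a + (c - a)..b + (c - a)}, l) \<in> T" using t'T by (simp only:)
    ultimately show ?thesis by blast
  qed
  have "\<exists>v. \<forall>x\<in>{y0 - K..y0 + K}. D x = v"
  proof -
    have "D ` {y0 - K..y0 + K} \<subseteq> (\<lambda>t. D (Inf (fst t))) ` Q"
    proof (rule image_subsetI)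
      fix x assume x: "x \<in> {y0 - K..y0 + K}"
      obtain a b l where 1: "a < b" "({a..b}, l) \<in> T" "x \<in> {a..b}" using tiling_coverE[OF T_tiling] .
      have q: "({a..b}, l) \<in> Q" using 1 x by (auto simp: Q_def patch_def)
      have "D x = D a" using tile[OF q 1(1)] 1 by auto
      then show "D x \<in> (\<lambda>t. D (Inf (fst t))) ` Q" using q 1(1) by force
    qed
    moreover have "finite Q" unfolding Q_def by (rule finite_patch[OF T_tiling])
    ultimately have "finite (D ` {y0 - K..y0 + K})" by (meson finite_imageI finite_subset)
    then have "D constant_on {y0 - K..y0 + K}"
      using continuous_finite_range_constant[of "{y0 - K..y0 + K}" D] continuous_on_subset[OF D_cont] by auto
    then show ?thesis unfolding constant_on_def by blast
  qed
  then obtain v where v: "\<And>x. x \<in> {y0 - K..y0 + K} \<Longrightarrow> D x = v" by blast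
  have "D y0 = y - y0" using m_inj by (simp add: D_def)
  then have vy: "v = y - y0" using v[of y0] K by simp
  have "patch {- K..K} (translate y0 T) \<subseteq> translate y T"
  proof
    fix t assume "t \<in> patch {- K..K} (translate y0 T)"
    then have "t \<in> translate y0 Q" by (simp add: patch_translate Q_def add.commute)
    then obtain u where u: "u \<in> Q" "t = translate_tile y0 u" by (auto simp: translate_def)
    have uT: "u \<in> T" using u by (simp add: Q_def patch_def)
    obtain a b l where 1: "a < b" "u = ({a..b}, l)" using tiling_tileE[OF T_tiling uT] .
    have "{a..b} \<inter> {y0 - K..y0 + K} \<noteq> {}" using u 1 by (simp add: Q_def patch_def)
    then obtain x where x: "x \<in> {a..b}" "x \<in> {y0 - K..y0 + K}" by blast
    obtain w where w: "\<And>x. x \<in> {a..b} \<Longrightarrow> D x = w" "({a + w..b + w}, l) \<in> T"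
      using tile[of a b l] u 1 by blast
    have "w = y - y0" using w(1)[OF x(1)] v[OF x(2)] vy by simp
    then have "({a + (y - y0)..b + (y - y0)}, l) \<in> T" using w(2) by simp
    then have "translate_tile y ({a + (y - y0)..b + (y - y0)}, l) \<in> translate y T"
      unfolding translate_def by blast
    then show "t \<in> translate y T" using u 1 by (simp add: translate_tile_def)
  qed
  then show ?thesis by (intro patch_determined is_tiling_translate T_tiling)
qed

text \<open>By minimality T' shows its window around m y0 again at some position t + n + r with
  small r. Read back through m, this position is a point y with the pattern of y0.\<close>

lemma values_dense_mod_1:
  assumes min: "minimal_map (space_topology (orbit_closure T')) (translate 1)" and \<epsilon>: "\<epsilon> > 0"
  shows "\<exists>y n. agree K (translate y0 T) (translate y T) \<and> \<bar>m y + real_of_int n - t\<bar> < \<epsilon>"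
proof -
  \<comment> \<open>\<open>agree_shape\<close> needs a positive radius, while K is
    arbitrary.\<close>
  define K1 where "K1 = \<bar>K\<bar> + 1"
  have "compact ((\<lambda>x. m x - m y0) ` {y0 - K1..y0 + K1})"
    using continuous_on_subset[OF m_cont] by (intro compact_continuous_image continuous_intros) auto
  then obtain B where B: "\<And>x. x \<in> {y0 - K1..y0 + K1} \<Longrightarrow> \<bar>m x - m y0\<bar> \<le> B"
    using compact_imp_bounded bounded_iff by (metis (no_types, lifting) imageI real_norm_def)
  obtain n r where nr: "\<bar>r\<bar> \<le> \<epsilon> / 2" "agree B (translate (m y0) T') (translate (t + real_of_int n + r) T')"
    using minimal_unit_translation_dense[OF T'_tiling min, of "\<epsilon> / 2"] \<epsilon> by (metis half_gt_zero)
  define y where "y = inv m (t + real_of_int n + r)"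
  have my: "m y = t + real_of_int n + r" using m_surj by (simp add: y_def surj_f_inv_f)
  have "agree K1 (translate y0 T) (translate y T)"
    by (rule agree_shape[of K1 y0 B]) (use B nr my in \<open>auto simp: K1_def abs_le_iff\<close>)
  then have "agree K (translate y0 T) (translate y T)" by (rule agree_mono) (simp add: K1_def)
  moreover have "\<bar>m y + real_of_int (- n) - t\<bar> < \<epsilon>" using my nr(1) \<epsilon> by simp
  ultimately show ?thesis by blast
qed

end

section \<open>The line result for forms of either sign\<close>

context recurrent_line
begin

text \<open>The sign of \<open>\<mu>\<close> determines that of the displacement: a point \<open>y\<close> far to the right of \<open>x\<close> in
  its pattern class lies between \<open>x\<close> and some \<open>f^n x\<close> with \<open>n > 0\<close>.\<close>

lemma line_semiconjugacy_pos:
  assumes \<mu>: "equivariant R \<mu>" "\<And>x. (m has_real_derivative \<mu> x) (at x)" "\<And>x. \<mu> x > 0"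
    and d: "equivariant R d" "f = (\<lambda>x. x + d x)" "inj f"
    and rot: "\<And>x1 x2 p n. E R x1 x2 \<Longrightarrow> real_of_int p < m x2 - m x1 \<Longrightarrow> m x2 - m x1 < real_of_int n \<Longrightarrow>
        strictly_between x2 (int_iterate f p x1) (int_iterate f n x1)"
    and dense: "\<And>t \<epsilon>. \<epsilon> > 0 \<Longrightarrow> \<exists>y n. E R 0 y \<and> \<bar>m y + real_of_int n - t\<bar> < \<epsilon>"
  shows "\<exists>h. (\<forall>x. h (f x) = h x + 1) \<and> weakly_equivariant (\<lambda>x. h x - m x)"
proof -
  obtain D where D: "D > 0" "\<And>x. \<bar>d x\<bar> \<le> D" using weakly_equivariant_bounded[OF equivariant_weakly_equivariant[OF d(1)]] by blast
  have fcont: "continuous_on UNIV f" using d(1) by (auto simp: equivariant_def d(2) intro!: continuous_intros)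
  have fD: "\<bar>f x - x\<bar> \<le> D" for x using D(2) by (simp add: d(2))
  note f_sm = displacement_strict_mono(1)[OF fcont d(3) fD]
  note f_bij = displacement_strict_mono(2)[OF fcont d(3) fD]
  have f_gt: "x < f x" for x
  proof (rule ccontr)
    assume "\<not> x < f x"
    then have le: "f x \<le> x" by simp
    obtain L where L: "\<And>x z. \<exists>y. \<bar>y - z\<bar> \<le> L \<and> E R x y" using E_recur by metis
    obtain y where "\<bar>y - (x + L + 1)\<bar> \<le> L" "E R x y" using L by blast
    then have y: "x < y" "E R x y" by auto
    have "m x < m y" using DERIV_pos_imp_increasing[OF y(1), of m] \<mu>(2,3) by blast
    moreover obtain n :: nat where n: "m y - m x < real n" using reals_Archimedean2 by blast
    ultimately have "strictly_between y (int_iterate f 0 x) (int_iterate f (int n) x)"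
      by (intro rot y(2)) auto
    moreover have "(f ^^ n) x \<le> x"
    proof (induction n)
      case (Suc n)
      have "f ((f ^^ n) x) \<le> f x" using Suc f_sm by (simp add: strict_mono_less_eq)
      then show ?case using le by simp
    qed simp
    ultimately show False using y(1) by (auto simp: strictly_between_def int_iterate_def)
  qed
  have mono: "int_iterate f p x < int_iterate f n x" if "p < n" for p n x
    using that
  proof (induction rule: int_less_induct)
    case base
    show ?case using int_iterate_Suc[OF f_bij, of "n - 1" x] f_gt by simp
  next
    case (step p)
    then show ?case using int_iterate_Suc[OF f_bij, of "p - 1" x] f_gt[of "int_iterate f (p - 1) x"] by simp
  qed
  interpret rotation_line E R D \<mu> m d f
  proof
    fix x1 x2 and n :: int assume E: "E R x1 x2"
    \<comment> \<open>The rotation property asks for integers on both sides of m x2 - m x1; p and q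
      supply the side that is not given.\<close>
    define p where "p = \<lfloor>m x2 - m x1\<rfloor> - 1"
    define q where "q = \<lfloor>m x2 - m x1\<rfloor> + 1"
    have pq: "real_of_int p < m x2 - m x1" "m x2 - m x1 < real_of_int q" unfolding p_def q_def by linarith+
    show "x2 < int_iterate f n x1" if "m x2 - m x1 < real_of_int n"
    proof -
      have "p < n" using pq(1) that by linarith
      then show ?thesis using rot[OF E pq(1) that] mono[of p n x1] by (simp add: strictly_between_def)
    qed
    show "int_iterate f n x1 < x2" if "real_of_int n < m x2 - m x1"
    proof -
      have "n < q" using pq(2) that by linarith
      then show ?thesis using rot[OF E that pq(2)] mono[of n q x1] by (simp add: strictly_between_def)
    qed
  qed (use \<mu> d D dense in auto)
  show ?thesis using semiconj_f semiconj_minus_m_weakly_equivariant by blast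
qed

text \<open>A negative \<mu> is reduced to the positive case by passing to \<open>inv f\<close> and
  - m: if h increases by 1 under \<open>inv f\<close>, then - h increases by 1 under f. Density is
  assumed for all radii because the displacement of \<open>inv f\<close> has a larger one.\<close>

lemma line_semiconjugacy:
  assumes \<mu>: "equivariant R \<mu>" "\<And>x. (m has_real_derivative \<mu> x) (at x)" "(\<forall>x. \<mu> x > 0) \<or> (\<forall>x. \<mu> x < 0)"
    and d: "equivariant R d" "f = (\<lambda>x. x + d x)" "inj f"
    and rot: "\<And>x1 x2 p n. E R x1 x2 \<Longrightarrow> real_of_int p < m x2 - m x1 \<Longrightarrow> m x2 - m x1 < real_of_int n \<Longrightarrow>
        strictly_between x2 (int_iterate f p x1) (int_iterate f n x1)"
    and dense: "\<And>t \<epsilon> R. \<epsilon> > 0 \<Longrightarrow> \<exists>y n. E R 0 y \<and> \<bar>m y + real_of_int n - t\<bar> < \<epsilon>"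
  shows "\<exists>h. (\<forall>x. h (f x) = h x + 1) \<and> weakly_equivariant (\<lambda>x. h x - m x)"
proof (cases "\<forall>x. \<mu> x > 0")
  case True
  then show ?thesis using line_semiconjugacy_pos[OF \<mu>(1,2) _ d rot dense] by blast
next
  case False
  then have neg: "\<mu> x < 0" for x using \<mu>(3) by blast
  obtain D where D: "D > 0" "\<And>x. \<bar>d x\<bar> \<le> D" using weakly_equivariant_bounded[OF equivariant_weakly_equivariant[OF d(1)]] by blast
  have fcont: "continuous_on UNIV f" using d(1) by (auto simp: equivariant_def d(2) intro!: continuous_intros)
  have fD: "\<bar>f x - x\<bar> \<le> D" for x using D(2) by (simp add: d(2))
  note f_bij = displacement_strict_mono(2)[OF fcont d(3) fD]
  have "\<exists>h. (\<forall>x. h (inv f x) = h x + 1) \<and> weakly_equivariant (\<lambda>x. h x - (- m x))"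
  proof (rule line_semiconjugacy_pos)
    show "equivariant (R + D) (\<lambda>x. - \<mu> x)"
      using equivariant_mono[OF \<mu>(1), of "R + D"] D(1) by (auto simp: equivariant_def intro!: continuous_intros)
    show "((\<lambda>x. - m x) has_real_derivative - \<mu> x) (at x)" for x by (intro DERIV_minus \<mu>(2))
    show "- \<mu> x > 0" for x using neg by simp
    show "equivariant (R + D) (\<lambda>x. inv f x - x)" by (rule inverse_equivariant(1)[OF d(1) D(2) d(2,3)])
    show "inv f = (\<lambda>x. x + (inv f x - x))" by simp
    show "inj (inv f)" using f_bij by (simp add: bij_imp_bij_inv bij_is_inj)
    show "\<exists>y n. E (R + D) 0 y \<and> \<bar>- m y + real_of_int n - t\<bar> < \<epsilon>" if \<epsilon>: "\<epsilon> > 0" for t \<epsilon>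
    proof -
      obtain y n where "E (R + D) 0 y" "\<bar>m y + real_of_int n - (- t)\<bar> < \<epsilon>" using dense[OF \<epsilon>] by blast
      then show ?thesis by (intro exI[of _ y] exI[of _ "- n"]) (auto simp: abs_less_iff)
    qed
    show "strictly_between x2 (int_iterate (inv f) p x1) (int_iterate (inv f) n x1)"
      if "E (R + D) x1 x2" "real_of_int p < - m x2 - - m x1" "- m x2 - - m x1 < real_of_int n" for x1 x2 p n
    proof -
      have "E R x1 x2" using E_mono[OF that(1), of R] D(1) by simp
      then have "strictly_between x2 (int_iterate f (- n) x1) (int_iterate f (- p) x1)"
        using that(2,3) by (intro rot) auto
      then show ?thesis by (simp add: int_iterate_inv[OF f_bij] strictly_between_def min.commute max.commute)
    qed
  qed
  then obtain h where h: "\<And>x. h (inv f x) = h x + 1" "weakly_equivariant (\<lambda>x. h x - (- m x))" by blast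
  have "- h (f x) = - h x + 1" for x using h(1)[of "f x"] inv_f_f[OF d(3), of x] by simp
  moreover have "(\<lambda>x. - 1 * (h x - - m x)) = (\<lambda>x. - h x - m x)" by auto
  then have "weakly_equivariant (\<lambda>x. - h x - m x)" using weakly_equivariant_scale[OF h(2), of "- 1"] by simp
  ultimately show ?thesis by (intro exI[of _ "\<lambda>x. - h x"] conjI allI)
qed

text \<open>By recurrence \<mu> is bounded below by some c > 0, so m grows at least linearly in both
  directions.\<close>

lemma antiderivative_surj:
  assumes "equivariant R \<mu>" "\<And>x. (m has_real_derivative \<mu> x) (at x)" "\<And>x. \<mu> x > 0"
  shows "surj m"
proof -
  obtain c where c: "c > 0" "\<And>x. c \<le> \<mu> x" using equivariant_pos_lower_bound[OF assms(1,3)] by blast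
  have inc: "m x + c * (y - x) \<le> m y" if "x \<le> y" for x y
  proof -
    have "m x - c * x \<le> m y - c * y"
    proof (rule DERIV_nonneg_imp_nondecreasing[OF that])
      fix z show "\<exists>D. ((\<lambda>x. m x - c * x) has_real_derivative D) (at z) \<and> 0 \<le> D"
        by (intro exI[of _ "\<mu> z - c * 1"] conjI DERIV_diff assms(2) DERIV_cmult DERIV_ident)
          (use c in simp)
    qed
    then show ?thesis by (simp add: algebra_simps)
  qed
  have cont: "continuous_on UNIV m"
    using assms(2) by (meson DERIV_isCont continuous_at_imp_continuous_on)
  have "y \<in> range m" for y
  proof -
    define r where "r = \<bar>y - m 0\<bar> / c"
    have r: "0 \<le> r" "c * r = \<bar>y - m 0\<bar>" using c(1) by (auto simp: r_def)
    have "m (- r) \<le> y" "y \<le> m r" using inc[of "- r" 0] inc[of 0 r] r by auto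
    then obtain x where "m x = y"
      using IVT'[of m "- r" y r] r(1) continuous_on_subset[OF cont] by auto
    then show ?thesis by blast
  qed
  then show ?thesis by blast
qed

end

subsection \<open>From an orbit to the whole space\<close>

lemma LBINT_antiderivative:
  fixes m \<mu> :: "real \<Rightarrow> real"
  assumes "continuous_on UNIV \<mu>" "\<And>x. (m has_real_derivative \<mu> x) (at x)"
  shows "(LBINT x=a..b. \<mu> x) = m b - m a"
  using assms(2) continuous_on_subset[OF assms(1)]
  by (intro interval_integral_FTC_finite)
    (auto simp: has_real_derivative_iff_has_vector_derivative[symmetric] has_field_derivative_at_within)

lemma LBINT_has_derivative:
  fixes \<mu> :: "real \<Rightarrow> real"
  assumes "continuous_on UNIV \<mu>"
  shows "((\<lambda>x. LBINT y=0..x. \<mu> y) has_real_derivative \<mu> x) (at x)"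
proof -
  have "((\<lambda>u. LBINT y=ereal 0..ereal u. \<mu> y) has_vector_derivative \<mu> x) (at x within {- \<bar>x\<bar> - 1..\<bar>x\<bar> + 1})"
    by (rule interval_integral_FTC2) (use continuous_on_subset[OF assms] in auto)
  moreover have "at x within {- \<bar>x\<bar> - 1..\<bar>x\<bar> + 1} = at x" by (intro at_within_Icc_at) auto
  ultimately show ?thesis
    by (simp add: has_real_derivative_iff_has_vector_derivative zero_ereal_def)
qed

locale pointed_tiling_space = minimal_tiling_space \<Omega> for \<Omega> :: "'l tiling set" +
  fixes T :: "'l tiling" assumes T_mem: "T \<in> \<Omega>"
begin

sublocale line: recurrent_line "\<lambda>K x y. agree K (translate x T) (translate y T)"
proof
  fix K show "\<exists>L. \<forall>x z. \<exists>y. \<bar>y - z\<bar> \<le> L \<and> agree K (translate x T) (translate y T)"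
  proof -
    obtain L where L: "\<And>S S'. S \<in> \<Omega> \<Longrightarrow> S' \<in> \<Omega> \<Longrightarrow> \<exists>y. \<bar>y\<bar> \<le> L \<and> agree K S (translate y S')"
      using recur by metis
    have "\<exists>y. \<bar>y - z\<bar> \<le> L \<and> agree K (translate x T) (translate y T)" for x z
    proof -
      obtain y where "\<bar>y\<bar> \<le> L" "agree K (translate x T) (translate y (translate z T))"
        using L[OF invariant[OF T_mem] invariant[OF T_mem]] by blast
      then show ?thesis by (intro exI[of _ "z + y"]) (simp add: translate_translate)
    qed
    then show ?thesis by blast
  qed
next
  fix K x y s K' assume "agree K (translate x T) (translate y T)" "\<bar>s\<bar> \<le> K - K'"
  then have "agree K' (translate s (translate x T)) (translate s (translate y T))" by (rule agree_translate)
  then show "agree K' (translate (x + s) T) (translate (y + s) T)" by (simp add: translate_translate)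
qed (auto intro: agree_refl agree_sym agree_trans)

lemma equivariant_eq_PE_radius: "line.equivariant R \<phi> \<longleftrightarrow> PE_radius T R \<phi>"
  unfolding line.equivariant_def PE_radius_def ..

lemma sPE_equivariant: "sPE T \<phi> \<Longrightarrow> \<exists>R>0. line.equivariant R \<phi>"
  by (simp add: sPE_def equivariant_eq_PE_radius)

lemma sPE_weakly_equivariant: "sPE T \<phi> \<Longrightarrow> line.weakly_equivariant \<phi>"
  using sPE_equivariant line.equivariant_weakly_equivariant by blast

lemma wPE_weakly_equivariant:
  assumes "wPE T \<phi>" shows "line.weakly_equivariant \<phi>"
proof -
  obtain \<psi> where \<psi>: "\<And>n. sPE T (\<psi> n)" "uniform_limit UNIV \<psi> \<phi> sequentially"
    using assms unfolding wPE_def by blast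
  have "\<exists>R. line.equivariant R (\<psi> n)" for n using sPE_equivariant[OF \<psi>(1)] by blast
  then show ?thesis using \<psi>(2) by (rule line.weakly_equivariant_uniform_limit)
qed

lemma orbit_approx: "S \<in> \<Omega> \<Longrightarrow> \<exists>x. agree K S (translate x T)"
  using recur T_mem by blast

lemma translate_inj: "translate x T = translate y T \<Longrightarrow> x = y"
proof -
  assume "translate x T = translate y T"
  then have "translate (- y) (translate x T) = translate (- y) (translate y T)" by simp
  then have "translate (x - y) T = T" by (simp add: translate_translate)
  then show "x = y" using nonper[OF T_mem, of "x - y"] by simp
qed

text \<open>If T - x_k agrees with S on growing windows, the values \<psi>(x_k) form a Cauchy
  sequence. The conclusion is kept as an estimate: it serves both for continuity and for
  transferring identities from the orbit to the space.\<close>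

lemma weakly_equivariant_extends:
  assumes "line.weakly_equivariant \<psi>"
  shows "\<exists>\<Psi>. \<forall>\<epsilon>>0. \<exists>K. \<forall>S\<in>\<Omega>. \<forall>x. agree K S (translate x T) \<longrightarrow> \<bar>\<Psi> S - \<psi> x\<bar> \<le> \<epsilon>"
proof -
  define X where "X S k = (SOME x. agree (real k) S (translate x T))" for S k
  have X: "agree (real k) S (translate (X S k) T)" if "S \<in> \<Omega>" for S k
    unfolding X_def by (rule someI_ex[OF orbit_approx[OF that]])
  define \<Psi> where "\<Psi> S = lim (\<lambda>k. \<psi> (X S k))" for S
  have near: "\<exists>R. \<forall>S\<in>\<Omega>. \<forall>x. agree R S (translate x T) \<longrightarrow> (\<forall>k. R \<le> real k \<longrightarrow> \<bar>\<psi> (X S k) - \<psi> x\<bar> \<le> \<epsilon>)"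
    if \<epsilon>: "\<epsilon> > 0" for \<epsilon>
  proof -
    obtain R where R: "\<And>x y. agree R (translate x T) (translate y T) \<Longrightarrow> \<bar>\<psi> x - \<psi> y\<bar> \<le> \<epsilon>"
      using assms \<epsilon> unfolding line.weakly_equivariant_def by blast
    have "\<bar>\<psi> (X S k) - \<psi> x\<bar> \<le> \<epsilon>" if "S \<in> \<Omega>" "agree R S (translate x T)" "R \<le> real k" for S x k
      using R agree_mono[OF X[OF that(1)] that(3)] that(2) agree_sym agree_trans by metis
    then show ?thesis by blast
  qed
  have conv: "(\<lambda>k. \<psi> (X S k)) \<longlonglongrightarrow> \<Psi> S" if S: "S \<in> \<Omega>" for S
  proof -
    have "Cauchy (\<lambda>k. \<psi> (X S k))"
    proof (rule metric_CauchyI)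
      fix e :: real assume "e > 0"
      then have "e / 2 > 0" by simp
      then obtain R where R: "\<And>x k. agree R S (translate x T) \<Longrightarrow> R \<le> real k \<Longrightarrow> \<bar>\<psi> (X S k) - \<psi> x\<bar> \<le> e / 2"
        using near S by meson
      obtain N :: nat where N: "R \<le> real N" using real_arch_simple by blast
      have "dist (\<psi> (X S k)) (\<psi> (X S l)) < e" if "N \<le> k" "N \<le> l" for k l
      proof -
        have "R \<le> real k" "R \<le> real l" using N that by linarith+
        then have "\<bar>\<psi> (X S k) - \<psi> (X S l)\<bar> \<le> e / 2" using R agree_mono[OF X[OF S]] by blast
        then show ?thesis using \<open>e > 0\<close> by (simp add: dist_real_def)
      qed
      then show "\<exists>M. \<forall>m\<ge>M. \<forall>n\<ge>M. dist (\<psi> (X S m)) (\<psi> (X S n)) < e" by blast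
    qed
    then show ?thesis
      unfolding \<Psi>_def using Cauchy_convergent convergent_LIMSEQ_iff by blast
  qed
  show ?thesis
  proof (intro exI[of _ \<Psi>] allI impI)
    fix \<epsilon> :: real assume "\<epsilon> > 0"
    then obtain R where R: "\<And>S x k. S \<in> \<Omega> \<Longrightarrow> agree R S (translate x T) \<Longrightarrow> R \<le> real k \<Longrightarrow> \<bar>\<psi> (X S k) - \<psi> x\<bar> \<le> \<epsilon>"
      using near by meson
    obtain N :: nat where N: "R \<le> real N" using real_arch_simple by blast
    have "\<bar>\<Psi> S - \<psi> x\<bar> \<le> \<epsilon>" if S: "S \<in> \<Omega>" "agree R S (translate x T)" for S x
    proof (rule tendsto_upperbound)
      show "(\<lambda>k. \<bar>\<psi> (X S k) - \<psi> x\<bar>) \<longlonglongrightarrow> \<bar>\<Psi> S - \<psi> x\<bar>" by (intro tendsto_intros conv S(1))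
      show "\<forall>\<^sub>F k in sequentially. \<bar>\<psi> (X S k) - \<psi> x\<bar> \<le> \<epsilon>"
        unfolding eventually_sequentially using R[OF S] N by (intro exI[of _ N]) auto
    qed simp
    then show "\<exists>K. \<forall>S\<in>\<Omega>. \<forall>x. agree K S (translate x T) \<longrightarrow> \<bar>\<Psi> S - \<psi> x\<bar> \<le> \<epsilon>" by blast
  qed
qed

section \<open>Continuity on the tiling space\<close>

lemma topspace_space_topology: "topspace (space_topology \<Omega>) = \<Omega>"
  using tilings by (auto simp: space_topology_def tiling_topology_def)

lemma continuous_dist:
  assumes "continuous_map (space_topology \<Omega>) euclideanreal \<Phi>" "S \<in> \<Omega>" "\<epsilon> > 0"
  shows "\<exists>r>0. \<forall>S'\<in>\<Omega>. tiling_dist S S' < r \<longrightarrow> \<bar>\<Phi> S' - \<Phi> S\<bar> < \<epsilon>"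
proof -
  have "openin (space_topology \<Omega>) {S' \<in> topspace (space_topology \<Omega>). \<Phi> S' \<in> ball (\<Phi> S) \<epsilon>}"
    using assms(1) by (intro openin_continuous_map_preimage[of _ euclideanreal]) auto
  then obtain U where U: "openin tiling_topology U" "{S' \<in> \<Omega>. \<Phi> S' \<in> ball (\<Phi> S) \<epsilon>} = U \<inter> \<Omega>"
    unfolding topspace_space_topology unfolding space_topology_def openin_subtopology by blast
  have "S \<in> {S' \<in> \<Omega>. \<Phi> S' \<in> ball (\<Phi> S) \<epsilon>}" using assms(2,3) by simp
  then have "S \<in> U" using U(2) by blast
  then obtain r where r: "r > 0" "tiling.mball S r \<subseteq> U"
    using U(1) unfolding tiling_topology_def tiling.openin_mtopology by blast
  have "\<bar>\<Phi> S' - \<Phi> S\<bar> < \<epsilon>" if S': "S' \<in> \<Omega>" "tiling_dist S S' < r" for S'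
  proof -
    have "S' \<in> tiling.mball S r"
      using tilings[OF assms(2)] tilings[OF S'(1)] S'(2) by (simp add: tiling.in_mball)
    then have "S' \<in> {S' \<in> \<Omega>. \<Phi> S' \<in> ball (\<Phi> S) \<epsilon>}" using r(2) S'(1) U(2) by blast
    then show ?thesis by (simp add: dist_real_def abs_minus_commute)
  qed
  then show ?thesis using r(1) by blast
qed

lemma continuous_agree:
  assumes "continuous_map (space_topology \<Omega>) euclideanreal \<Phi>" "S \<in> \<Omega>" "\<epsilon> > 0"
  shows "\<exists>K. \<forall>S'\<in>\<Omega>. agree K S S' \<longrightarrow> \<bar>\<Phi> S' - \<Phi> S\<bar> < \<epsilon>"
proof -
  obtain r where r: "r > 0" "\<And>S'. S' \<in> \<Omega> \<Longrightarrow> tiling_dist S S' < r \<Longrightarrow> \<bar>\<Phi> S' - \<Phi> S\<bar> < \<epsilon>"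
    using continuous_dist[OF assms] by blast
  have "\<bar>\<Phi> S' - \<Phi> S\<bar> < \<epsilon>" if S': "S' \<in> \<Omega>" "agree (inverse (r / 2)) S S'" for S'
  proof -
    have "tiling_dist S S' \<le> r / 2"
      by (rule tiling_dist_le_agree[of _ 0]) (use r(1) S'(2) in auto)
    then show ?thesis using r(1) by (intro r(2) S'(1)) linarith
  qed
  then show ?thesis by blast
qed

lemma continuous_on_orbit:
  assumes "continuous_map (space_topology \<Omega>) euclideanreal \<Phi>"
  shows "continuous_on UNIV (\<lambda>x. \<Phi> (translate x T))"
  unfolding continuous_on_iff
proof (intro ballI allI impI)
  fix x \<epsilon> :: real assume "\<epsilon> > 0"
  then obtain r where r: "r > 0"
    "\<And>S'. S' \<in> \<Omega> \<Longrightarrow> tiling_dist (translate x T) S' < r \<Longrightarrow> \<bar>\<Phi> S' - \<Phi> (translate x T)\<bar> < \<epsilon>"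
    using continuous_dist[OF assms invariant[OF T_mem]] by metis
  have "dist (\<Phi> (translate y T)) (\<Phi> (translate x T)) < \<epsilon>" if "dist y x < r / 4" for y
  proof -
    have xy: "\<bar>x - y\<bar> \<le> r / 4" using that by (simp add: dist_real_def abs_minus_commute)
    have "tiling_dist (translate x T) (translate y T) \<le> r / 2"
      by (rule tiling_dist_le_agree[of _ "x - y"])
        (use r(1) xy in \<open>auto simp: translate_translate agree_refl\<close>)
    then have "tiling_dist (translate x T) (translate y T) < r" using r(1) by linarith
    then show ?thesis using r(2)[OF invariant[OF T_mem]] by (simp add: dist_real_def)
  qed
  then show "\<exists>\<delta>>0. \<forall>y\<in>UNIV. dist y x < \<delta> \<longrightarrow> dist (\<Phi> (translate y T)) (\<Phi> (translate x T)) < \<epsilon>"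
    using r(1) by (intro exI[of _ "r / 4"]) auto
qed

lemma continuous_map_spaceI:
  assumes "\<And>S. S \<in> \<Omega> \<Longrightarrow> H S \<in> \<Omega>"
    and "\<And>S e. S \<in> \<Omega> \<Longrightarrow> e > 0 \<Longrightarrow> \<exists>d>0. \<forall>S'\<in>\<Omega>. tiling_dist S S' < d \<longrightarrow> tiling_dist (H S) (H S') < e"
  shows "continuous_map (space_topology \<Omega>) (space_topology \<Omega>) H"
proof -
  have "continuous_map (space_topology \<Omega>) tiling.mtopology H"
    unfolding tiling.continuous_map_to_metric topspace_space_topology
  proof (intro ballI allI impI)
    fix S and e :: real assume S: "S \<in> \<Omega>" and "e > 0"
    obtain d where d: "d > 0" "\<And>S'. S' \<in> \<Omega> \<Longrightarrow> tiling_dist S S' < d \<Longrightarrow> tiling_dist (H S) (H S') < e"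
      using assms(2)[OF S \<open>e > 0\<close>] by blast
    have "openin (space_topology \<Omega>) (tiling.mball S d \<inter> \<Omega>)"
      unfolding space_topology_def tiling_topology_def by (intro openin_subtopology_Int) simp
    moreover have "S \<in> tiling.mball S d \<inter> \<Omega>" using d(1) S tilings by simp
    moreover have "\<forall>S'\<in>tiling.mball S d \<inter> \<Omega>. H S' \<in> tiling.mball (H S) e"
      using d(2) assms(1) tilings S by (auto simp: tiling.in_mball)
    ultimately show "\<exists>U. openin (space_topology \<Omega>) U \<and> S \<in> U \<and> (\<forall>S'\<in>U. H S' \<in> tiling.mball (H S) e)"
      by blast
  qed
  then show ?thesis
    unfolding space_topology_def[of \<Omega>] continuous_map_in_subtopology
    using assms(1) topspace_space_topology by (auto simp: tiling_topology_def space_topology_def)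
qed

text \<open>\<open>sPE_on_space\<close> speaks of the orbit of one tiling U. Every S is approximated
  by translates of U, and continuity of \<Phi> carries the equality over.\<close>

lemma displacement_agree:
  assumes "sPE_on_space \<Omega> \<Phi>"
  shows "\<exists>R>0. \<forall>S\<in>\<Omega>. \<forall>S'\<in>\<Omega>. agree R S S' \<longrightarrow> \<Phi> S = \<Phi> S'"
proof -
  have cont: "continuous_map (space_topology \<Omega>) euclideanreal \<Phi>" using assms by (simp add: sPE_on_space_def)
  obtain U where U: "U \<in> \<Omega>" "sPE U (\<lambda>x. \<Phi> (translate x U))" using assms unfolding sPE_on_space_def by blast
  then obtain R where R: "R > 0"
    "\<And>x y. agree R (translate x U) (translate y U) \<Longrightarrow> \<Phi> (translate x U) = \<Phi> (translate y U)"
    unfolding sPE_def PE_radius_def by blast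
  have "\<Phi> S = \<Phi> S'" if S: "S \<in> \<Omega>" "S' \<in> \<Omega>" "agree R S S'" for S S'
  proof (rule ccontr)
    assume "\<Phi> S \<noteq> \<Phi> S'"
    then have e: "\<bar>\<Phi> S - \<Phi> S'\<bar> / 2 > 0" by simp
    obtain K where K: "\<And>V. V \<in> \<Omega> \<Longrightarrow> agree K S V \<Longrightarrow> \<bar>\<Phi> V - \<Phi> S\<bar> < \<bar>\<Phi> S - \<Phi> S'\<bar> / 2"
      using continuous_agree[OF cont S(1) e] by blast
    obtain K' where K': "\<And>V. V \<in> \<Omega> \<Longrightarrow> agree K' S' V \<Longrightarrow> \<bar>\<Phi> V - \<Phi> S'\<bar> < \<bar>\<Phi> S - \<Phi> S'\<bar> / 2"
      using continuous_agree[OF cont S(2) e] by blast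
    \<comment> \<open>K gives closeness of the values, R preserves the pattern that S and S'
      share.\<close>
    obtain x where x: "agree (max K R) S (translate x U)" using recur S(1) U(1) by blast
    obtain y where y: "agree (max K' R) S' (translate y U)" using recur S(2) U(1) by blast
    have "agree R S (translate x U)" "agree R S' (translate y U)"
      using agree_mono[OF x, of R] agree_mono[OF y, of R] by auto
    then have "agree R (translate x U) (translate y U)" using S(3) by (meson agree_sym agree_trans)
    then have "\<Phi> (translate x U) = \<Phi> (translate y U)" by (rule R(2))
    moreover have "\<bar>\<Phi> (translate x U) - \<Phi> S\<bar> < \<bar>\<Phi> S - \<Phi> S'\<bar> / 2"
      by (rule K[OF invariant[OF U(1)]]) (use agree_mono[OF x, of K] in simp)
    moreover have "\<bar>\<Phi> (translate y U) - \<Phi> S'\<bar> < \<bar>\<Phi> S - \<Phi> S'\<bar> / 2"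
      by (rule K'[OF invariant[OF U(1)]]) (use agree_mono[OF y, of K'] in simp)
    ultimately show False by argo
  qed
  then show ?thesis using R(1) by blast
qed

text \<open>\<open>eq\<close> says that x + \<psi> x turns the orbit map of F into the translation
  by \<rho>; the identity passes to all S by approximation with translates of T.\<close>

lemma semi_conjugate_translation:
  assumes F: "\<And>S. S \<in> \<Omega> \<Longrightarrow> F S = translate (\<Phi> S) S"
    and \<Phi>: "\<And>S S'. S \<in> \<Omega> \<Longrightarrow> S' \<in> \<Omega> \<Longrightarrow> agree R S S' \<Longrightarrow> \<Phi> S = \<Phi> S'"
    and \<psi>: "line.weakly_equivariant \<psi>"
    and eq: "\<And>x. \<Phi> (translate x T) + \<psi> (x + \<Phi> (translate x T)) = \<psi> x + \<rho>"
  shows "semi_conjugate (space_topology \<Omega>) F (space_topology \<Omega>) (translate \<rho>)"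
proof -
  obtain \<Psi> where \<Psi>: "\<And>\<epsilon>. \<epsilon> > 0 \<Longrightarrow> \<exists>K. \<forall>S\<in>\<Omega>. \<forall>x. agree K S (translate x T) \<longrightarrow> \<bar>\<Psi> S - \<psi> x\<bar> \<le> \<epsilon>"
    using weakly_equivariant_extends[OF \<psi>] by blast
  obtain B where B: "\<And>S. S \<in> \<Omega> \<Longrightarrow> \<bar>\<Psi> S\<bar> \<le> B"
  proof -
    obtain b where b: "\<And>x. \<bar>\<psi> x\<bar> \<le> b" using line.weakly_equivariant_bounded[OF \<psi>] by blast
    obtain K where K: "\<And>S x. S \<in> \<Omega> \<Longrightarrow> agree K S (translate x T) \<Longrightarrow> \<bar>\<Psi> S - \<psi> x\<bar> \<le> 1"
      using \<Psi>[of 1] by auto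
    have "\<bar>\<Psi> S\<bar> \<le> b + 1" if S: "S \<in> \<Omega>" for S
    proof -
      obtain x where "agree K S (translate x T)" using orbit_approx[OF S] by blast
      then show ?thesis using K[OF S] b[of x] by fastforce
    qed
    then show ?thesis using that by blast
  qed
  have \<Psi>_agree: "\<exists>K. \<forall>S\<in>\<Omega>. \<forall>S'\<in>\<Omega>. agree K S S' \<longrightarrow> \<bar>\<Psi> S - \<Psi> S'\<bar> \<le> \<epsilon>" if \<epsilon>: "\<epsilon> > 0" for \<epsilon>
  proof -
    obtain K where K: "\<And>S x. S \<in> \<Omega> \<Longrightarrow> agree K S (translate x T) \<Longrightarrow> \<bar>\<Psi> S - \<psi> x\<bar> \<le> \<epsilon> / 2"
      using \<Psi>[OF half_gt_zero[OF \<epsilon>]] by blast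
    have "\<bar>\<Psi> S - \<Psi> S'\<bar> \<le> \<epsilon>" if S: "S \<in> \<Omega>" "S' \<in> \<Omega>" "agree K S S'" for S S'
    proof -
      obtain x where x: "agree K S (translate x T)" using orbit_approx[OF S(1)] by blast
      then have x': "agree K S' (translate x T)" using S(3) agree_sym agree_trans by blast
      show ?thesis using K[OF S(1) x] K[OF S(2) x'] by linarith
    qed
    then show ?thesis by blast
  qed
  \<comment> \<open>The metric allows a small shift besides agreement on a window, so continuity of
    H also needs control of \<Psi> along the flow.\<close>
  have \<Psi>_shift: "\<exists>\<delta>>0. \<forall>S\<in>\<Omega>. \<forall>s. \<bar>s\<bar> \<le> \<delta> \<longrightarrow> \<bar>\<Psi> (translate s S) - \<Psi> S\<bar> \<le> \<epsilon>" if \<epsilon>: "\<epsilon> > 0" for \<epsilon>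
  proof -
    have e3: "\<epsilon> / 3 > 0" using \<epsilon> by simp
    obtain K where K: "\<And>S x. S \<in> \<Omega> \<Longrightarrow> agree K S (translate x T) \<Longrightarrow> \<bar>\<Psi> S - \<psi> x\<bar> \<le> \<epsilon> / 3"
      using \<Psi>[OF e3] by blast
    obtain \<delta> where \<delta>: "\<delta> > 0" "\<And>x s. \<bar>s\<bar> \<le> \<delta> \<Longrightarrow> \<bar>\<psi> (x + s) - \<psi> x\<bar> \<le> \<epsilon> / 3"
      using line.weakly_equivariant_uniformly_continuous[OF \<psi> e3] by blast
    have "\<bar>\<Psi> (translate s S) - \<Psi> S\<bar> \<le> \<epsilon>" if S: "S \<in> \<Omega>" and s: "\<bar>s\<bar> \<le> \<delta>" for S s
    proof -
      obtain x where x: "agree (K + \<bar>s\<bar>) S (translate x T)" using orbit_approx[OF S] by blast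
      have "agree K (translate s S) (translate s (translate x T))" by (rule agree_translate[OF x]) simp
      then have 1: "agree K (translate s S) (translate (x + s) T)" by (simp add: translate_translate)
      have 2: "agree K S (translate x T)" by (rule agree_mono[OF x]) simp
      show ?thesis using K[OF invariant[OF S] 1] K[OF S 2] \<delta>(2)[OF s, of x] by linarith
    qed
    then show ?thesis using \<delta>(1) by blast
  qed
  define H where "H S = translate (\<Psi> S) S" for S
  have "continuous_map (space_topology \<Omega>) (space_topology \<Omega>) H"
  proof (rule continuous_map_spaceI)
    show "H S \<in> \<Omega>" if "S \<in> \<Omega>" for S unfolding H_def by (rule invariant[OF that])
    fix S and e :: real assume S: "S \<in> \<Omega>" and e: "e > 0"
    \<comment> \<open>\<Psi> varies twice by at most e/16 and the shift s is at most e/8: together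
      e/4, the shift permitted at distance e/2.\<close>
    then have e16: "e / 16 > 0" by simp
    obtain K where K: "\<And>S S'. S \<in> \<Omega> \<Longrightarrow> S' \<in> \<Omega> \<Longrightarrow> agree K S S' \<Longrightarrow> \<bar>\<Psi> S - \<Psi> S'\<bar> \<le> e / 16"
      using \<Psi>_agree[OF e16] by blast
    obtain \<delta> where \<delta>: "\<delta> > 0" "\<And>S s. S \<in> \<Omega> \<Longrightarrow> \<bar>s\<bar> \<le> \<delta> \<Longrightarrow> \<bar>\<Psi> (translate s S) - \<Psi> S\<bar> \<le> e / 16"
      using \<Psi>_shift[OF e16] by blast
    \<comment> \<open>\<open>B\<close> is the room lost when the tilings are translated by \<Psi>
      S.\<close>
    obtain r where r: "0 < r" "r \<le> 1" "r \<le> min \<delta> (e / 8)" "max K (inverse (e / 2) + B) \<le> inverse r - r"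
      using ex_small_with_large_inverse[of "min \<delta> (e / 8)" "max K (inverse (e / 2) + B)"] \<delta>(1) e by auto
    have "tiling_dist (H S) (H S') < e" if S': "S' \<in> \<Omega>" "tiling_dist S S' < r" for S'
    proof -
      obtain s where s: "\<bar>s\<bar> \<le> r" "agree (inverse r - r) S (translate s S')"
        using tiling_close_dist[OF S'(2) r(2)] .
      have "agree K S (translate s S')" by (rule agree_mono[OF s(2)]) (use r(4) in simp)
      then have "\<bar>\<Psi> S - \<Psi> (translate s S')\<bar> \<le> e / 16" by (rule K[OF S invariant[OF S'(1)]])
      moreover have "\<bar>\<Psi> (translate s S') - \<Psi> S'\<bar> \<le> e / 16" by (rule \<delta>(2)[OF S'(1)]) (use s r in simp)
      moreover have "\<bar>s\<bar> \<le> e / 8" using s r(3) by simp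
      ultimately have small: "\<bar>\<Psi> S + s - \<Psi> S'\<bar> \<le> (e / 2) / 2" by linarith
      have "agree (inverse (e / 2)) (translate (\<Psi> S) S) (translate (\<Psi> S) (translate s S'))"
        by (rule agree_translate[OF s(2)]) (use B[OF S] r(4) in simp)
      then have "agree (inverse (e / 2)) (H S) (translate (\<Psi> S + s - \<Psi> S') (H S'))"
        by (simp add: H_def translate_translate add.commute)
      then have "tiling_dist (H S) (H S') \<le> e / 2"
        using e small by (intro tiling_dist_le_agree) auto
      then show ?thesis using e by simp
    qed
    then show "\<exists>d>0. \<forall>S'\<in>\<Omega>. tiling_dist S S' < d \<longrightarrow> tiling_dist (H S) (H S') < e"
      using r(1) by blast
  qed
  moreover have "translate \<rho> (H S) = H (F S)" if S: "S \<in> \<Omega>" for S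
  proof -
    have "\<bar>\<Phi> S + \<Psi> (F S) - (\<Psi> S + \<rho>)\<bar> \<le> \<epsilon>" if \<epsilon>: "\<epsilon> > 0" for \<epsilon>
    proof -
      obtain K where K: "\<And>S x. S \<in> \<Omega> \<Longrightarrow> agree K S (translate x T) \<Longrightarrow> \<bar>\<Psi> S - \<psi> x\<bar> \<le> \<epsilon> / 2"
        using \<Psi>[OF half_gt_zero[OF \<epsilon>]] by blast
      \<comment> \<open>R makes \<Phi> S equal to \<Phi>(T - x); K + |\<Phi> S| keeps agreement of
        radius K after F is applied.\<close>
      obtain x where x: "agree (max R (K + \<bar>\<Phi> S\<bar>)) S (translate x T)" using orbit_approx[OF S] by blast
      have "agree R S (translate x T)" by (rule agree_mono[OF x]) simp
      then have \<Phi>x: "\<Phi> S = \<Phi> (translate x T)" by (rule \<Phi>[OF S invariant[OF T_mem]])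
      have 1: "agree K S (translate x T)" by (rule agree_mono[OF x]) simp
      have "agree K (translate (\<Phi> S) S) (translate (\<Phi> S) (translate x T))"
        by (rule agree_translate[OF x]) simp
      then have 2: "agree K (F S) (translate (x + \<Phi> S) T)" by (simp add: F[OF S] translate_translate)
      have "F S \<in> \<Omega>" using invariant[OF S] F[OF S] by simp
      from K[OF this 2] K[OF S 1] eq[of x, folded \<Phi>x] show ?thesis by linarith
    qed
    then have "\<bar>\<Phi> S + \<Psi> (F S) - (\<Psi> S + \<rho>)\<bar> \<le> 0" by (rule field_le_epsilon[of _ 0, simplified])
    then have "\<Psi> S + \<rho> = \<Phi> S + \<Psi> (F S)" by simp
    then have "translate (\<Psi> S + \<rho>) S = translate (\<Phi> S + \<Psi> (F S)) S" by simp
    also have "\<dots> = translate (\<Psi> (F S)) (F S)" using F[OF S] by (simp add: translate_translate)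
    finally show ?thesis by (simp add: H_def translate_translate)
  qed
  ultimately show ?thesis
    unfolding semi_conjugate_def topspace_space_topology by blast
qed

end

lemma (in pointed_tiling_space) rotation_values_dense:
  assumes \<mu>: "0 < R" "PE_radius T R \<mu>" "(\<forall>x. \<mu> x > 0) \<or> (\<forall>x. \<mu> x < 0)"
    and min: "minimal_map (space_topology (shape_change T R \<mu>)) (translate 1)"
    and \<epsilon>: "\<epsilon> > 0"
  shows "\<exists>y n. agree K (translate x T) (translate y T) \<and>
           \<bar>(LBINT z=0..y. \<mu> z) + real_of_int n - t\<bar> < \<epsilon>"
proof -
  define m where "m x = (LBINT z=0..x. \<mu> z)" for x :: real
  have deriv: "(m has_real_derivative \<mu> x) (at x)" for x
    unfolding m_def by (rule LBINT_has_derivative) (use \<mu>(2) in \<open>simp add: PE_radius_def\<close>)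
  have equivariant: "line.equivariant R \<mu>" using \<mu>(2) by (simp add: equivariant_eq_PE_radius)
  have neg_deriv: "((\<lambda>x. - m x) has_real_derivative - \<mu> x) (at x)" for x by (intro DERIV_minus deriv)
  have mono: "strict_mono m \<or> strict_mono (\<lambda>x. - m x)"
    using \<mu>(3)
  proof
    assume "\<forall>x. \<mu> x > 0"
    then have "strict_mono m" using DERIV_pos_imp_increasing deriv by (intro strict_monoI) blast
    then show ?thesis ..
  next
    assume *: "\<forall>x. \<mu> x < 0"
    have "strict_mono (\<lambda>x. - m x)"
    proof (rule strict_monoI)
      fix x y :: real assume "x < y"
      then show "- m x < - m y"
        by (rule DERIV_pos_imp_increasing) (use neg_deriv * in \<open>meson neg_0_less_iff_less\<close>)
    qed
    then show ?thesis ..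
  qed
  have surj: "surj m"
    using \<mu>(3)
  proof
    assume "\<forall>x. \<mu> x > 0"
    then show ?thesis using line.antiderivative_surj[OF equivariant deriv] by blast
  next
    assume *: "\<forall>x. \<mu> x < 0"
    have "line.equivariant R (\<lambda>x. - \<mu> x)" using equivariant by (auto simp: line.equivariant_def intro!: continuous_intros)
    then have "surj (\<lambda>x. - m x)" using line.antiderivative_surj[OF _ neg_deriv] * by simp
    then have "\<exists>x. y = m x" for y using surjD[of "\<lambda>x. - m x" "- y"] by simp
    then show ?thesis by (simp add: surj_def)
  qed
  interpret tiling_shape_change \<Omega> T R \<mu> m
    using T_mem \<mu>(1,2) deriv mono surj by unfold_locales auto
  have "T' = shape_change_tiling T R \<mu>"
    unfolding T'_def shape_change_tiling_def lab_def m_def ..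
  then show ?thesis
    using values_dense_mod_1[of \<epsilon> K x t] min \<epsilon> by (simp add: shape_change_def m_def)
qed

lemma cohomologous_antiderivatives:
  assumes "is_d a \<mu>" "is_d b \<nu>" "is_d k (\<lambda>x. \<nu> x - \<mu> x)"
  shows "b y - b x = a y - a x + (k y - k x)"
proof -
  have "((\<lambda>x. b x - a x - k x) has_real_derivative \<nu> x - \<mu> x - (\<nu> x - \<mu> x)) (at x)" for x
    using assms by (intro DERIV_diff) (auto simp: is_d_def)
  then have "b x - a x - k x = b y - a y - k y"
    using DERIV_isconst_all[of "\<lambda>x. b x - a x - k x" x y] by simp
  then show ?thesis by simp
qed

theorem theorem4:
  fixes \<Omega> :: "'l tiling set" and T :: "'l tiling"
    and F :: "'l tiling \<Rightarrow> 'l tiling" and C :: "(real \<Rightarrow> real) set"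
  assumes "tiling_space \<Omega>" and "uniquely_ergodic \<Omega>"
    and "F \<in> sPE_homeos \<Omega>"
    and "T \<in> \<Omega>"
    and "rotation_class F T C" and "irrational_class T C"
    and "C \<in> dx_plus_AN T"
  shows "\<exists>G. uniform_translation G \<and>
           semi_conjugate (space_topology \<Omega>) F (space_topology \<Omega>) G"
proof -
  interpret minimal_tiling_space \<Omega> by (rule minimal_tiling_spaceI[OF assms(1)])
  interpret pointed_tiling_space \<Omega> T using assms(4) by unfold_locales

  obtain \<Phi> where F: "\<And>S. S \<in> \<Omega> \<Longrightarrow> F S = translate (\<Phi> S) S" and \<Phi>: "sPE_on_space \<Omega> \<Phi>"
    using assms(3) unfolding sPE_homeos_def by blast
  obtain R1 where R1: "\<And>S S'. S \<in> \<Omega> \<Longrightarrow> S' \<in> \<Omega> \<Longrightarrow> agree R1 S S' \<Longrightarrow> \<Phi> S = \<Phi> S'"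
    using displacement_agree[OF \<Phi>] by blast
  define d where "d x = \<Phi> (translate x T)" for x
  define f where "f x = x + d x" for x
  have d_equivariant: "line.equivariant R1 d"
    unfolding line.equivariant_def d_def
    using continuous_on_orbit \<Phi> R1[OF invariant[OF T_mem] invariant[OF T_mem]]
    by (auto simp: sPE_on_space_def)
  have F_orbit: "F (translate x T) = translate (f x) T" for x
    using F[OF invariant[OF T_mem]] by (simp add: translate_translate f_def d_def)
  have orbit_map: "orbit_map F T = f"
  proof
    fix x show "orbit_map F T x = f x"
      unfolding orbit_map_def F_orbit by (rule the_equality) (auto dest: translate_inj)
  qed
  have f_inj: "inj f"
  proof (rule injI)
    fix x y assume "f x = f y"
    then have "F (translate x T) = F (translate y T)" by (simp add: F_orbit)
    moreover have "inj_on F \<Omega>"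
      using assms(3) homeomorphic_imp_injective_map topspace_space_topology
      unfolding sPE_homeos_def by fastforce
    ultimately have "translate x T = translate y T"
      using invariant[OF T_mem] by (auto dest: inj_onD)
    then show "x = y" by (rule translate_inj)
  qed

  obtain \<mu> R2 where \<mu>C: "\<mu> \<in> C" and \<mu>: "R2 > 0" "PE_radius T R2 \<mu>" "(\<forall>x. \<mu> x > 0) \<or> (\<forall>x. \<mu> x < 0)"
      "minimal_map (space_topology (shape_change T R2 \<mu>)) (translate 1)"
    using assms(6) unfolding irrational_class_def by blast
  define m where "m x = (LBINT z=0..x. \<mu> z)" for x :: real
  have \<mu>_equivariant: "line.equivariant R2 \<mu>" using \<mu>(2) by (simp add: equivariant_eq_PE_radius)
  have m_deriv: "(m has_real_derivative \<mu> x) (at x)" for x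
    unfolding m_def by (rule LBINT_has_derivative) (use \<mu>(2) in \<open>simp add: PE_radius_def\<close>)
  have dense: "\<exists>y n. agree K (translate 0 T) (translate y T) \<and> \<bar>m y + real_of_int n - t\<bar> < \<epsilon>"
    if "\<epsilon> > 0" for t \<epsilon> K
    unfolding m_def by (rule rotation_values_dense[OF \<mu> that])

  obtain \<nu> where \<nu>C: "\<nu> \<in> C" and "rotation_form F T \<nu>" and C: "C \<in> H1 T"
    using assms(5) unfolding rotation_class_def by blast
  then obtain R3 where \<nu>: "sPE T \<nu>" and R3: "\<And>x1 x2 p n. agree R3 (translate x1 T) (translate x2 T) \<Longrightarrow>
      real_of_int p < (LBINT x=x1..x2. \<nu> x) \<Longrightarrow> (LBINT x=x1..x2. \<nu> x) < real_of_int n \<Longrightarrow>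
      strictly_between x2 (int_iterate f p x1) (int_iterate f n x1)"
    unfolding rotation_form_def orbit_map by blast
  have "(\<nu>, \<mu>) \<in> cohomologous T"
    using in_quotient_imp_in_rel[OF equiv_cohomologous C[unfolded H1_def]] \<mu>C \<nu>C by blast
  then obtain k where k: "sPE T k" "is_d k (\<lambda>x. \<mu> x - \<nu> x)" unfolding cohomologous_def by blast
  obtain R4 where R4: "line.equivariant R4 k" using sPE_equivariant[OF k(1)] by blast
  have \<nu>_cont: "continuous_on UNIV \<nu>" using \<nu> by (auto simp: sPE_def PE_radius_def)
  define R where "R = max (max R1 R2) (max R3 R4)"
  \<comment> \<open>\<mu> and the rotation form \<nu> differ by dk, and k takes equal values at
    points with the same pattern. Their integrals between such points coincide, so the rotation
    property passes to \<mu>.\<close>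
  have rot: "strictly_between x2 (int_iterate f p x1) (int_iterate f n x1)"
    if E: "agree R (translate x1 T) (translate x2 T)"
      and lt: "real_of_int p < m x2 - m x1" "m x2 - m x1 < real_of_int n" for x1 x2 p n
  proof -
    define m1 where "m1 x = (LBINT z=0..x. \<nu> z)" for x :: real
    have m1: "(m1 has_real_derivative \<nu> x) (at x)" for x
      unfolding m1_def by (rule LBINT_has_derivative[OF \<nu>_cont])
    have "agree R4 (translate x1 T) (translate x2 T)" "agree R3 (translate x1 T) (translate x2 T)"
      by (rule agree_mono[OF E]; simp add: R_def)+
    then have "k x1 = k x2" and E3: "agree R3 (translate x1 T) (translate x2 T)"
      using R4 by (auto simp: line.equivariant_def)
    then have "m x2 - m x1 = m1 x2 - m1 x1"
      using cohomologous_antiderivatives[of m1 \<nu> m \<mu> k x2 x1] k(2) m1 m_deriv by (simp add: is_d_def)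
    also have "\<dots> = (LBINT x=x1..x2. \<nu> x)" using LBINT_antiderivative[OF \<nu>_cont m1] by simp
    finally show ?thesis using R3[OF E3] lt by simp
  qed
  have "\<exists>h. (\<forall>x. h (f x) = h x + 1) \<and> line.weakly_equivariant (\<lambda>x. h x - m x)"
  proof (rule line.line_semiconjugacy[OF _ m_deriv \<mu>(3) _ _ f_inj rot dense])
    show "line.equivariant R \<mu>" "line.equivariant R d"
      by (rule line.equivariant_mono[OF \<mu>_equivariant] line.equivariant_mono[OF d_equivariant]; simp add: R_def)+
    show "f = (\<lambda>x. x + d x)" by (simp add: f_def fun_eq_iff)
  qed
  then obtain h where h: "\<And>x. h (f x) = h x + 1" "line.weakly_equivariant (\<lambda>x. h x - m x)" by blast

  \<comment> \<open>\<open>A\<close> contributes a constant c and \<open>B\<close> a form with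
    weakly equivariant primitive, each up to a coboundary; hence m x = c x + w x up to a
    constant.\<close>
  obtain A B where AB: "C = class_add A B" "A \<in> dx_line T" "B \<in> H1_AN T"
    using assms(7) unfolding dx_plus_AN_def by blast
  obtain c where c: "A = coh_class T (\<lambda>x. c)" using AB(2) unfolding dx_line_def by blast
  obtain \<alpha> \<beta> where \<alpha>: "B \<in> H1 T" "\<alpha> \<in> B" "wPE T \<beta>" "is_d \<beta> \<alpha>" using AB(3) unfolding H1_AN_def by blast
  obtain a b where ab: "\<mu> = (\<lambda>x. a x + b x)" "a \<in> A" "b \<in> B"
    using \<mu>C AB(1) unfolding class_add_def by blast
  obtain k1 where k1: "sPE T k1" "is_d k1 (\<lambda>x. a x - c)"
    using ab(2) c unfolding coh_class_def cohomologous_def by blast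
  have "(\<alpha>, b) \<in> cohomologous T"
    using in_quotient_imp_in_rel[OF equiv_cohomologous \<alpha>(1)[unfolded H1_def]] \<alpha>(2) ab(3) by blast
  then obtain k2 where k2: "sPE T k2" "is_d k2 (\<lambda>x. b x - \<alpha> x)" unfolding cohomologous_def by blast
  define w where "w x = k1 x + k2 x + \<beta> x" for x
  have w_equivariant: "line.weakly_equivariant w"
    unfolding w_def by (intro line.weakly_equivariant_add sPE_weakly_equivariant wPE_weakly_equivariant k1 k2 \<alpha>)
  have "(w has_real_derivative (a x - c) + (b x - \<alpha> x) + \<alpha> x) (at x)" for x
    unfolding w_def using k1(2) k2(2) \<alpha>(4) by (intro DERIV_add) (auto simp: is_d_def)
  moreover have "a x - c + (b x - \<alpha> x) + \<alpha> x = \<mu> x - c" for x by (simp add: ab(1))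
  ultimately have "is_d w (\<lambda>x. \<mu> x - c)" unfolding is_d_def by metis
  moreover have "is_d (\<lambda>x. c * x) (\<lambda>x. c)" by (auto simp: is_d_def intro!: derivative_eq_intros)
  moreover have "is_d m \<mu>" using m_deriv by (simp add: is_d_def)
  ultimately have m_w: "m y - m x = c * y - c * x + (w y - w x)" for x y
    using cohomologous_antiderivatives by blast
  \<comment> \<open>For c = 0 the function m would be bounded, and so would h, which grows by 1 at
    each step of the f-orbit of 0.\<close>
  have "c \<noteq> 0"
  proof
    assume "c = 0"
    obtain B where B: "\<And>x. \<bar>w x\<bar> \<le> B" using line.weakly_equivariant_bounded[OF w_equivariant] by blast
    obtain C where C: "\<And>x. \<bar>h x - m x\<bar> \<le> C" using line.weakly_equivariant_bounded[OF h(2)] by blast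
    have hn: "h ((f ^^ n) 0) = h 0 + real n" for n by (induction n) (auto simp: h(1))
    obtain n :: nat where "2 * B + 2 * C < real n" using reals_Archimedean2 by blast
    then show False
      using hn[of n] C[of 0] C[of "(f ^^ n) 0"] B[of 0] B[of "(f ^^ n) 0"] m_w[of "(f ^^ n) 0" 0] \<open>c = 0\<close>
      by (simp add: abs_le_iff)
  qed

  \<comment> \<open>Up to a constant this is h x / c - x; written through h - m and w, its weak
    equivariance is visible.\<close>
  define \<psi> where "\<psi> x = 1 / c * ((h x - m x) + w x)" for x
  have "line.weakly_equivariant \<psi>"
    unfolding \<psi>_def by (intro line.weakly_equivariant_scale line.weakly_equivariant_add h(2) w_equivariant)
  moreover have "d x + \<psi> (x + d x) = \<psi> x + 1 / c" for x
  proof -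
    have "c * (d x + \<psi> (x + d x)) = c * d x + (h (f x) - m (f x) + w (f x))"
      using \<open>c \<noteq> 0\<close> by (simp add: \<psi>_def f_def distrib_left)
    also have "\<dots> = h x - m x + w x + 1" using h(1)[of x] m_w[of "f x" x] by (simp add: f_def algebra_simps)
    also have "\<dots> = c * (\<psi> x + 1 / c)" using \<open>c \<noteq> 0\<close> by (simp add: \<psi>_def distrib_left)
    finally show ?thesis using \<open>c \<noteq> 0\<close> by simp
  qed
  ultimately have "semi_conjugate (space_topology \<Omega>) F (space_topology \<Omega>) (translate (1 / c))"
    by (intro semi_conjugate_translation[where \<Phi> = \<Phi> and R = R1 and \<psi> = \<psi>] F R1)
      (simp_all add: d_def)
  moreover have "uniform_translation (translate (1 / c) :: 'l tiling \<Rightarrow> 'l tiling)"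
    unfolding uniform_translation_def using \<open>c \<noteq> 0\<close> by (intro exI[of _ "1 / c"]) simp
  ultimately show ?thesis by blast
qed

end
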